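(* Let $(R,\mathfrak m)$ be an F-finite Gorenstein local ring of characteristic $p>0$. If $f\in\mathfrak m$ is a nonzero divisor such that $R/(f)$ is F-pure, then $R$ is F-pure, $\mathrm{fpt}(R/(f))\le\mathrm{fpt}(R)-\mathrm{ord}(f)$, and $\mathrm{dfpt}(R)\le\mathrm{dfpt}(R/(f))$.
   Context: Rings are commutative Noetherian of prime characteristic $p$. A ring is F-finite if its Frobenius map is finite; $F^e_*(R)$ is $R$ viewed as an $R$-module via the $e$-th iterate of Frobenius. An F-finite ring $R$ is F-pure if $R\to F_*(R)$ splits $R$-linearly. $\mathrm{ord}(f)=\max\{i\mid f\in\mathfrak m^i\}$. For an F-finite F-pure local ring $(R,\mathfrak m)$ and $\lambda\ge0$, the pair $(R,\mathfrak m^\lambda)$ is F-pure if for all $e\gg0$ there is $f\in\mathfrak m^{\lfloor\lambda(p^e-1)\rfloor}$ such that the $R$-linear map $R\to F^e_*(R)$, $1\mapsto F^e_*(f)$, splits; $\mathrm{fpt}(R)=\sup\{\lambda\ge 0\mid (R,\mathfrak m^\lambda)\text{ is F-pure}\}$, and $\mathrm{dfpt}(R)=\dim(R)-\mathrm{fpt}(R)$. *)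

theory Defs
  imports "HOL-Algebra.Algebra" "HOL-Library.Extended_Real"
begin

section \<open>Local rings and Krull dimension\<close>

definition local_noetherian_ring :: "('a, 'm) ring_scheme \<Rightarrow> bool" where
  "local_noetherian_ring R \<longleftrightarrow> cring R \<and> noetherian_ring R \<and> (\<exists>!I. maximalideal I R)"

definition max_ideal :: "('a, 'm) ring_scheme \<Rightarrow> 'a set" where
  "max_ideal R = (THE I. maximalideal I R)"

definition has_characteristic :: "('a, 'm) ring_scheme \<Rightarrow> nat \<Rightarrow> bool" where
  "has_characteristic R p \<longleftrightarrow> (\<forall>n::nat. add_pow R n \<one>\<^bsub>R\<^esub> = \<zero>\<^bsub>R\<^esub> \<longleftrightarrow> p dvd n)"

definition nonzerodivisor :: "('a, 'm) ring_scheme \<Rightarrow> 'a \<Rightarrow> bool" where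
  "nonzerodivisor R f \<longleftrightarrow>
     f \<in> carrier R \<and> (\<forall>x\<in>carrier R. f \<otimes>\<^bsub>R\<^esub> x = \<zero>\<^bsub>R\<^esub> \<longrightarrow> x = \<zero>\<^bsub>R\<^esub>)"

definition krull_dim :: "('a, 'm) ring_scheme \<Rightarrow> enat" where
  "krull_dim R = (SUP n \<in> {n::nat. \<exists>P. (\<forall>i\<le>n. primeideal (P i) R) \<and> (\<forall>i<n. P i \<subset> P (Suc i))}. enat n)"

fun ideal_power :: "('a, 'm) ring_scheme \<Rightarrow> 'a set \<Rightarrow> nat \<Rightarrow> 'a set" where
  "ideal_power R I 0 = carrier R"
| "ideal_power R I (Suc n) = ideal_prod R I (ideal_power R I n)"

text \<open>The order of vanishing with respect to the maximal ideal. The supremum is a maximum exactly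
  when it is finite; over a Noetherian local ring this is the case for every nonzero \<open>f\<close>
  (Krull's intersection theorem).\<close>

definition ord_at_max :: "('a, 'm) ring_scheme \<Rightarrow> 'a \<Rightarrow> enat" where
  "ord_at_max R f = (SUP i \<in> {i::nat. f \<in> ideal_power R (max_ideal R) i}. enat i)"


section \<open>Modules and homomorphisms\<close>

text \<open>Modules extend the record of rings, so the fields \<open>mult\<close> and \<open>one\<close> have to be filled in
  below; the locale \<^locale>\<open>module\<close> ignores them.\<close>

definition module_hom ::
    "('a, 'm) ring_scheme \<Rightarrow> ('a, 'b, 'k) module_scheme \<Rightarrow> ('a, 'c, 'l) module_scheme \<Rightarrow> ('b \<Rightarrow> 'c) set" where
  "module_hom R M N =
     {h. h \<in> carrier M \<rightarrow> carrier N
       \<and> (\<forall>x\<in>carrier M. \<forall>y\<in>carrier M. h (x \<oplus>\<^bsub>M\<^esub> y) = h x \<oplus>\<^bsub>N\<^esub> h y)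
       \<and> (\<forall>r\<in>carrier R. \<forall>x\<in>carrier M. h (r \<odot>\<^bsub>M\<^esub> x) = r \<odot>\<^bsub>N\<^esub> h x)}"

definition finitely_generated_module ::
    "('a, 'm) ring_scheme \<Rightarrow> ('a, 'b, 'k) module_scheme \<Rightarrow> bool" where
  "finitely_generated_module R M \<longleftrightarrow>
     (\<exists>S\<subseteq>carrier M. finite S \<and>
        (\<forall>x\<in>carrier M. \<exists>c\<in>S \<rightarrow> carrier R. x = finsum M (\<lambda>s. c s \<odot>\<^bsub>M\<^esub> s) S))"

definition self_module :: "('a, 'm) ring_scheme \<Rightarrow> ('a, 'a) module" where
  "self_module R =
     \<lparr>carrier = carrier R, monoid.mult = monoid.mult R, one = one R, ring.zero = ring.zero R, add = add R,
      smult = monoid.mult R\<rparr>"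


section \<open>Gorenstein local rings\<close>

text \<open>The test modules \<open>M\<close>, \<open>N\<close> live on the same type as \<open>J\<close>. This is no restriction as soon as
  that type admits an injection from the carrier of \<open>R\<close>: by Baer's criterion, ideals of \<open>R\<close> inside
  \<open>R\<close> suffice as test inclusions.\<close>

definition injective_module :: "('a, 'm) ring_scheme \<Rightarrow> ('a, 'b) module \<Rightarrow> bool" where
  "injective_module R J \<longleftrightarrow> module R J \<and>
     (\<forall>(M :: ('a, 'b) module) (N :: ('a, 'b) module) h g.
        module R M \<and> module R N \<and> h \<in> module_hom R M N \<and> inj_on h (carrier M)
          \<and> g \<in> module_hom R M J
        \<longrightarrow> (\<exists>g'\<in>module_hom R N J. \<forall>x\<in>carrier M. g' (h x) = g x))"

text \<open>Exactness of \<open>0 \<rightarrow> M \<rightarrow> J 0 \<rightarrow> J 1 \<rightarrow> \<dots>\<close> with augmentation \<open>aug\<close> and differentials \<open>d\<close>.\<close>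

definition injective_resolution ::
    "('a, 'm) ring_scheme \<Rightarrow> ('a, 'c) module \<Rightarrow> (nat \<Rightarrow> ('a, 'b) module)
      \<Rightarrow> ('c \<Rightarrow> 'b) \<Rightarrow> (nat \<Rightarrow> 'b \<Rightarrow> 'b) \<Rightarrow> bool" where
  "injective_resolution R M J aug d \<longleftrightarrow>
     (\<forall>i. injective_module R (J i))
     \<and> aug \<in> module_hom R M (J 0) \<and> inj_on aug (carrier M)
     \<and> (\<forall>i. d i \<in> module_hom R (J i) (J (Suc i)))
     \<and> aug ` carrier M = {x \<in> carrier (J 0). d 0 x = \<zero>\<^bsub>J (Suc 0)\<^esub>}
     \<and> (\<forall>i. d i ` carrier (J i) = {x \<in> carrier (J (Suc i)). d (Suc i) x = \<zero>\<^bsub>J (Suc (Suc i))\<^esub>})"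

text \<open>Finite injective dimension of \<open>R\<close> over itself. HOL cannot quantify over the types carrying the
  modules of a resolution, so these are taken on \<open>'a \<times> nat\<close>. This loses nothing for Noetherian \<open>R\<close>:
  every module of cardinality at most \<open>max |R| \<aleph>\<^sub>0\<close> embeds into an injective module of cardinality
  at most \<open>max |R| \<aleph>\<^sub>0\<close> (adjoin extensions of the homomorphisms from the, finitely generated, ideals
  of \<open>R\<close>, and iterate countably often), so \<open>R\<close> has an injective resolution on this type, and
  whether the injective dimension is at most \<open>n\<close> can be read off from any resolution.\<close>

definition finite_self_injective_dimension :: "('a, 'm) ring_scheme \<Rightarrow> bool" where
  "finite_self_injective_dimension R \<longleftrightarrow>
     (\<exists>(J :: nat \<Rightarrow> ('a, 'a \<times> nat) module) aug d n.
        injective_resolution R (self_module R) J aug d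
        \<and> (\<forall>i>n. carrier (J i) = {\<zero>\<^bsub>J i\<^esub>}))"

definition gorenstein_local_ring :: "('a, 'm) ring_scheme \<Rightarrow> bool" where
  "gorenstein_local_ring R \<longleftrightarrow> local_noetherian_ring R \<and> finite_self_injective_dimension R"


section \<open>Frobenius pushforwards, F-purity and F-pure thresholds\<close>

definition frobenius_module :: "nat \<Rightarrow> nat \<Rightarrow> ('a, 'm) ring_scheme \<Rightarrow> ('a, 'a) module" where
  "frobenius_module p e R =
     \<lparr>carrier = carrier R, monoid.mult = monoid.mult R, one = one R, ring.zero = ring.zero R, add = add R,
      smult = (\<lambda>r x. (r [^]\<^bsub>R\<^esub> (p ^ e)) \<otimes>\<^bsub>R\<^esub> x)\<rparr>"

definition F_finite :: "nat \<Rightarrow> ('a, 'm) ring_scheme \<Rightarrow> bool" where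
  "F_finite p R \<longleftrightarrow> finitely_generated_module R (frobenius_module p 1 R)"

text \<open>The \<open>R\<close>-linear map from \<open>R\<close> to its \<open>e\<close>-th Frobenius pushforward with \<open>1 \<mapsto> f\<close> has an
  \<open>R\<close>-linear left inverse.\<close>

definition frobenius_splits :: "nat \<Rightarrow> nat \<Rightarrow> ('a, 'm) ring_scheme \<Rightarrow> 'a \<Rightarrow> bool" where
  "frobenius_splits p e R f \<longleftrightarrow>
     (\<exists>\<theta>\<in>module_hom R (frobenius_module p e R) (self_module R).
        \<forall>r\<in>carrier R. \<theta> (r \<odot>\<^bsub>frobenius_module p e R\<^esub> f) = r)"

definition F_pure :: "nat \<Rightarrow> ('a, 'm) ring_scheme \<Rightarrow> bool" where
  "F_pure p R \<longleftrightarrow> frobenius_splits p 1 R \<one>\<^bsub>R\<^esub>"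

definition F_pure_pair :: "nat \<Rightarrow> ('a, 'm) ring_scheme \<Rightarrow> real \<Rightarrow> bool" where
  "F_pure_pair p R l \<longleftrightarrow>
     (\<forall>\<^sub>F e in sequentially.
        \<exists>f\<in>ideal_power R (max_ideal R) (nat \<lfloor>l * (real p ^ e - 1)\<rfloor>). frobenius_splits p e R f)"

definition fpt :: "nat \<Rightarrow> ('a, 'm) ring_scheme \<Rightarrow> ereal" where
  "fpt p R = (SUP l \<in> {l::real. 0 \<le> l \<and> F_pure_pair p R l}. ereal l)"

definition dfpt :: "nat \<Rightarrow> ('a, 'm) ring_scheme \<Rightarrow> ereal" where
  "dfpt p R = ereal_of_enat (krull_dim R) - fpt p R"

end

theory Submission
  imports Defs
begin

text \<open>The crucial fact is that \<open>Ext\<^sup>1(F\<^sup>e\<^sub>*R, R) = 0\<close> over a Gorenstein local ring. It lets every \<open>R\<close>-linear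
  \<open>\<phi> : F\<^sup>e\<^sub>*(R/f) \<rightarrow> R/f\<close> be lifted to some \<open>\<psi> : F\<^sup>e\<^sub>*R \<rightarrow> R\<close>. With \<open>q = p\<^sup>e\<close>, the map \<open>\<psi>\<close> sends \<open>fR\<close> into
  itself, so \<open>\<chi>(x) = \<psi>(fx)/f\<close> is \<open>R\<close>-linear, and \<open>f\<chi>(f\<^sup>q\<^sup>-\<^sup>1x) = \<psi>(f\<^sup>qx) = f\<psi>(x)\<close>. Hence a splitting of
  \<open>1 \<mapsto> F\<^sup>e\<^sub>*(g)\<close> over \<open>R/f\<close> gives one of \<open>1 \<mapsto> F\<^sup>e\<^sub>*(f\<^sup>q\<^sup>-\<^sup>1g)\<close> over \<open>R\<close>, and \<open>f\<^sup>q\<^sup>-\<^sup>1\<close> contributes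
  \<open>(q - 1) ord(f)\<close> to the power of the maximal ideal. The inequality between the defects then
  only needs \<open>dim R \<le> dim R/f + 1\<close>, which is Krull's principal ideal theorem.

  For the vanishing, finite self-injective dimension gives a regular sequence \<open>x\<close> for which
  \<open>R/(x)\<close> is self-injective (Bass). The powers \<open>x\<^sup>q\<close> are again regular, that is, \<open>x\<close> is regular on
  \<open>F\<^sup>e\<^sub>*R\<close>; so \<open>Ext\<^sup>1(F\<^sup>e\<^sub>*R, R/(x)) = 0\<close>, and Nakayama's lemma removes the members of \<open>x\<close> one by one.\<close>

section \<open>Ideals of Noetherian rings\<close>

text \<open>No Ext group is formed. Vanishing of Ext^1(R^k/K, N) is the statement that every linear
  map K -> N extends to R^k; higher groups appear only as cocycles modulo coboundaries among the
  elements of a resolution killed by an ideal. The types force this: the resolution lives on one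
  fixed type, while R^k, R/I and F^e_*R live on others. Injectivity is therefore reduced at once to
  Baer's condition on ideals, which mentions no test module. Nakayama's lemma needs finite
  generation, which such implicit Ext groups do not display. The substitute is divisibility: where x
  acts surjectively, each element starts an infinite sequence of successive quotients by x, and
  comparing finitely many values in a Noetherian module R^m shows that the element vanishes. Two
  facts finish the argument. The lifted map has value 1 at g only modulo f, but f lies in the
  maximal ideal, so this value is a unit and can be divided out. And for f in the i-th power of the
  maximal ideal, i(q - 1) is an integer, so adding i to lambda raises floor(lambda (q - 1)) by
  exactly i(q - 1), for every e.\<close>

definition adjoin :: "('a, 'm) ring_scheme \<Rightarrow> 'a set \<Rightarrow> 'a \<Rightarrow> 'a set" where
  "adjoin R I a = {i \<oplus>\<^bsub>R\<^esub> r \<otimes>\<^bsub>R\<^esub> a | i r. i \<in> I \<and> r \<in> carrier R}"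

text \<open>This is the kernel of multiplication by \<open>a\<close> from R to R/I, whence the exact
  sequence 0 -> R/(I:a) -> R/I -> R/(I+aR) -> 0 behind the later reductions. The equation
  \<open>colon R I a = I\<close> says that \<open>a\<close> is a nonzerodivisor on R/I.\<close>

definition colon :: "('a, 'm) ring_scheme \<Rightarrow> 'a set \<Rightarrow> 'a \<Rightarrow> 'a set" where
  "colon R I a = {r \<in> carrier R. r \<otimes>\<^bsub>R\<^esub> a \<in> I}"

lemma ideal_subset: "ideal I R \<Longrightarrow> I \<subseteq> carrier R"
  by (simp add: additive_subgroup.a_subset ideal.axioms(1))

lemma ideal_carrier: "ideal I R \<Longrightarrow> x \<in> I \<Longrightarrow> x \<in> carrier R"
  by (meson ideal.Icarr)

lemma ideal_zero: "ideal I R \<Longrightarrow> \<zero>\<^bsub>R\<^esub> \<in> I"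
  by (simp add: additive_subgroup.zero_closed ideal.axioms(1))

lemma ideal_add: "ideal I R \<Longrightarrow> x \<in> I \<Longrightarrow> y \<in> I \<Longrightarrow> x \<oplus>\<^bsub>R\<^esub> y \<in> I"
  by (simp add: additive_subgroup.a_closed ideal.axioms(1))

lemma ideal_uminus: "ideal I R \<Longrightarrow> x \<in> I \<Longrightarrow> \<ominus>\<^bsub>R\<^esub> x \<in> I"
  using group.subgroupE(3)[of "add_monoid R" I x]
  by (simp add: a_inv_def additive_subgroup.a_subgroup ideal.axioms ring.is_abelian_group abelian_group.a_group)

lemma ideal_minus: "ideal I R \<Longrightarrow> x \<in> I \<Longrightarrow> y \<in> I \<Longrightarrow> x \<ominus>\<^bsub>R\<^esub> y \<in> I"
  unfolding a_minus_def by (simp add: ideal_add ideal_uminus)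

lemma ideal_lmult: "ideal I R \<Longrightarrow> r \<in> carrier R \<Longrightarrow> x \<in> I \<Longrightarrow> r \<otimes>\<^bsub>R\<^esub> x \<in> I"
  by (simp add: ideal.I_l_closed)

lemma ideal_rmult: "ideal I R \<Longrightarrow> r \<in> carrier R \<Longrightarrow> x \<in> I \<Longrightarrow> x \<otimes>\<^bsub>R\<^esub> r \<in> I"
  by (simp add: ideal.I_r_closed)

lemmas ideal_closed = ideal_zero ideal_add ideal_uminus ideal_minus ideal_lmult ideal_rmult

lemma (in cring) cring_idealI:
  assumes "I \<subseteq> carrier R" "\<zero> \<in> I" "\<And>x y. x \<in> I \<Longrightarrow> y \<in> I \<Longrightarrow> x \<oplus> y \<in> I"
    "\<And>r x. r \<in> carrier R \<Longrightarrow> x \<in> I \<Longrightarrow> r \<otimes> x \<in> I"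
  shows "ideal I R"
proof (rule idealI)
  show "ring R" by (rule ring_axioms)
  show "subgroup I (add_monoid R)"
  proof (rule add.subgroupI)
    show "\<ominus> a \<in> I" if a: "a \<in> I" for a
    proof -
      have "\<ominus> a = (\<ominus> \<one>) \<otimes> a" using a assms(1) by (auto simp: l_minus)
      then show ?thesis using assms(4)[of "\<ominus> \<one>" a] a by simp
    qed
  qed (use assms in auto)
  show "\<And>a x. a \<in> I \<Longrightarrow> x \<in> carrier R \<Longrightarrow> x \<otimes> a \<in> I" using assms by auto
  show "\<And>a x. a \<in> I \<Longrightarrow> x \<in> carrier R \<Longrightarrow> a \<otimes> x \<in> I" using assms by (metis m_comm subsetD)
qed

lemma (in cring) minus_swap:
  assumes "ideal I R" "a \<in> carrier R" "b \<in> carrier R" "a \<ominus> b \<in> I" "b \<in> I" shows "a \<in> I"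
proof -
  have "a = (a \<ominus> b) \<oplus> b" using assms(2,3) by Ring.algebra
  then show ?thesis using assms ideal_add[of I R "a \<ominus> b" b] by simp
qed

lemma (in cring) adjoin_memI:
  "ideal I R \<Longrightarrow> i \<in> I \<Longrightarrow> r \<in> carrier R \<Longrightarrow> x = i \<oplus> r \<otimes> a \<Longrightarrow> x \<in> adjoin R I a"
  unfolding adjoin_def by auto

lemma (in cring) adjoin_memE:
  assumes "x \<in> adjoin R I a"
  obtains i r where "i \<in> I" "r \<in> carrier R" "x = i \<oplus> r \<otimes> a"
  using assms unfolding adjoin_def by auto

lemma (in cring) adjoin_ideal:
  assumes I: "ideal I R" and a: "a \<in> carrier R"
  shows "ideal (adjoin R I a) R"
proof (rule cring_idealI)
  note c = ideal_carrier[OF I]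
  show "adjoin R I a \<subseteq> carrier R" using c a unfolding adjoin_def by auto
  show "\<zero> \<in> adjoin R I a"
    by (rule adjoin_memI[OF I ideal_zero[OF I] zero_closed]) (use a in simp)
  show "x \<oplus> y \<in> adjoin R I a" if "x \<in> adjoin R I a" "y \<in> adjoin R I a" for x y
  proof -
    from that obtain i r j s where "i \<in> I" "r \<in> carrier R" "x = i \<oplus> r \<otimes> a"
      "j \<in> I" "s \<in> carrier R" "y = j \<oplus> s \<otimes> a" by (auto elim!: adjoin_memE)
    then show ?thesis
      by (intro adjoin_memI[OF I ideal_add[OF I], of i j "r \<oplus> s"]) (use a c in \<open>simp_all, Ring.algebra\<close>)
  qed
  show "t \<otimes> x \<in> adjoin R I a" if "t \<in> carrier R" "x \<in> adjoin R I a" for t x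
  proof -
    from that obtain i r where "i \<in> I" "r \<in> carrier R" "x = i \<oplus> r \<otimes> a" by (auto elim!: adjoin_memE)
    with that show ?thesis
      by (intro adjoin_memI[OF I ideal_lmult[OF I], of t i "t \<otimes> r"]) (use a c in \<open>simp_all, Ring.algebra\<close>)
  qed
qed

lemma (in cring) adjoin_superset: 
  assumes "ideal I R" "a \<in> carrier R" shows "I \<subseteq> adjoin R I a"
proof
  fix x assume "x \<in> I" then show "x \<in> adjoin R I a"
    by (intro adjoin_memI[OF assms(1), of x \<zero>]) (use assms ideal_carrier[of I R] in auto)
qed

lemma (in cring) adjoin_self: 
  assumes "ideal I R" "a \<in> carrier R" shows "a \<in> adjoin R I a"
  by (intro adjoin_memI[OF assms(1) ideal_zero[OF assms(1)], of \<one>]) (use assms in auto)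

lemma (in cring) adjoin_minimal:
  assumes "ideal J R" "I \<subseteq> J" "a \<in> J" shows "adjoin R I a \<subseteq> J"
  using assms by (auto elim!: adjoin_memE intro: ideal_closed)

lemma (in cring) colon_ideal:
  assumes I: "ideal I R" and a: "a \<in> carrier R"
  shows "ideal (colon R I a) R"
  by (rule cring_idealI) (use a in \<open>auto simp: colon_def l_distr m_assoc intro: ideal_closed[OF I]\<close>)

lemma (in cring) colon_superset: 
  assumes "ideal I R" "a \<in> carrier R" shows "I \<subseteq> colon R I a"
  using assms unfolding colon_def by (auto intro: ideal_closed ideal_carrier)

section \<open>Chain conditions and primes that are annihilators\<close>

locale noetherian_cring = cring + noetherian_ring
begin

lemma noetherian_chain:
  assumes id: "\<And>n::nat. ideal (C n) R" and mono: "\<And>n. C n \<subseteq> C (Suc n)"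
  shows "\<exists>n. \<forall>k\<ge>n. C k = C n"
proof -
  have le: "m \<le> n \<Longrightarrow> C m \<subseteq> C n" for m n by (rule lift_Suc_mono_le[of C, OF mono])
  have cmp: "C m \<subseteq> C n \<or> C n \<subseteq> C m" for m n
    using le[of m n] le[of n m] nat_le_linear[of m n] by blast
  have "subset.chain {I. ideal I R} (range C)"
    using id cmp by (auto simp: subset_chain_def)
  then have "\<Union>(range C) \<in> range C" by (intro ideal_chain_is_trivial) auto
  then obtain n where "\<Union>(range C) = C n" by auto
  then have "\<forall>k\<ge>n. C k = C n" using le by blast
  then show ?thesis by blast
qed

lemma noetherian_maximal:
  assumes "S \<noteq> {}" "\<And>I. I \<in> S \<Longrightarrow> ideal I R"
  obtains M where "M \<in> S" "\<And>I. I \<in> S \<Longrightarrow> M \<subseteq> I \<Longrightarrow> I = M"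
proof (rule ccontr)
  assume "\<not> thesis"
  then have *: "\<And>M. M \<in> S \<Longrightarrow> \<exists>I\<in>S. M \<subset> I" using that by blast
  from assms(1) obtain I0 where "I0 \<in> S" by auto
  have "\<exists>C. \<forall>n::nat. C n \<in> S \<and> C n \<subset> C (Suc n)"
    by (rule dependent_nat_choice) (use * \<open>I0 \<in> S\<close> in auto)
  then obtain C where C: "\<And>n::nat. C n \<in> S" "\<And>n. C n \<subset> C (Suc n)" by blast
  have "\<exists>n. \<forall>k\<ge>n. C k = C n"
    by (rule noetherian_chain) (use C assms(2) psubset_imp_subset in \<open>simp_all add: psubset_imp_subset\<close>)
  then obtain n where "\<forall>k\<ge>n. C k = C n" ..
  then have "C (Suc n) = C n" by (meson le_Suc_eq order_refl)
  with C(2)[of n] show False by simp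
qed

text \<open>\<open>colon R I g\<close> is the annihilator of the class of \<open>g\<close> in R/I.
  The annihilators that are maximal among those of nonzero classes are prime, finite in number, and
  together contain every zero divisor on R/I.\<close>

definition maximal_annihilator :: "'a set \<Rightarrow> 'a \<Rightarrow> bool" where
  "maximal_annihilator I g \<longleftrightarrow> g \<in> carrier R \<and> g \<notin> I \<and>
     (\<forall>h\<in>carrier R. h \<notin> I \<longrightarrow> colon R I g \<subseteq> colon R I h \<longrightarrow> colon R I h = colon R I g)"

text \<open>If ab kills g but b does not, then bg is a nonzero class whose annihilator contains that
  of g. Maximality makes the two annihilators equal, and a kills bg.\<close>

lemma maximal_annihilator_prime:
  assumes I: "ideal I R" and max: "maximal_annihilator I g"
  shows "primeideal (colon R I g) R"
proof (rule primeidealI)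
  have g: "g \<in> carrier R" "g \<notin> I" using max by (auto simp: maximal_annihilator_def)
  show "ideal (colon R I g) R" using I g by (simp add: colon_ideal)
  show "cring R" by (rule is_cring)
  show "carrier R \<noteq> colon R I g"
  proof
    assume "carrier R = colon R I g"
    then have "\<one> \<in> colon R I g" by blast
    then show False using g by (simp add: colon_def)
  qed
  fix a b assume ab: "a \<in> carrier R" "b \<in> carrier R" "a \<otimes> b \<in> colon R I g"
  show "a \<in> colon R I g \<or> b \<in> colon R I g"
  proof (cases "b \<in> colon R I g")
    case False
    then have nb: "b \<otimes> g \<notin> I" using ab by (simp add: colon_def)
    have "colon R I g \<subseteq> colon R I (b \<otimes> g)"
    proof
      fix r assume "r \<in> colon R I g"
      then have r: "r \<in> carrier R" "r \<otimes> g \<in> I" by (auto simp: colon_def)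
      have "r \<otimes> (b \<otimes> g) = b \<otimes> (r \<otimes> g)" using r ab g by Ring.algebra
      then show "r \<in> colon R I (b \<otimes> g)" using r ab ideal_lmult[OF I ab(2) r(2)] by (simp add: colon_def)
    qed
    then have "colon R I (b \<otimes> g) = colon R I g" using max nb ab g by (simp add: maximal_annihilator_def)
    moreover have "a \<in> colon R I (b \<otimes> g)" using ab g by (simp add: colon_def m_assoc)
    ultimately show ?thesis by simp
  qed auto
qed

text \<open>The maximal element is sought only among annihilators containing that of
  \<open>z\<close>. This places every zero divisor on R/I, say x with xz in I, in a maximal
  annihilator.\<close>

lemma maximal_annihilator_exists:
  assumes I: "ideal I R" and z: "z \<in> carrier R" "z \<notin> I"
  obtains g where "maximal_annihilator I g" "colon R I z \<subseteq> colon R I g"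
proof -
  let ?S = "{colon R I g | g. g \<in> carrier R \<and> g \<notin> I \<and> colon R I z \<subseteq> colon R I g}"
  have "?S \<noteq> {}" using z by auto
  moreover have "J \<in> ?S \<Longrightarrow> ideal J R" for J using I colon_ideal by auto
  ultimately obtain M where M: "M \<in> ?S" and mx: "\<And>J. J \<in> ?S \<Longrightarrow> M \<subseteq> J \<Longrightarrow> J = M"
    by (rule noetherian_maximal) blast+
  from M obtain g where g: "M = colon R I g" "g \<in> carrier R" "g \<notin> I" "colon R I z \<subseteq> colon R I g" by auto
  have "maximal_annihilator I g"
    unfolding maximal_annihilator_def
  proof (intro conjI ballI impI)
    fix h assume "h \<in> carrier R" "h \<notin> I" "colon R I g \<subseteq> colon R I h"
    then show "colon R I h = colon R I g" using mx[of "colon R I h"] g by blast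
  qed (use g in auto)
  then show thesis using g that by blast
qed

lemma associated_prime_exists:
  assumes I: "ideal I R" and "I \<noteq> carrier R"
  obtains g where "g \<in> carrier R" "g \<notin> I" "primeideal (colon R I g) R"
proof -
  obtain z where "z \<in> carrier R" "z \<notin> I" using assms ideal_subset by blast
  then obtain g where g: "maximal_annihilator I g" by (rule maximal_annihilator_exists[OF I])
  show thesis
    by (rule that[OF _ _ maximal_annihilator_prime[OF I g]]) (use g in \<open>auto simp: maximal_annihilator_def\<close>)
qed

end

section \<open>Krull's principal ideal theorem\<close>

text \<open>The contraction to R of the extension of I to the localization at Q. Arguments over the
  local ring at Q are carried out with such ideals of R, so the localized ring is not
  constructed.\<close>

definition saturation :: "('a, 'm) ring_scheme \<Rightarrow> 'a set \<Rightarrow> 'a set \<Rightarrow> 'a set" where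
  "saturation R Q I = {r \<in> carrier R. \<exists>s\<in>carrier R - Q. s \<otimes>\<^bsub>R\<^esub> r \<in> I}"

text \<open>For a prime \<open>Q\<close> the saturated ideals are the ideals of the localization at \<open>Q\<close>.\<close>

definition saturated :: "('a, 'm) ring_scheme \<Rightarrow> 'a set \<Rightarrow> 'a set \<Rightarrow> bool" where
  "saturated R Q I \<longleftrightarrow> ideal I R \<and>
     (\<forall>s\<in>carrier R - Q. \<forall>r\<in>carrier R. s \<otimes>\<^bsub>R\<^esub> r \<in> I \<longrightarrow> r \<in> I)"

lemma saturated_ideal: "saturated R Q I \<Longrightarrow> ideal I R"
  by (simp add: saturated_def)

lemma saturatedD:
  "saturated R Q I \<Longrightarrow> s \<in> carrier R \<Longrightarrow> s \<notin> Q \<Longrightarrow> r \<in> carrier R \<Longrightarrow> s \<otimes>\<^bsub>R\<^esub> r \<in> I \<Longrightarrow> r \<in> I"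
  by (auto simp: saturated_def)

context cring
begin

lemma prime_mult_notin:
  "primeideal Q R \<Longrightarrow> s \<in> carrier R \<Longrightarrow> t \<in> carrier R \<Longrightarrow> s \<notin> Q \<Longrightarrow> t \<notin> Q \<Longrightarrow> s \<otimes> t \<notin> Q"
  by (meson primeideal.I_prime)

lemma prime_one_notin: "primeideal Q R \<Longrightarrow> \<one> \<notin> Q"
  using ideal.one_imp_carrier primeideal.I_notcarr primeideal.axioms(1) by blast

lemma saturation_saturated:
  assumes Q: "primeideal Q R" and I: "ideal I R"
  shows "saturated R Q (saturation R Q I)"
  unfolding saturated_def
proof (intro conjI ballI impI)
  show "ideal (saturation R Q I) R"
  proof (rule cring_idealI)
    show "\<zero> \<in> saturation R Q I"
      unfolding saturation_def using prime_one_notin[OF Q] I by (auto intro!: bexI[of _ \<one>] ideal_zero)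
    show "x \<oplus> y \<in> saturation R Q I" if "x \<in> saturation R Q I" "y \<in> saturation R Q I" for x y
    proof -
      from that obtain s t where *: "x \<in> carrier R" "y \<in> carrier R" "s \<in> carrier R" "t \<in> carrier R"
        "s \<notin> Q" "t \<notin> Q" "s \<otimes> x \<in> I" "t \<otimes> y \<in> I" by (auto simp: saturation_def)
      have "(s \<otimes> t) \<otimes> (x \<oplus> y) = t \<otimes> (s \<otimes> x) \<oplus> s \<otimes> (t \<otimes> y)" using * by Ring.algebra
      then have "(s \<otimes> t) \<otimes> (x \<oplus> y) \<in> I" using * by (simp add: ideal_closed[OF I])
      then show ?thesis using * prime_mult_notin[OF Q, of s t] by (auto simp: saturation_def)
    qed
    show "r \<otimes> x \<in> saturation R Q I" if "r \<in> carrier R" "x \<in> saturation R Q I" for r x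
    proof -
      from that obtain s where *: "x \<in> carrier R" "s \<in> carrier R" "s \<notin> Q" "s \<otimes> x \<in> I"
        by (auto simp: saturation_def)
      have "s \<otimes> (r \<otimes> x) = r \<otimes> (s \<otimes> x)" using * that by Ring.algebra
      then have "s \<otimes> (r \<otimes> x) \<in> I" using * that by (simp add: ideal_closed[OF I])
      then show ?thesis using * that by (auto simp: saturation_def)
    qed
  qed (auto simp: saturation_def)
  fix s r assume *: "s \<in> carrier R - Q" "r \<in> carrier R" "s \<otimes> r \<in> saturation R Q I"
  then obtain t where t: "t \<in> carrier R" "t \<notin> Q" "t \<otimes> (s \<otimes> r) \<in> I" by (auto simp: saturation_def)
  then have "(t \<otimes> s) \<otimes> r \<in> I" using * by (simp add: m_assoc)
  then show "r \<in> saturation R Q I" using * t prime_mult_notin[OF Q, of t s] by (auto simp: saturation_def)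
qed

lemma saturation_superset:
  assumes Q: "primeideal Q R" and I: "ideal I R"
  shows "I \<subseteq> saturation R Q I"
  unfolding saturation_def using prime_one_notin[OF Q] ideal_carrier[OF I]
  by (auto intro!: bexI[of _ \<one>])

lemma saturation_minimal:
  assumes "saturated R Q J" "I \<subseteq> J" shows "saturation R Q I \<subseteq> J"
  using assms by (auto simp: saturation_def saturated_def)

lemma saturation_adjoin:
  assumes Q: "primeideal Q R" and C: "saturated R Q C" and g: "g \<in> carrier R"
  shows "saturated R Q (saturation R Q (adjoin R C g))" "C \<subseteq> saturation R Q (adjoin R C g)"
    "g \<in> saturation R Q (adjoin R C g)"
proof -
  note C' = saturated_ideal[OF C]
  note A = adjoin_ideal[OF C' g]
  show "saturated R Q (saturation R Q (adjoin R C g))" by (rule saturation_saturated[OF Q A])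
  show "C \<subseteq> saturation R Q (adjoin R C g)" using saturation_superset[OF Q A] adjoin_superset[OF C' g] by blast
  show "g \<in> saturation R Q (adjoin R C g)" using saturation_superset[OF Q A] adjoin_self[OF C' g] by blast
qed

lemma saturation_adjoinE:
  assumes "x \<in> saturation R Q (adjoin R C g)"
  obtains s i r where "s \<in> carrier R" "s \<notin> Q" "i \<in> C" "r \<in> carrier R" "x \<in> carrier R" "s \<otimes> x = i \<oplus> r \<otimes> g"
  using assms by (auto simp: saturation_def elim!: adjoin_memE)

end

context noetherian_cring
begin

text \<open>Nakayama's lemma over the localization at \<open>Q\<close>, for \<open>N = C + A N\<close>.\<close>

lemma saturated_nakayama:
  assumes Q: "primeideal Q R" and C: "saturated R Q C" and N: "saturated R Q N" and "C \<subseteq> N" and "A \<subseteq> Q"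
    and gen: "\<And>D. saturated R Q D \<Longrightarrow> C \<subseteq> D \<Longrightarrow> (\<And>a n. a \<in> A \<Longrightarrow> n \<in> N \<Longrightarrow> a \<otimes> n \<in> D) \<Longrightarrow> N \<subseteq> D"
  shows "N = C"
proof (rule ccontr)
  assume "N \<noteq> C"
  let ?S = "{D. saturated R Q D \<and> C \<subseteq> D \<and> D \<subset> N}"
  have "?S \<noteq> {}" using \<open>N \<noteq> C\<close> \<open>C \<subseteq> N\<close> C by blast
  moreover have "D \<in> ?S \<Longrightarrow> ideal D R" for D using saturated_ideal by auto
  ultimately obtain M where M: "M \<in> ?S" and mx: "\<And>D. D \<in> ?S \<Longrightarrow> M \<subseteq> D \<Longrightarrow> D = M"
    by (rule noetherian_maximal) blast+
  have sM: "saturated R Q M" and CM: "C \<subseteq> M" and MN: "M \<subset> N" using M by auto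
  note iM = saturated_ideal[OF sM] and iN = saturated_ideal[OF N]
  have Qc: "a \<in> Q \<Longrightarrow> a \<in> carrier R" for a using ideal_carrier primeideal.axioms(1)[OF Q] by metis
  \<comment> \<open>By maximality of M no saturated ideal lies strictly between M and N, so any
    single h outside M generates N modulo M after localization.\<close>
  have big: "N \<subseteq> saturation R Q (adjoin R M h)" if h: "h \<in> N" "h \<notin> M" for h
  proof -
    have hc: "h \<in> carrier R" using h iN ideal_carrier by metis
    let ?D = "saturation R Q (adjoin R M h)"
    have "adjoin R M h \<subseteq> N" using adjoin_minimal[OF iN, of M h] MN h by auto
    then have "?D \<subseteq> N" by (rule saturation_minimal[OF N])
    moreover have "?D \<noteq> M" using saturation_adjoin(3)[OF Q sM hc] h by auto
    ultimately show ?thesis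
      using mx[of ?D] saturation_adjoin(1,2)[OF Q sM hc] CM by auto
  qed
  obtain g where g: "g \<in> N" "g \<notin> M" using MN by auto
  have gc: "g \<in> carrier R" using g iN ideal_carrier by metis
  have ag: "a \<otimes> g \<in> M" if "a \<in> A" for a
  proof (rule ccontr)
    assume n: "a \<otimes> g \<notin> M"
    have a: "a \<in> Q" "a \<in> carrier R" using that \<open>A \<subseteq> Q\<close> Qc by auto
    have "a \<otimes> g \<in> N" using g a iN by (simp add: ideal_closed)
    with big[OF _ n] g(1) have "g \<in> saturation R Q (adjoin R M (a \<otimes> g))" by auto
    then obtain s i r where *: "s \<in> carrier R" "s \<notin> Q" "i \<in> M" "r \<in> carrier R" "s \<otimes> g = i \<oplus> r \<otimes> (a \<otimes> g)"
      by (rule saturation_adjoinE)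
    have ic: "i \<in> carrier R" using * iM ideal_carrier by metis
    \<comment> \<open>The factor s - ra stays outside Q because s does and a lies in Q. It is a unit
      of the local ring and can be cancelled.\<close>
    have "(s \<ominus> r \<otimes> a) \<otimes> g = s \<otimes> g \<ominus> r \<otimes> (a \<otimes> g)" using *(1,4) a gc by Ring.algebra
    also have "\<dots> = i" unfolding *(5) using *(1,4) a gc ic by Ring.algebra
    finally have "(s \<ominus> r \<otimes> a) \<otimes> g \<in> M" using * by simp
    moreover have "s \<ominus> r \<otimes> a \<notin> Q"
    proof
      assume "s \<ominus> r \<otimes> a \<in> Q"
      then show False using minus_swap[of Q s "r \<otimes> a"] * a primeideal.axioms(1)[OF Q] by (simp add: ideal_closed)
    qed
    ultimately show False using saturatedD[OF sM, of "s \<ominus> r \<otimes> a" g] * a gc g by simp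
  qed
  have "a \<otimes> n \<in> M" if "a \<in> A" "n \<in> N" for a n
  proof -
    have a: "a \<in> carrier R" using that \<open>A \<subseteq> Q\<close> Qc by auto
    from big[OF g] that have "n \<in> saturation R Q (adjoin R M g)" by auto
    then obtain s i r where *: "s \<in> carrier R" "s \<notin> Q" "i \<in> M" "r \<in> carrier R" "n \<in> carrier R" "s \<otimes> n = i \<oplus> r \<otimes> g"
      by (rule saturation_adjoinE)
    have ic: "i \<in> carrier R" using * iM ideal_carrier by metis
    have "s \<otimes> (a \<otimes> n) = a \<otimes> (s \<otimes> n)" using *(1,5) a by Ring.algebra
    also have "\<dots> = a \<otimes> i \<oplus> r \<otimes> (a \<otimes> g)" unfolding *(6) using *(1,4) a gc ic by Ring.algebra
    finally have "s \<otimes> (a \<otimes> n) \<in> M" using * a ag[OF that(1)] iM by (simp add: ideal_closed)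
    then show ?thesis using saturatedD[OF sM, of s "a \<otimes> n"] * a by simp
  qed
  then have "N \<subseteq> M" using gen[OF sM CM] by simp
  then show False using MN by auto
qed

end

text \<open>This records that D/C has finite length over the localization at Q: each step enlarges D
  by one copy of the residue field, since the new generator \<open>g\<close> is killed by Q modulo
  D.\<close>

inductive_set finite_colength :: "('a, 'm) ring_scheme \<Rightarrow> 'a set \<Rightarrow> 'a set \<Rightarrow> 'a set set"
  for R (structure) and Q C where
  base: "C \<in> finite_colength R Q C"
| step: "D \<in> finite_colength R Q C \<Longrightarrow> g \<in> carrier R \<Longrightarrow> g \<notin> D \<Longrightarrow> Q \<subseteq> colon R D g \<Longrightarrow>
    saturation R Q (adjoin R D g) \<in> finite_colength R Q C"

context noetherian_cring
begin

lemma finite_colength_saturated: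
  assumes "primeideal Q R" "saturated R Q C" "D \<in> finite_colength R Q C"
  shows "saturated R Q D \<and> C \<subseteq> D"
  using assms(3)
proof induction
  case (step D g)
  then show ?case using saturation_adjoin(1,2)[OF assms(1), of D g] by auto
qed (use assms in auto)

text \<open>The last hypothesis says that Q is the only prime between C and Q. A maximal reachable
  ideal M that is proper has an associated prime; as M is saturated, this prime lies in Q, so it
  equals Q and one more step is possible.\<close>

lemma finite_colength_carrier:
  assumes Q: "primeideal Q R" and C: "saturated R Q C"
    and min: "\<And>p. primeideal p R \<Longrightarrow> C \<subseteq> p \<Longrightarrow> p \<subseteq> Q \<Longrightarrow> p = Q"
  shows "carrier R \<in> finite_colength R Q C"
proof (rule ccontr)
  assume n: "carrier R \<notin> finite_colength R Q C"
  have "finite_colength R Q C \<noteq> {}" using finite_colength.base by blast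
  moreover have "\<And>D. D \<in> finite_colength R Q C \<Longrightarrow> ideal D R"
    using finite_colength_saturated[OF Q C] saturated_ideal by blast
  ultimately obtain M where M: "M \<in> finite_colength R Q C"
    and mx: "\<And>D. D \<in> finite_colength R Q C \<Longrightarrow> M \<subseteq> D \<Longrightarrow> D = M"
    by (rule noetherian_maximal) blast+
  have sM: "saturated R Q M" and CM: "C \<subseteq> M" using finite_colength_saturated[OF Q C M] by auto
  note iM = saturated_ideal[OF sM]
  have "M \<noteq> carrier R" using M n by auto
  then obtain g where g: "g \<in> carrier R" "g \<notin> M" "primeideal (colon R M g) R"
    by (rule associated_prime_exists[OF iM])
  have "colon R M g \<subseteq> Q"
    using saturatedD[OF sM] g by (auto simp: colon_def)
  moreover have "C \<subseteq> colon R M g" using colon_superset[OF iM g(1)] CM by blast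
  ultimately have "Q \<subseteq> colon R M g" using min g(3) by blast
  then have "saturation R Q (adjoin R M g) \<in> finite_colength R Q C"
    using finite_colength.step[OF M] g by blast
  then have "saturation R Q (adjoin R M g) = M" using mx saturation_adjoin(2)[OF Q sM g(1)] by blast
  then show False using saturation_adjoin(3)[OF Q sM g(1)] g by auto
qed

text \<open>Induction on the length. Modulo D the enlarged ideal is a one-dimensional space over the
  residue field, so a chain either enters D or has full image there for ever. In both cases it is
  determined by its traces on D, which stabilise by induction.\<close>

lemma finite_colength_descending:
  assumes Q: "primeideal Q R" and C: "saturated R Q C" and "D \<in> finite_colength R Q C"
    and "\<And>n. saturated R Q (b n)" "\<And>n. C \<subseteq> b n" "\<And>n. b n \<subseteq> D" "\<And>n. b (Suc n) \<subseteq> b n"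
  shows "\<exists>n::nat. \<forall>k\<ge>n. b k = b n"
  using assms(3-)
proof (induction arbitrary: b)
  case base
  then have "b n = C" for n by blast
  then show ?case by blast
next
  case (step D g)
  have le: "m \<le> n \<Longrightarrow> b n \<subseteq> b m" for m n by (rule lift_Suc_antimono_le[of b, OF step.prems(4)])
  have sD: "saturated R Q D" "C \<subseteq> D" using finite_colength_saturated[OF Q C step.hyps(1)] by auto
  note iD = saturated_ideal[OF sD(1)]
  have inter: "saturated R Q (b n \<inter> D)" for n
    using step.prems(1)[of n] sD by (auto simp: saturated_def intro: i_intersect)
  have "\<exists>n. \<forall>k\<ge>n. b k \<inter> D = b n \<inter> D"
    by (rule step.IH) (use inter step.prems(2) step.prems(4) sD(2) in blast)+
  then obtain n where n: "\<And>k. k \<ge> n \<Longrightarrow> b k \<inter> D = b n \<inter> D" by blast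
  show ?case
  proof (cases "\<exists>m. b m \<subseteq> D")
    case True
    then obtain m where m: "b m \<subseteq> D" by auto
    have "b k = b (max m n)" if k: "k \<ge> max m n" for k
    proof -
      have "b k \<subseteq> D" "b (max m n) \<subseteq> D" using le[of m k] le[of m "max m n"] m k by auto
      then have "b k = b k \<inter> D" "b (max m n) = b (max m n) \<inter> D" by blast+
      then show ?thesis using n[of k] n[of "max m n"] k by simp
    qed
    then show ?thesis by blast
  next
    case False
    have "b n \<subseteq> b k" if k: "k \<ge> n" for k
    proof
      fix y assume y: "y \<in> b n"
      obtain c where c: "c \<in> b k" "c \<notin> D" using False by blast
      have cn: "c \<in> b n" using c le[OF k] by auto
      note sk = step.prems(1)[of k] and sn = step.prems(1)[of n]
      note ik = saturated_ideal[OF sk] and in' = saturated_ideal[OF sn]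
      from y step.prems(3)[of n] have "y \<in> saturation R Q (adjoin R D g)" by auto
      then obtain s i r where *: "s \<in> carrier R" "s \<notin> Q" "i \<in> D" "r \<in> carrier R" "y \<in> carrier R" "s \<otimes> y = i \<oplus> r \<otimes> g"
        by (rule saturation_adjoinE)
      from cn step.prems(3)[of n] have "c \<in> saturation R Q (adjoin R D g)" by auto
      then obtain s' i' r' where p: "s' \<in> carrier R" "s' \<notin> Q" "i' \<in> D" "r' \<in> carrier R" "c \<in> carrier R" "s' \<otimes> c = i' \<oplus> r' \<otimes> g"
        by (rule saturation_adjoinE)
      have car: "i \<in> carrier R" "i' \<in> carrier R" using * p iD ideal_carrier by metis+
      \<comment> \<open>The element c witnesses that \<open>b k\<close> is not inside D. Hence its
        coefficient r' at g is a unit of the local ring and serves as a pivot.\<close>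
      have r': "r' \<notin> Q"
      proof
        assume "r' \<in> Q"
        then have "r' \<otimes> g \<in> D" using step.hyps by (auto simp: colon_def)
        then have "s' \<otimes> c \<in> D" using p iD by (simp add: ideal_closed)
        then show False using saturatedD[OF sD(1), of s' c] p c by simp
      qed
      \<comment> \<open>This combination eliminates g, so it lies in D, where the traces of
        \<open>b n\<close> and \<open>b k\<close> agree.\<close>
      let ?z = "r' \<otimes> (s \<otimes> y) \<ominus> r \<otimes> (s' \<otimes> c)"
      have "?z = r' \<otimes> i \<ominus> r \<otimes> i'" unfolding *(6) p(6) using *(1,4) p(1,4) car step.hyps(2) by Ring.algebra
      then have "?z \<in> D" using * p iD by (simp add: ideal_closed)
      moreover have "?z \<in> b n" using *(1-5) p(1-5) y cn in' by (simp add: ideal_closed)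
      ultimately have "?z \<in> b k" using n[OF k] by auto
      then have "r' \<otimes> (s \<otimes> y) \<in> b k"
        using minus_swap[OF ik, of "r' \<otimes> (s \<otimes> y)" "r \<otimes> (s' \<otimes> c)"] *(1-5) p(1-5) c ik by (simp add: ideal_closed)
      then have "s \<otimes> y \<in> b k" using saturatedD[OF sk p(4) r', of "s \<otimes> y"] *(1,5) by simp
      then show "y \<in> b k" by (rule saturatedD[OF sk *(1,2,5)])
    qed
    then have "\<forall>k\<ge>n. b k = b n" using le by blast
    then show ?thesis by blast
  qed
qed

text \<open>The powers of the ideal \<open>P/P\<^sub>0\<close> after localization at \<open>P\<close>, pulled back to \<open>R\<close>.\<close>

fun symbolic_power :: "'a set \<Rightarrow> 'a set \<Rightarrow> nat \<Rightarrow> 'a set" where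
  "symbolic_power P0 P 0 = carrier R"
| "symbolic_power P0 P (Suc n) =
     \<Inter>{D. saturated R P D \<and> P0 \<subseteq> D \<and> (\<forall>a\<in>P. \<forall>v\<in>symbolic_power P0 P n. a \<otimes> v \<in> D)}"

lemma saturated_carrier: "saturated R P (carrier R)"
  by (simp add: saturated_def oneideal)

lemma saturated_Inter:
  assumes "F \<noteq> {}" "\<And>D. D \<in> F \<Longrightarrow> saturated R P D" shows "saturated R P (\<Inter>F)"
proof -
  have "ideal (\<Inter>F) R" using assms by (intro i_Intersect) (auto simp: saturated_def)
  then show ?thesis using assms unfolding saturated_def by blast
qed

lemma symbolic_power_saturated:
  assumes "primeideal P R" "P0 \<subseteq> carrier R"
  shows "saturated R P (symbolic_power P0 P n) \<and> P0 \<subseteq> symbolic_power P0 P n"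
proof (induction n)
  case 0 then show ?case using assms by (simp add: saturated_carrier)
next
  case (Suc n)
  have "ideal P R" "ideal (symbolic_power P0 P n) R" using assms(1) Suc primeideal.axioms(1) saturated_ideal by blast+
  then have "symbolic_power P0 P n \<in> {D. saturated R P D \<and> P0 \<subseteq> D \<and> (\<forall>a\<in>P. \<forall>v\<in>symbolic_power P0 P n. a \<otimes> v \<in> D)}"
    using Suc by (auto simp: ideal_closed ideal_carrier)
  then show ?case by (auto intro!: saturated_Inter)
qed

lemma symbolic_power_decreasing:
  assumes "primeideal P R" "P0 \<subseteq> carrier R"
  shows "symbolic_power P0 P (Suc n) \<subseteq> symbolic_power P0 P n"
proof -
  have "ideal P R" "ideal (symbolic_power P0 P n) R" using assms primeideal.axioms(1) symbolic_power_saturated[OF assms] saturated_ideal by blast+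
  then show ?thesis using symbolic_power_saturated[OF assms, of n] by (auto simp: ideal_closed ideal_carrier)
qed

text \<open>By Nakayama, equality would make the n-th power equal to P0. But it contains y^n for
  every y in P, and for y outside the prime P0 no power of y lies in P0.\<close>

lemma symbolic_power_strict:
  assumes P: "primeideal P R" and P0: "primeideal P0 R" and lt: "P0 \<subset> P"
  shows "symbolic_power P0 P (Suc n) \<noteq> symbolic_power P0 P n"
proof
  assume eq: "symbolic_power P0 P (Suc n) = symbolic_power P0 P n"
  have P0c: "P0 \<subseteq> carrier R" using P0 primeideal.axioms(1) ideal_subset by blast
  have Pc: "P \<subseteq> carrier R" using P primeideal.axioms(1) ideal_subset by blast
  have sP0: "saturated R P P0"
    unfolding saturated_def using P0 lt primeideal.axioms(1) primeideal.I_prime[OF P0] by blast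
  have "symbolic_power P0 P n = P0"
  proof (rule saturated_nakayama[OF P sP0, where A = P])
    fix D assume "saturated R P D" "P0 \<subseteq> D" "\<And>a v. a \<in> P \<Longrightarrow> v \<in> symbolic_power P0 P n \<Longrightarrow> a \<otimes> v \<in> D"
    then have "symbolic_power P0 P (Suc n) \<subseteq> D" by auto
    then show "symbolic_power P0 P n \<subseteq> D" using eq by simp
  qed (use symbolic_power_saturated[OF P P0c, of n] in auto)
  moreover obtain y where y: "y \<in> P" "y \<notin> P0" using lt by auto
  have "y [^] k \<in> symbolic_power P0 P k" for k :: nat
  proof (induction k)
    case (Suc k) then show ?case using y Pc by (auto simp: m_comm subsetD)
  qed simp
  moreover have "y [^] k \<notin> P0" for k :: nat
  proof (induction k)
    case 0 show ?case using prime_one_notin[OF P0] by simp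
  next
    case (Suc k) then show ?case using y Pc prime_mult_notin[OF P0, of "y [^] k" y] by auto
  qed
  ultimately show False by blast
qed

text \<open>Krull's classical argument, in R/P0 localized at P2. If no such prime exists, P2 is
  minimal over P0 + fR, so the quotient by f has finite length and the symbolic powers of P1
  stabilise modulo f. Nakayama then makes them stabilise altogether, which strictness
  forbids.\<close>

theorem prime_between_containing:
  assumes P0: "primeideal P0 R" and P1: "primeideal P1 R" and P2: "primeideal P2 R"
    and lt: "P0 \<subset> P1" "P1 \<subset> P2" and f: "f \<in> P2"
  shows "\<exists>P. primeideal P R \<and> P0 \<subset> P \<and> P \<subset> P2 \<and> f \<in> P"
proof (rule ccontr)
  assume no: "\<not> ?thesis"
  then have f1: "f \<notin> P1" using P1 lt by blast
  have id: "ideal P0 R" "ideal P1 R" "ideal P2 R" using P0 P1 P2 primeideal.axioms(1) by blast+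
  have fc: "f \<in> carrier R" by (rule ideal_carrier[OF id(3) f])
  have P0c: "P0 \<subseteq> carrier R" by (rule ideal_subset[OF id(1)])
  let ?S = "symbolic_power P0 P1"
  let ?c = "\<lambda>I. saturation R P2 (adjoin R I f)"
  note sS = symbolic_power_saturated[OF P1 P0c]
  have iS: "ideal (?S n) R" for n using sS saturated_ideal by blast
  have adj: "ideal (adjoin R I f) R" if "ideal I R" for I using adjoin_ideal[OF that fc] .
  have mono: "?c I \<subseteq> ?c J" if "I \<subseteq> J" for I J
    using that unfolding saturation_def adjoin_def by blast
  have sat: "saturated R P2 (?c I)" if "ideal I R" for I by (rule saturation_saturated[OF P2 adj[OF that]])
  have "carrier R \<in> finite_colength R P2 (?c P0)"
  proof (rule finite_colength_carrier[OF P2 sat[OF id(1)]])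
    fix p assume p: "primeideal p R" "?c P0 \<subseteq> p" "p \<subseteq> P2"
    have "adjoin R P0 f \<subseteq> p" using p(2) saturation_superset[OF P2 adj[OF id(1)]] by blast
    then have "P0 \<subseteq> p" "f \<in> p" using adjoin_superset[OF id(1) fc] adjoin_self[OF id(1) fc] by auto
    moreover have "P0 \<noteq> p" using \<open>f \<in> p\<close> f1 lt by auto
    ultimately show "p = P2" using no p by blast
  qed
  then have "\<exists>n. \<forall>k\<ge>n. ?c (?S k) = ?c (?S n)"
  proof (rule finite_colength_descending[OF P2 sat[OF id(1)]])
    show "?c (?S (Suc n)) \<subseteq> ?c (?S n)" for n by (rule mono[OF symbolic_power_decreasing[OF P1 P0c]])
    show "?c P0 \<subseteq> ?c (?S n)" for n using mono sS by blast
    show "?c (?S n) \<subseteq> carrier R" for n by (auto simp: saturation_def)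
  qed (use sat iS in auto)
  then obtain n where "\<forall>k\<ge>n. ?c (?S k) = ?c (?S n)" ..
  then have n: "?c (?S (Suc n)) = ?c (?S n)" by (meson le_Suc_eq order_refl)
  have sat12: "saturated R P2 D" if "saturated R P1 D" for D
    using that lt unfolding saturated_def by blast
  have "?S n = ?S (Suc n)"
  proof (rule saturated_nakayama[OF P2, where A = "{f}"])
    show "saturated R P2 (?S n)" "saturated R P2 (?S (Suc n))" using sS sat12 by blast+
    show "?S (Suc n) \<subseteq> ?S n" by (rule symbolic_power_decreasing[OF P1 P0c])
    fix D assume D: "saturated R P2 D" "?S (Suc n) \<subseteq> D" "\<And>a v. a \<in> {f} \<Longrightarrow> v \<in> ?S n \<Longrightarrow> a \<otimes> v \<in> D"
    show "?S n \<subseteq> D"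
    proof
      fix r assume r: "r \<in> ?S n"
      then have "r \<in> ?c (?S (Suc n))"
        unfolding n using saturation_superset[OF P2 adj[OF iS]] adjoin_superset[OF iS fc] by blast
      then obtain s i t where *: "s \<in> carrier R" "s \<notin> P2" "i \<in> ?S (Suc n)" "t \<in> carrier R" "r \<in> carrier R" "s \<otimes> r = i \<oplus> t \<otimes> f"
        by (rule saturation_adjoinE)
      have i: "i \<in> ?S n" using * symbolic_power_decreasing[OF P1 P0c] by blast
      have ic: "i \<in> carrier R" by (rule ideal_carrier[OF iS i])
      \<comment> \<open>The symbolic power is saturated at P1 and f lies outside P1, so f can be
        cancelled from ft. This yields S n = S (n+1) + f S n after localization at P2, the form that
        Nakayama with A = {f} needs.\<close>
      have "f \<otimes> t = s \<otimes> r \<ominus> i" unfolding *(6) using *(1,4) ic fc by Ring.algebra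
      moreover have "s \<otimes> r \<ominus> i \<in> ?S n" using *(1) r i iS by (simp add: ideal_closed del: symbolic_power.simps)
      ultimately have "f \<otimes> t \<in> ?S n" by simp
      then have "t \<in> ?S n" using saturatedD[of R P1 "?S n" f t] sS fc f1 *(4) by blast
      then have "t \<otimes> f \<in> D" using D(3)[of f t] fc * by (simp add: m_comm)
      moreover have "i \<in> D" using *(3) D(2) by blast
      ultimately have "s \<otimes> r \<in> D" unfolding *(6) by (simp add: ideal_add[OF saturated_ideal[OF D(1)]])
      then show "r \<in> D" by (rule saturatedD[OF D(1) *(1,2,5)])
    qed
  qed (use f in auto)
  then show False using symbolic_power_strict[OF P1 P0 lt(1), of n] by metis
qed

text \<open>The prime just below the top is exchanged for one that contains f, and the argument
  repeats with the chain ending there. Each exchange uses the prime two places below the current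
  top, so only the bottom of the chain is lost.\<close>

lemma prime_chain_containing:
  assumes "\<forall>i\<le>Suc n. primeideal (P i) R" "\<forall>i\<le>n. P i \<subset> P (Suc i)" "f \<in> P (Suc n)"
  shows "\<exists>Q. (\<forall>i\<le>n. primeideal (Q i) R \<and> f \<in> Q i) \<and> (\<forall>i<n. Q i \<subset> Q (Suc i)) \<and> Q n = P (Suc n)"
  using assms
proof (induction n arbitrary: P)
  case 0
  then show ?case by (intro exI[of _ "\<lambda>_. P 1"]) auto
next
  case (Suc n)
  have "\<exists>p. primeideal p R \<and> P n \<subset> p \<and> p \<subset> P (Suc (Suc n)) \<and> f \<in> p"
    by (rule prime_between_containing[of _ "P (Suc n)"]) (use Suc.prems in auto)
  then obtain p where p: "primeideal p R" "P n \<subset> p" "p \<subset> P (Suc (Suc n))" "f \<in> p" by blast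
  let ?P = "P(Suc n := p)"
  have "\<exists>Q. (\<forall>i\<le>n. primeideal (Q i) R \<and> f \<in> Q i) \<and> (\<forall>i<n. Q i \<subset> Q (Suc i)) \<and> Q n = ?P (Suc n)"
    by (rule Suc.IH) (use Suc.prems p in \<open>auto simp: le_Suc_eq less_Suc_eq_le\<close>)
  then obtain Q where Q: "\<forall>i\<le>n. primeideal (Q i) R \<and> f \<in> Q i" "\<forall>i<n. Q i \<subset> Q (Suc i)" "Q n = p" by auto
  show ?case
    by (rule exI[of _ "Q(Suc n := P (Suc (Suc n)))"])
      (use Q p Suc.prems in \<open>auto simp: le_Suc_eq less_Suc_eq\<close>)
qed

end

section \<open>Linear maps and free modules\<close>

text \<open>Linearity on a subset K of V, with the operations of V. Maps out of ideals and out of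
  submodules of R^k are thus handled without turning K into a module of its own;
  \<open>module_hom\<close> is the case where K is the carrier.\<close>

definition linear_on ::
    "('a, 'm) ring_scheme \<Rightarrow> ('a, 'b, 'k) module_scheme \<Rightarrow> 'b set \<Rightarrow> ('a, 'c, 'l) module_scheme \<Rightarrow> ('b \<Rightarrow> 'c) \<Rightarrow> bool" where
  "linear_on R V K N h \<longleftrightarrow> (\<forall>x\<in>K. h x \<in> carrier N)
     \<and> (\<forall>x\<in>K. \<forall>y\<in>K. h (x \<oplus>\<^bsub>V\<^esub> y) = h x \<oplus>\<^bsub>N\<^esub> h y)
     \<and> (\<forall>r\<in>carrier R. \<forall>x\<in>K. h (r \<odot>\<^bsub>V\<^esub> x) = r \<odot>\<^bsub>N\<^esub> h x)"

lemma linear_onD: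
  assumes "linear_on R V K N h"
  shows "x \<in> K \<Longrightarrow> h x \<in> carrier N"
    "x \<in> K \<Longrightarrow> y \<in> K \<Longrightarrow> h (x \<oplus>\<^bsub>V\<^esub> y) = h x \<oplus>\<^bsub>N\<^esub> h y"
    "r \<in> carrier R \<Longrightarrow> x \<in> K \<Longrightarrow> h (r \<odot>\<^bsub>V\<^esub> x) = r \<odot>\<^bsub>N\<^esub> h x"
  using assms by (auto simp: linear_on_def)

lemma linear_on_subset: "linear_on R V L N h \<Longrightarrow> K \<subseteq> L \<Longrightarrow> linear_on R V K N h"
  unfolding linear_on_def by blast

lemma linear_on_module_hom: "linear_on R V (carrier V) N h \<longleftrightarrow> h \<in> module_hom R V N"
  by (auto simp: linear_on_def module_hom_def)

lemma self_module_simps [simp]: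
  "carrier (self_module R) = carrier R" "ring.zero (self_module R) = ring.zero R" "add (self_module R) = add R"
  "smult (self_module R) = monoid.mult R"
  by (auto simp: self_module_def)

lemma submodule_mem:
  assumes "module R V" "submodule K R V"
  shows "K \<subseteq> carrier V" "x \<in> K \<Longrightarrow> x \<in> carrier V" "\<zero>\<^bsub>V\<^esub> \<in> K"
    "x \<in> K \<Longrightarrow> y \<in> K \<Longrightarrow> x \<oplus>\<^bsub>V\<^esub> y \<in> K" "x \<in> K \<Longrightarrow> \<ominus>\<^bsub>V\<^esub> x \<in> K"
    "x \<in> K \<Longrightarrow> y \<in> K \<Longrightarrow> x \<ominus>\<^bsub>V\<^esub> y \<in> K" "r \<in> carrier R \<Longrightarrow> x \<in> K \<Longrightarrow> r \<odot>\<^bsub>V\<^esub> x \<in> K"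
proof -
  interpret module R V by fact
  note E = submoduleE[OF assms(2)]
  show "K \<subseteq> carrier V" "x \<in> K \<Longrightarrow> x \<in> carrier V" "x \<in> K \<Longrightarrow> y \<in> K \<Longrightarrow> x \<oplus>\<^bsub>V\<^esub> y \<in> K"
    "x \<in> K \<Longrightarrow> \<ominus>\<^bsub>V\<^esub> x \<in> K" "r \<in> carrier R \<Longrightarrow> x \<in> K \<Longrightarrow> r \<odot>\<^bsub>V\<^esub> x \<in> K"
    using E by auto
  show "x \<in> K \<Longrightarrow> y \<in> K \<Longrightarrow> x \<ominus>\<^bsub>V\<^esub> y \<in> K" using E by (simp add: a_minus_def)
  show "\<zero>\<^bsub>V\<^esub> \<in> K" using subgroup.one_closed[OF submodule.axioms(1)[OF assms(2)]] by simp
qed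

lemma submodule_iff:
  assumes "module R V"
  shows "submodule K R V \<longleftrightarrow> K \<subseteq> carrier V \<and> \<zero>\<^bsub>V\<^esub> \<in> K \<and> (\<forall>x\<in>K. \<forall>y\<in>K. x \<oplus>\<^bsub>V\<^esub> y \<in> K)
    \<and> (\<forall>r\<in>carrier R. \<forall>x\<in>K. r \<odot>\<^bsub>V\<^esub> x \<in> K)" (is "?L \<longleftrightarrow> ?R")
proof
  assume ?L then show ?R using submodule_mem[OF assms] by metis
next
  interpret module R V by fact
  assume R: ?R
  show ?L
  proof (rule submoduleI)
    fix a assume a: "a \<in> K"
    then have "\<ominus>\<^bsub>V\<^esub> a = (\<ominus>\<^bsub>R\<^esub> \<one>\<^bsub>R\<^esub>) \<odot>\<^bsub>V\<^esub> a" using R by (auto simp: smult_l_minus subsetD)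
    then show "\<ominus>\<^bsub>V\<^esub> a \<in> K" using R a by simp
  qed (use R in auto)
qed

lemma carrier_submodule: "module R V \<Longrightarrow> submodule (carrier V) R V"
  by (rule module.carrier_is_submodule)

lemma linear_on_zero:
  assumes "module R V" "module R N" "submodule K R V" "linear_on R V K N h"
  shows "h \<zero>\<^bsub>V\<^esub> = \<zero>\<^bsub>N\<^esub>"
proof -
  interpret V: module R V by fact
  interpret N: module R N by fact
  note s = submodule_mem[OF assms(1,3)] and l = linear_onD[OF assms(4)]
  have "h (\<zero>\<^bsub>R\<^esub> \<odot>\<^bsub>V\<^esub> \<zero>\<^bsub>V\<^esub>) = \<zero>\<^bsub>R\<^esub> \<odot>\<^bsub>N\<^esub> h \<zero>\<^bsub>V\<^esub>" by (rule l(3)) (use s in auto)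
  moreover have "h \<zero>\<^bsub>V\<^esub> \<in> carrier N" by (rule l(1)[OF s(3)])
  ultimately show ?thesis by simp
qed

lemma linear_on_minus:
  assumes "module R V" "module R N" "submodule K R V" "linear_on R V K N h" "x \<in> K" "y \<in> K"
  shows "h (x \<ominus>\<^bsub>V\<^esub> y) = h x \<ominus>\<^bsub>N\<^esub> h y"
proof -
  interpret V: module R V by fact
  interpret N: module R N by fact
  note s = submodule_mem[OF assms(1,3)] and l = linear_onD[OF assms(4)]
  have "\<ominus>\<^bsub>V\<^esub> y = (\<ominus>\<^bsub>R\<^esub> \<one>\<^bsub>R\<^esub>) \<odot>\<^bsub>V\<^esub> y" using s assms by (simp add: V.smult_l_minus)
  then have "h (\<ominus>\<^bsub>V\<^esub> y) = \<ominus>\<^bsub>N\<^esub> h y" using s l assms by (simp add: N.smult_l_minus)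
  then show ?thesis using s l assms by (simp add: a_minus_def)
qed

lemma (in cring) self_module_module: "module R (self_module R)"
proof (rule moduleI)
  show "abelian_group (self_module R)"
    by (rule abelian_groupI) (auto simp: a_ac intro: add.l_inv_ex)
qed (auto simp: l_distr r_distr m_assoc is_cring)

text \<open>After sorting by \<open>a_ac\<close> a summand and its negative need not be adjacent.
  These rules cancel them across one or two intervening summands.\<close>

lemma (in abelian_group) cancel_simps:
  assumes "x \<in> carrier G" "y \<in> carrier G" "z \<in> carrier G" "w \<in> carrier G"
  shows "x \<oplus> (y \<oplus> \<ominus> x) = y" "\<ominus> x \<oplus> (y \<oplus> x) = y"
    "x \<oplus> (y \<oplus> (\<ominus> x \<oplus> z)) = y \<oplus> z" "\<ominus> x \<oplus> (y \<oplus> (x \<oplus> z)) = y \<oplus> z"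
    "x \<oplus> (y \<oplus> (z \<oplus> \<ominus> x)) = y \<oplus> z" "\<ominus> x \<oplus> (y \<oplus> (z \<oplus> x)) = y \<oplus> z"
    "x \<oplus> (y \<oplus> (z \<oplus> (\<ominus> x \<oplus> w))) = y \<oplus> (z \<oplus> w)" "\<ominus> x \<oplus> (y \<oplus> (z \<oplus> (x \<oplus> w))) = y \<oplus> (z \<oplus> w)"
  using assms a_lcomm[of _ "\<ominus> x"] a_lcomm[of _ x] by (simp_all add: r_neg1 r_neg2 a_comm[of _ x] a_comm[of _ "\<ominus> x"])

lemmas (in abelian_group) group_simps = minus_eq minus_add a_ac r_neg l_neg r_neg1 r_neg2 cancel_simps

lemma (in abelian_group) minus_eq_zeroD: "x \<in> carrier G \<Longrightarrow> y \<in> carrier G \<Longrightarrow> x \<ominus> y = \<zero> \<Longrightarrow> x = y"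
  by (metis a_minus_def minus_equality minus_minus a_inv_closed)

section \<open>Gluing of linear maps and Baer's criterion\<close>

definition submodule_sum :: "('a, 'b, 'k) module_scheme \<Rightarrow> 'b set \<Rightarrow> 'b set \<Rightarrow> 'b set" where
  "submodule_sum V K L = {x \<oplus>\<^bsub>V\<^esub> y | x y. x \<in> K \<and> y \<in> L}"

lemma submodule_sum_submodule:
  assumes "module R V" "submodule K R V" "submodule L R V"
  shows "submodule (submodule_sum V K L) R V" "K \<subseteq> submodule_sum V K L" "L \<subseteq> submodule_sum V K L"
proof -
  interpret module R V by fact
  note K = submodule_mem[OF assms(1,2)] and L = submodule_mem[OF assms(1,3)]
  have I: "a \<oplus>\<^bsub>V\<^esub> b \<in> submodule_sum V K L" if "a \<in> K" "b \<in> L" for a b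
    using that by (auto simp: submodule_sum_def)
  show "submodule (submodule_sum V K L) R V"
    unfolding submodule_iff[OF assms(1)]
  proof (intro conjI ballI)
    show "submodule_sum V K L \<subseteq> carrier V" using K(2) L(2) by (auto simp: submodule_sum_def)
    show "\<zero>\<^bsub>V\<^esub> \<in> submodule_sum V K L" using I[OF K(3) L(3)] by simp
  next
    fix x y assume "x \<in> submodule_sum V K L" "y \<in> submodule_sum V K L"
    then obtain a b c d where *: "a \<in> K" "b \<in> L" "c \<in> K" "d \<in> L" "x = a \<oplus>\<^bsub>V\<^esub> b" "y = c \<oplus>\<^bsub>V\<^esub> d"
      by (auto simp: submodule_sum_def)
    then have "x \<oplus>\<^bsub>V\<^esub> y = (a \<oplus>\<^bsub>V\<^esub> c) \<oplus>\<^bsub>V\<^esub> (b \<oplus>\<^bsub>V\<^esub> d)" using K(2) L(2) by (simp add: M.a_ac)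
    then show "x \<oplus>\<^bsub>V\<^esub> y \<in> submodule_sum V K L" using * K L I by metis
  next
    fix r x assume r: "r \<in> carrier R" and "x \<in> submodule_sum V K L"
    then obtain a b where *: "a \<in> K" "b \<in> L" "x = a \<oplus>\<^bsub>V\<^esub> b"
      by (auto simp: submodule_sum_def)
    then have "r \<odot>\<^bsub>V\<^esub> x = (r \<odot>\<^bsub>V\<^esub> a) \<oplus>\<^bsub>V\<^esub> (r \<odot>\<^bsub>V\<^esub> b)" using r K(2) L(2) by (simp add: smult_r_distr)
    then show "r \<odot>\<^bsub>V\<^esub> x \<in> submodule_sum V K L" using * K L I r by metis
  qed
  show "K \<subseteq> submodule_sum V K L"
  proof
    fix x assume "x \<in> K" then show "x \<in> submodule_sum V K L" using I[of x "\<zero>\<^bsub>V\<^esub>"] K(2) L(3) by simp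
  qed
  show "L \<subseteq> submodule_sum V K L"
  proof
    fix x assume "x \<in> L" then show "x \<in> submodule_sum V K L" using I[of "\<zero>\<^bsub>V\<^esub>" x] L(2) K(3) by simp
  qed
qed

text \<open>If a + b = a' + b', then a - a' = b' - b lies in both submodules, where the two maps
  agree. So the sum of the values does not depend on the decomposition.\<close>

lemma linear_on_glue:
  assumes V: "module R V" and N: "module R N" and K: "submodule K R V" and L: "submodule L R V"
    and h: "linear_on R V K N h" and g: "linear_on R V L N g"
    and agree: "\<And>x. x \<in> K \<Longrightarrow> x \<in> L \<Longrightarrow> h x = g x"
  shows "\<exists>f. linear_on R V (submodule_sum V K L) N f \<and> (\<forall>x\<in>K. f x = h x) \<and> (\<forall>x\<in>L. f x = g x)"
proof -
  interpret V: module R V by fact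
  interpret N: module R N by fact
  note Ks = submodule_mem[OF V K] and Ls = submodule_mem[OF V L]
  note hD = linear_onD[OF h] and gD = linear_onD[OF g]
  define f where "f x = (SOME y. \<exists>a\<in>K. \<exists>b\<in>L. x = a \<oplus>\<^bsub>V\<^esub> b \<and> y = h a \<oplus>\<^bsub>N\<^esub> g b)" for x
  have f: "f (a \<oplus>\<^bsub>V\<^esub> b) = h a \<oplus>\<^bsub>N\<^esub> g b" if "a \<in> K" "b \<in> L" for a b
  proof -
    have "\<exists>a'\<in>K. \<exists>b'\<in>L. a \<oplus>\<^bsub>V\<^esub> b = a' \<oplus>\<^bsub>V\<^esub> b' \<and> f (a \<oplus>\<^bsub>V\<^esub> b) = h a' \<oplus>\<^bsub>N\<^esub> g b'"
      unfolding f_def by (rule someI_ex) (use that in blast)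
    then obtain a' b' where *: "a' \<in> K" "b' \<in> L" "a \<oplus>\<^bsub>V\<^esub> b = a' \<oplus>\<^bsub>V\<^esub> b'"
      "f (a \<oplus>\<^bsub>V\<^esub> b) = h a' \<oplus>\<^bsub>N\<^esub> g b'" by blast
    have c: "a \<in> carrier V" "b \<in> carrier V" "a' \<in> carrier V" "b' \<in> carrier V"
      using that * Ks(2) Ls(2) by auto
    have "a \<ominus>\<^bsub>V\<^esub> a' = (a \<oplus>\<^bsub>V\<^esub> b) \<ominus>\<^bsub>V\<^esub> (a' \<oplus>\<^bsub>V\<^esub> b)" using c by (simp add: V.M.group_simps)
    also have "\<dots> = b' \<ominus>\<^bsub>V\<^esub> b" unfolding *(3) using c by (simp add: V.M.group_simps)
    finally have e: "a \<ominus>\<^bsub>V\<^esub> a' = b' \<ominus>\<^bsub>V\<^esub> b" .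
    have "h a \<ominus>\<^bsub>N\<^esub> h a' = h (a \<ominus>\<^bsub>V\<^esub> a')" using linear_on_minus[OF V N K h] that * by simp
    also have "\<dots> = g (b' \<ominus>\<^bsub>V\<^esub> b)"
    proof -
      have "a \<ominus>\<^bsub>V\<^esub> a' \<in> K" by (rule Ks(6)) (use that * in auto)
      moreover have "a \<ominus>\<^bsub>V\<^esub> a' \<in> L" unfolding e by (rule Ls(6)) (use that * in auto)
      ultimately show ?thesis using agree e by simp
    qed
    also have "\<dots> = g b' \<ominus>\<^bsub>N\<^esub> g b" using linear_on_minus[OF V N L g] that * by simp
    finally have e2: "h a \<ominus>\<^bsub>N\<^esub> h a' = g b' \<ominus>\<^bsub>N\<^esub> g b" .
    have c': "h a \<in> carrier N" "g b \<in> carrier N" "h a' \<in> carrier N" "g b' \<in> carrier N"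
      using hD gD that * by auto
    have "h a \<oplus>\<^bsub>N\<^esub> g b = (h a \<ominus>\<^bsub>N\<^esub> h a') \<oplus>\<^bsub>N\<^esub> (h a' \<oplus>\<^bsub>N\<^esub> g b)" using c' by (simp add: N.M.group_simps)
    also have "\<dots> = h a' \<oplus>\<^bsub>N\<^esub> g b'" unfolding e2 using c' by (simp add: N.M.group_simps)
    finally show ?thesis using * by simp
  qed
  show ?thesis
  proof (intro exI conjI ballI)
    show fK: "f x = h x" if "x \<in> K" for x
      using f[OF that Ls(3)] linear_on_zero[OF V N L g] hD(1)[OF that] Ks(2)[OF that] by simp
    show fL: "f x = g x" if "x \<in> L" for x
      using f[OF Ks(3) that] linear_on_zero[OF V N K h] gD(1)[OF that] Ls(2)[OF that] by simp
    show "linear_on R V (submodule_sum V K L) N f"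
      unfolding linear_on_def
    proof (intro conjI ballI)
      fix x assume "x \<in> submodule_sum V K L"
      then obtain a b where ab: "a \<in> K" "b \<in> L" "x = a \<oplus>\<^bsub>V\<^esub> b" by (auto simp: submodule_sum_def)
      then have fx: "f x = h a \<oplus>\<^bsub>N\<^esub> g b" using f by simp
      then show "f x \<in> carrier N" using ab hD gD by simp
      { fix r assume r: "r \<in> carrier R"
        have "r \<odot>\<^bsub>V\<^esub> x = (r \<odot>\<^bsub>V\<^esub> a) \<oplus>\<^bsub>V\<^esub> (r \<odot>\<^bsub>V\<^esub> b)" using r ab Ks(2) Ls(2) by (simp add: V.smult_r_distr)
        then show "f (r \<odot>\<^bsub>V\<^esub> x) = r \<odot>\<^bsub>N\<^esub> f x" using f[of "r \<odot>\<^bsub>V\<^esub> a" "r \<odot>\<^bsub>V\<^esub> b"] fx r ab hD gD Ks Ls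
          by (simp add: N.smult_r_distr) }
      { fix y assume "y \<in> submodule_sum V K L"
        then obtain c d where cd: "c \<in> K" "d \<in> L" "y = c \<oplus>\<^bsub>V\<^esub> d" by (auto simp: submodule_sum_def)
        have "x \<oplus>\<^bsub>V\<^esub> y = (a \<oplus>\<^bsub>V\<^esub> c) \<oplus>\<^bsub>V\<^esub> (b \<oplus>\<^bsub>V\<^esub> d)" using ab cd Ks(2) Ls(2) by (simp add: V.a_ac)
        then have "f (x \<oplus>\<^bsub>V\<^esub> y) = (h a \<oplus>\<^bsub>N\<^esub> h c) \<oplus>\<^bsub>N\<^esub> (g b \<oplus>\<^bsub>N\<^esub> g d)"
          using f[of "a \<oplus>\<^bsub>V\<^esub> c" "b \<oplus>\<^bsub>V\<^esub> d"] ab cd hD gD Ks Ls by simp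
        then show "f (x \<oplus>\<^bsub>V\<^esub> y) = f x \<oplus>\<^bsub>N\<^esub> f y" using f[OF cd(1,2)] cd(3) fx ab cd hD gD
          by (simp add: N.a_ac) }
    qed
  qed
qed

text \<open>The extension property of \<open>N\<close> for the inclusions \<open>B/I \<subseteq> R/I\<close>.\<close>

definition baer :: "('a, 'm) ring_scheme \<Rightarrow> 'a set \<Rightarrow> ('a, 'b, 'k) module_scheme \<Rightarrow> bool" where
  "baer R I N \<longleftrightarrow> (\<forall>B h. ideal B R \<longrightarrow> I \<subseteq> B \<longrightarrow> linear_on R (self_module R) B N h \<longrightarrow>
     (\<forall>i\<in>I. h i = \<zero>\<^bsub>N\<^esub>) \<longrightarrow> (\<exists>q\<in>carrier N. \<forall>b\<in>B. h b = b \<odot>\<^bsub>N\<^esub> q))"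

lemma baerD:
  assumes "baer R I N" "ideal B R" "I \<subseteq> B" "linear_on R (self_module R) B N h" "\<And>i. i \<in> I \<Longrightarrow> h i = \<zero>\<^bsub>N\<^esub>"
  shows "\<exists>q\<in>carrier N. \<forall>b\<in>B. h b = b \<odot>\<^bsub>N\<^esub> q"
  using assms unfolding baer_def by blast

text \<open>The multiples of \<open>e\<close> that lie in K define an ideal B containing I, and r ->
  h(re) is a map on B that vanishes on I. The element q given by Baer's condition is a consistent
  value at \<open>e\<close>; then h is glued with re -> rq.\<close>

lemma baer_extend_step:
  assumes V: "module R V" and N: "module R N" and baer: "baer R I N" and I: "ideal I R"
    and K: "submodule K R V" and h: "linear_on R V K N h" and e: "e \<in> carrier V"
    and IV: "\<And>i. i \<in> I \<Longrightarrow> i \<odot>\<^bsub>V\<^esub> e \<in> K" "\<And>i. i \<in> I \<Longrightarrow> h (i \<odot>\<^bsub>V\<^esub> e) = \<zero>\<^bsub>N\<^esub>"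
  shows "\<exists>L f. submodule L R V \<and> K \<subseteq> L \<and> e \<in> L \<and> linear_on R V L N f \<and> (\<forall>x\<in>K. f x = h x)"
proof -
  interpret V: module R V by fact
  interpret N: module R N by fact
  note Ks = submodule_mem[OF V K] and hD = linear_onD[OF h]
  let ?B = "{r \<in> carrier R. r \<odot>\<^bsub>V\<^esub> e \<in> K}"
  have B: "ideal ?B R"
    by (rule V.cring_idealI) (use e Ks in \<open>auto simp: V.smult_l_distr V.smult_assoc1\<close>)
  have "linear_on R (self_module R) ?B N (\<lambda>r. h (r \<odot>\<^bsub>V\<^esub> e))"
    unfolding linear_on_def using hD e by (auto simp: V.smult_l_distr V.smult_assoc1)
  then have "\<exists>q\<in>carrier N. \<forall>b\<in>?B. h (b \<odot>\<^bsub>V\<^esub> e) = b \<odot>\<^bsub>N\<^esub> q"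
  proof (rule baerD[OF baer B, rotated])
    show "I \<subseteq> ?B" using IV(1) ideal_carrier[OF I] by auto
  qed (use IV(2) in auto)
  then obtain q where q: "q \<in> carrier N" "\<And>b. b \<in> ?B \<Longrightarrow> h (b \<odot>\<^bsub>V\<^esub> e) = b \<odot>\<^bsub>N\<^esub> q" by blast
  let ?E = "{r \<odot>\<^bsub>V\<^esub> e | r. r \<in> carrier R}"
  have E: "submodule ?E R V"
    unfolding submodule_iff[OF V]
  proof (intro conjI ballI)
    show "\<zero>\<^bsub>V\<^esub> \<in> ?E" using e by (auto intro!: exI[of _ "\<zero>\<^bsub>R\<^esub>"])
    show "x \<oplus>\<^bsub>V\<^esub> y \<in> ?E" if "x \<in> ?E" "y \<in> ?E" for x y
      using that e by (auto simp: V.smult_l_distr[symmetric])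
    show "r \<odot>\<^bsub>V\<^esub> x \<in> ?E" if "x \<in> ?E" "r \<in> carrier R" for r x
      using that e by (auto simp: V.smult_assoc1[symmetric])
  qed (use e in auto)
  define g where "g x = (SOME y. \<exists>r\<in>carrier R. x = r \<odot>\<^bsub>V\<^esub> e \<and> y = r \<odot>\<^bsub>N\<^esub> q)" for x
  have g: "g (r \<odot>\<^bsub>V\<^esub> e) = r \<odot>\<^bsub>N\<^esub> q" if r: "r \<in> carrier R" for r
  proof -
    have "\<exists>s\<in>carrier R. r \<odot>\<^bsub>V\<^esub> e = s \<odot>\<^bsub>V\<^esub> e \<and> g (r \<odot>\<^bsub>V\<^esub> e) = s \<odot>\<^bsub>N\<^esub> q"
      unfolding g_def by (rule someI_ex) (use r in blast)
    then obtain s where s: "s \<in> carrier R" "r \<odot>\<^bsub>V\<^esub> e = s \<odot>\<^bsub>V\<^esub> e" "g (r \<odot>\<^bsub>V\<^esub> e) = s \<odot>\<^bsub>N\<^esub> q" by blast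
    \<comment> \<open>If re = se, then r - s lies in B and (r - s)q = h(0) = 0, so \<open>g\<close>
      is well defined.\<close>
    have "(r \<ominus>\<^bsub>R\<^esub> s) \<odot>\<^bsub>V\<^esub> e = \<zero>\<^bsub>V\<^esub>"
      using r s e by (simp add: a_minus_def V.smult_l_distr V.smult_l_minus V.M.r_neg)
    then have "(r \<ominus>\<^bsub>R\<^esub> s) \<odot>\<^bsub>N\<^esub> q = \<zero>\<^bsub>N\<^esub>"
      using q(2)[of "r \<ominus>\<^bsub>R\<^esub> s"] linear_on_zero[OF V N K h] Ks(3) r s by simp
    then have "r \<odot>\<^bsub>N\<^esub> q \<ominus>\<^bsub>N\<^esub> s \<odot>\<^bsub>N\<^esub> q = \<zero>\<^bsub>N\<^esub>"
      using r s q(1) by (simp add: a_minus_def N.smult_l_distr N.smult_l_minus)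
    then have "r \<odot>\<^bsub>N\<^esub> q = s \<odot>\<^bsub>N\<^esub> q" by (rule N.minus_eq_zeroD[rotated 2]) (use r s q(1) in auto)
    then show ?thesis using s by simp
  qed
  have gl: "linear_on R V ?E N g"
    unfolding linear_on_def
  proof (intro conjI ballI)
    fix x assume "x \<in> ?E" then obtain r where r: "r \<in> carrier R" "x = r \<odot>\<^bsub>V\<^esub> e" by auto
    show "g x \<in> carrier N" using r g q by simp
    { fix s assume s: "s \<in> carrier R"
      show "g (s \<odot>\<^bsub>V\<^esub> x) = s \<odot>\<^bsub>N\<^esub> g x" using g[of "s \<otimes>\<^bsub>R\<^esub> r"] g[OF r(1)] r s e q
        by (simp add: V.smult_assoc1 N.smult_assoc1) }
    { fix y assume "y \<in> ?E" then obtain s where s: "s \<in> carrier R" "y = s \<odot>\<^bsub>V\<^esub> e" by auto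
      show "g (x \<oplus>\<^bsub>V\<^esub> y) = g x \<oplus>\<^bsub>N\<^esub> g y" using g[of "r \<oplus>\<^bsub>R\<^esub> s"] g[OF r(1)] g[OF s(1)] r s e q
        by (simp add: V.smult_l_distr N.smult_l_distr) }
  qed
  have ag: "h x = g x" if "x \<in> K" "x \<in> ?E" for x using that q(2) g by auto
  obtain f where f: "linear_on R V (submodule_sum V K ?E) N f" "\<forall>x\<in>K. f x = h x"
    using linear_on_glue[OF V N K E h gl ag] by blast
  note S = submodule_sum_submodule[OF V K E]
  have "e \<in> ?E" using e by (auto intro!: exI[of _ "\<one>\<^bsub>R\<^esub>"])
  then have "e \<in> submodule_sum V K ?E" using S(3) by blast
  then show ?thesis using S(1,2) f by blast
qed

section \<open>Free modules of finite rank\<close>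

primrec lincomb :: "('a, 'b, 'k) module_scheme \<Rightarrow> (nat \<Rightarrow> 'b) \<Rightarrow> nat \<Rightarrow> (nat \<Rightarrow> 'a) \<Rightarrow> 'b" where
  "lincomb N g 0 v = \<zero>\<^bsub>N\<^esub>"
| "lincomb N g (Suc k) v = lincomb N g k v \<oplus>\<^bsub>N\<^esub> v k \<odot>\<^bsub>N\<^esub> g k"

text \<open>Vectors are functions that vanish from index \<open>k\<close> on, so R^k is literally a
  subset of R^(k+1); inductions on the rank rely on this. The fields \<open>monoid.mult\<close> and
  \<open>one\<close> are fillers demanded by the record type.\<close>

definition free_module :: "('a, 'm) ring_scheme \<Rightarrow> nat \<Rightarrow> ('a, nat \<Rightarrow> 'a) module" where
  "free_module R k =
     \<lparr>carrier = {v. (\<forall>i<k. v i \<in> carrier R) \<and> (\<forall>i\<ge>k. v i = \<zero>\<^bsub>R\<^esub>)},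
      monoid.mult = (\<lambda>u v. u), one = (\<lambda>_. \<zero>\<^bsub>R\<^esub>), ring.zero = (\<lambda>_. \<zero>\<^bsub>R\<^esub>),
      add = (\<lambda>u v i. u i \<oplus>\<^bsub>R\<^esub> v i), smult = (\<lambda>r v i. r \<otimes>\<^bsub>R\<^esub> v i)\<rparr>"

definition unit_vector :: "('a, 'm) ring_scheme \<Rightarrow> nat \<Rightarrow> nat \<Rightarrow> 'a" where
  "unit_vector R j = (\<lambda>i. if i = j then \<one>\<^bsub>R\<^esub> else \<zero>\<^bsub>R\<^esub>)"

lemma free_module_simps [simp]:
  "ring.zero (free_module R k) = (\<lambda>_. \<zero>\<^bsub>R\<^esub>)" "add (free_module R k) = (\<lambda>u v i. u i \<oplus>\<^bsub>R\<^esub> v i)"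
  "smult (free_module R k) = (\<lambda>r v i. r \<otimes>\<^bsub>R\<^esub> v i)"
  "v \<in> carrier (free_module R k) \<longleftrightarrow> (\<forall>i<k. v i \<in> carrier R) \<and> (\<forall>i\<ge>k. v i = \<zero>\<^bsub>R\<^esub>)"
  by (auto simp: free_module_def)

context cring
begin

lemma free_module_coeff: "v \<in> carrier (free_module R k) \<Longrightarrow> v i \<in> carrier R"
  by (cases "i < k") auto

lemma free_module_module: "module R (free_module R k)"
proof (rule moduleI)
  show "abelian_group (free_module R k)"
  proof (rule abelian_groupI)
    fix x assume x: "x \<in> carrier (free_module R k)"
    show "\<exists>y\<in>carrier (free_module R k). y \<oplus>\<^bsub>free_module R k\<^esub> x = \<zero>\<^bsub>free_module R k\<^esub>"
      by (rule bexI[of _ "\<lambda>i. \<ominus> x i"]) (use x free_module_coeff[OF x] in \<open>auto simp: l_neg\<close>)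
    show "\<zero>\<^bsub>free_module R k\<^esub> \<oplus>\<^bsub>free_module R k\<^esub> x = x" using free_module_coeff[OF x] by auto
    fix y assume y: "y \<in> carrier (free_module R k)"
    show "x \<oplus>\<^bsub>free_module R k\<^esub> y = y \<oplus>\<^bsub>free_module R k\<^esub> x"
      using free_module_coeff[OF x] free_module_coeff[OF y] by (auto simp: a_comm)
    fix z assume z: "z \<in> carrier (free_module R k)"
    show "x \<oplus>\<^bsub>free_module R k\<^esub> y \<oplus>\<^bsub>free_module R k\<^esub> z = x \<oplus>\<^bsub>free_module R k\<^esub> (y \<oplus>\<^bsub>free_module R k\<^esub> z)"
      using free_module_coeff[OF x] free_module_coeff[OF y] free_module_coeff[OF z] by (auto simp: a_assoc)
  qed auto
qed (use free_module_coeff in \<open>auto simp: l_distr r_distr m_assoc is_cring fun_eq_iff\<close>)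

lemma unit_vector_carrier: "j < k \<Longrightarrow> unit_vector R j \<in> carrier (free_module R k)"
  by (auto simp: unit_vector_def)

end

context module
begin

lemma lincomb_closed:
  "(\<And>i. i < k \<Longrightarrow> v i \<in> carrier R) \<Longrightarrow> (\<And>i. i < k \<Longrightarrow> g i \<in> carrier M) \<Longrightarrow> lincomb M g k v \<in> carrier M"
  by (induction k) auto

lemma lincomb_submodule:
  assumes "submodule K R M"
  shows "(\<And>i. i < k \<Longrightarrow> v i \<in> carrier R) \<Longrightarrow> (\<And>i. i < k \<Longrightarrow> g i \<in> K) \<Longrightarrow> lincomb M g k v \<in> K"
  by (induction k) (auto simp: submodule_mem[OF module_axioms assms])

lemma lincomb_cong: 
  "(\<And>i. i < k \<Longrightarrow> v i = w i) \<Longrightarrow> (\<And>i. i < k \<Longrightarrow> g i = f i) \<Longrightarrow> lincomb M g k v = lincomb M f k w"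
  by (induction k) auto

lemma lincomb_add:
  assumes "\<And>i. i < k \<Longrightarrow> v i \<in> carrier R" "\<And>i. i < k \<Longrightarrow> w i \<in> carrier R" "\<And>i. i < k \<Longrightarrow> g i \<in> carrier M"
  shows "lincomb M g k (\<lambda>i. v i \<oplus> w i) = lincomb M g k v \<oplus>\<^bsub>M\<^esub> lincomb M g k w"
  using assms
proof (induction k)
  case (Suc k)
  have "lincomb M g k v \<in> carrier M" "lincomb M g k w \<in> carrier M"
    using Suc.prems by (auto intro!: lincomb_closed)
  then show ?case using Suc by (simp add: smult_l_distr M.a_ac)
qed simp

lemma lincomb_smult:
  assumes "r \<in> carrier R" "\<And>i. i < k \<Longrightarrow> v i \<in> carrier R" "\<And>i. i < k \<Longrightarrow> g i \<in> carrier M"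
  shows "lincomb M g k (\<lambda>i. r \<otimes> v i) = r \<odot>\<^bsub>M\<^esub> lincomb M g k v"
  using assms
proof (induction k)
  case (Suc k)
  have "lincomb M g k v \<in> carrier M"
    using Suc.prems by (auto intro!: lincomb_closed)
  then show ?case using Suc by (simp add: smult_r_distr smult_assoc1)
qed simp

lemma lincomb_linear:
  assumes "\<And>i. i < k \<Longrightarrow> g i \<in> carrier M"
  shows "linear_on R (free_module R k) (carrier (free_module R k)) M (lincomb M g k)"
  unfolding linear_on_def using assms by (auto simp: lincomb_closed lincomb_add lincomb_smult)

lemma lincomb_unit_vector:
  assumes "\<And>i. i < k \<Longrightarrow> g i \<in> carrier M"
  shows "lincomb M g k (unit_vector R j) = (if j < k then g j else \<zero>\<^bsub>M\<^esub>)"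
  using assms
proof (induction k)
  case (Suc k)
  then show ?case by (cases "j < k") (auto simp: unit_vector_def less_Suc_eq)
qed simp

lemma linear_on_lincomb:
  assumes N: "module R N" and K: "submodule K R M" and h: "linear_on R M K N h"
    and "\<And>i. i < k \<Longrightarrow> v i \<in> carrier R" "\<And>i. i < k \<Longrightarrow> g i \<in> K"
  shows "h (lincomb M g k v) = lincomb N (\<lambda>i. h (g i)) k v"
  using assms(4,5)
proof (induction k)
  case 0
  then show ?case using linear_on_zero[OF module_axioms N K h] by simp
next
  case (Suc k)
  have "lincomb M g k v \<in> K" using Suc.prems lincomb_submodule[OF K] by simp
  then show ?case using Suc linear_onD[OF h] submodule_mem[OF module_axioms K] by simp
qed

end

lemma (in cring) lincomb_unit_vectors:
  assumes v: "v \<in> carrier (free_module R k)"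
  shows "lincomb (free_module R k) (unit_vector R) k v = v"
proof -
  have "lincomb (free_module R k) (unit_vector R) j v = (\<lambda>i. if i < j then v i else \<zero>)" if "j \<le> k" for j
    using that
  proof (induction j)
    case (Suc j)
    then show ?case using free_module_coeff[OF v] by (auto simp: unit_vector_def fun_eq_iff less_Suc_eq)
  qed simp
  then show ?thesis using v by (auto simp: fun_eq_iff)
qed

lemma (in cring) linear_on_free_module:
  assumes N: "module R N" and h: "linear_on R (free_module R k) (carrier (free_module R k)) N h"
    and v: "v \<in> carrier (free_module R k)"
  shows "h v = lincomb N (\<lambda>i. h (unit_vector R i)) k v"
proof -
  interpret F: module R "free_module R k" by (rule free_module_module)
  have "h (lincomb (free_module R k) (unit_vector R) k v) = lincomb N (\<lambda>i. h (unit_vector R i)) k v"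
    by (rule F.linear_on_lincomb[OF N F.carrier_is_submodule h]) (use v unit_vector_carrier in auto)
  then show ?thesis using lincomb_unit_vectors[OF v] by simp
qed

text \<open>The condition on vectors with all entries in I lets h be glued with the zero map on I
  R^k. This first extension is what keeps the value at i times a unit vector equal to zero, for i in
  I, while the unit vectors are adjoined one at a time.\<close>

lemma baer_extend:
  assumes N: "module R N" and baer: "baer R I N" and I: "ideal I R"
    and K: "submodule K R (free_module R k)" and h: "linear_on R (free_module R k) K N h"
    and IK: "\<And>v. v \<in> K \<Longrightarrow> (\<And>j. v j \<in> I) \<Longrightarrow> h v = \<zero>\<^bsub>N\<^esub>"
  shows "\<exists>f. linear_on R (free_module R k) (carrier (free_module R k)) N f \<and> (\<forall>x\<in>K. f x = h x)"
proof -
  interpret N: module R N by fact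
  let ?V = "free_module R k"
  have V: "module R ?V" by (rule N.free_module_module)
  interpret V: module R ?V by (rule V)
  let ?L = "{v \<in> carrier ?V. \<forall>j. v j \<in> I}"
  have L: "submodule ?L R ?V"
    unfolding submodule_iff[OF V] using ideal_closed[OF I] by auto
  have zl: "linear_on R ?V ?L N (\<lambda>_. \<zero>\<^bsub>N\<^esub>)" by (auto simp: linear_on_def)
  have "\<exists>h0. linear_on R ?V (submodule_sum ?V K ?L) N h0 \<and> (\<forall>x\<in>K. h0 x = h x) \<and> (\<forall>x\<in>?L. h0 x = \<zero>\<^bsub>N\<^esub>)"
    by (rule linear_on_glue[OF V N K L h zl]) (use IK in auto)
  then obtain h0 where h0: "linear_on R ?V (submodule_sum ?V K ?L) N h0" "\<forall>x\<in>K. h0 x = h x"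
    "\<forall>x\<in>?L. h0 x = \<zero>\<^bsub>N\<^esub>" by blast
  note S = submodule_sum_submodule[OF V K L]
  have "\<exists>L' f. submodule L' R ?V \<and> submodule_sum ?V K ?L \<subseteq> L' \<and> (\<forall>i<j. unit_vector R i \<in> L') \<and>
      linear_on R ?V L' N f \<and> (\<forall>x\<in>submodule_sum ?V K ?L. f x = h0 x)" if "j \<le> k" for j
    using that
  proof (induction j)
    case 0
    then show ?case using S h0 by blast
  next
    case (Suc j)
    then obtain L' f where L': "submodule L' R ?V" "submodule_sum ?V K ?L \<subseteq> L'" "\<forall>i<j. unit_vector R i \<in> L'"
      "linear_on R ?V L' N f" "\<forall>x\<in>submodule_sum ?V K ?L. f x = h0 x" by auto
    have e: "unit_vector R j \<in> carrier ?V" using Suc by (intro N.unit_vector_carrier) simp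
    have ie: "i \<odot>\<^bsub>?V\<^esub> unit_vector R j \<in> ?L" if "i \<in> I" for i
    proof -
      have "i \<in> carrier R" by (rule ideal_carrier[OF I that])
      then show ?thesis using that e V.smult_closed[OF _ e, of i] ideal_zero[OF I] by (auto simp: unit_vector_def)
    qed
    have "\<exists>L'' f'. submodule L'' R ?V \<and> L' \<subseteq> L'' \<and> unit_vector R j \<in> L'' \<and> linear_on R ?V L'' N f'
      \<and> (\<forall>x\<in>L'. f' x = f x)"
    proof (rule baer_extend_step[OF V N baer I L'(1,4) e])
      show "i \<odot>\<^bsub>?V\<^esub> unit_vector R j \<in> L'" if "i \<in> I" for i using ie[OF that] S(3) L'(2) by blast
      show "f (i \<odot>\<^bsub>?V\<^esub> unit_vector R j) = \<zero>\<^bsub>N\<^esub>" if "i \<in> I" for i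
        using ie[OF that] S(3) L'(5) h0(3) by (metis (no_types, lifting) subsetD)
    qed
    then obtain L'' f' where "submodule L'' R ?V" "L' \<subseteq> L''" "unit_vector R j \<in> L''" "linear_on R ?V L'' N f'"
      "\<forall>x\<in>L'. f' x = f x" by blast
    then show ?case using L' by (intro exI[of _ L''] exI[of _ f']) (auto simp: less_Suc_eq subset_iff)
  qed
  then obtain L' f where L': "submodule L' R ?V" "submodule_sum ?V K ?L \<subseteq> L'" "\<forall>i<k. unit_vector R i \<in> L'"
    "linear_on R ?V L' N f" "\<forall>x\<in>submodule_sum ?V K ?L. f x = h0 x" by blast
  have "v \<in> L'" if v: "v \<in> carrier ?V" for v
  proof -
    have "lincomb ?V (unit_vector R) k v \<in> L'" 
      by (rule V.lincomb_submodule[OF L'(1)]) (use L'(3) v in auto)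
    then show ?thesis using N.lincomb_unit_vectors[OF v] by simp
  qed
  then have "linear_on R ?V (carrier ?V) N f" using L'(4) linear_on_subset by blast
  moreover have "\<forall>x\<in>K. f x = h x"
  proof
    fix x assume x: "x \<in> K"
    then have "x \<in> submodule_sum ?V K ?L" using S(2) by (rule subsetD[rotated])
    then have "f x = h0 x" using L'(5) by (rule bspec[rotated])
    then show "f x = h x" using bspec[OF h0(2) x] by simp
  qed
  ultimately show ?thesis by blast
qed

section \<open>Free modules over a Noetherian ring are Noetherian\<close>

context noetherian_cring
begin

text \<open>Induction on the rank: the last coordinates form a chain of ideals, and the vectors with
  last coordinate zero form a chain in rank k. Once both are constant so is the given chain, because
  two vectors with the same last coordinate differ by one of the second kind.\<close>

lemma free_module_chain:
  assumes "\<And>n. submodule (S n) R (free_module R k)" "\<And>n. S n \<subseteq> S (Suc n)"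
  shows "\<exists>n::nat. \<forall>l\<ge>n. S l = S n"
  using assms
proof (induction k arbitrary: S)
  case 0
  have "S n = {\<lambda>_. \<zero>}" for n
  proof -
    have "S n \<subseteq> {\<lambda>_. \<zero>}" using submodule_mem(1)[OF free_module_module 0(1)[of n]] by (auto simp: fun_eq_iff)
    moreover have "(\<lambda>_. \<zero>) \<in> S n" using submodule_mem(3)[OF free_module_module 0(1)[of n]] by simp
    ultimately show ?thesis by blast
  qed
  then show ?case by blast
next
  case (Suc k)
  note V = free_module_module[of "Suc k"] and W = free_module_module[of k]
  interpret V: module R "free_module R (Suc k)" by (rule V)
  note s = submodule_mem[OF V Suc.prems(1)]
  have mono: "m \<le> n \<Longrightarrow> S m \<subseteq> S n" for m n by (rule lift_Suc_mono_le[of S, OF Suc.prems(2)])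
  have c: "v i \<in> carrier R" if "v \<in> S n" for v n i using free_module_coeff[OF s(2)[OF that]] .
  let ?A = "\<lambda>n. (\<lambda>v. v k) ` S n" and ?T = "\<lambda>n. {v \<in> S n. v k = \<zero>}"
  have "ideal (?A n) R" for n
  proof (rule cring_idealI)
    show "?A n \<subseteq> carrier R" using c by auto
    show "\<zero> \<in> ?A n" using s(3)[of n] by (auto intro!: image_eqI[of _ _ "\<lambda>_. \<zero>"])
    show "x \<oplus> y \<in> ?A n" if "x \<in> ?A n" "y \<in> ?A n" for x y
      using that s(4)[of _ n] by (force intro: image_eqI)
    show "r \<otimes> x \<in> ?A n" if "x \<in> ?A n" "r \<in> carrier R" for r x
      using that s(7)[of r _ n] by (force intro: image_eqI)
  qed
  moreover have "?A n \<subseteq> ?A (Suc n)" for n using Suc.prems(2) by blast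
  ultimately have "\<exists>n. \<forall>l\<ge>n. ?A l = ?A n" by (rule noetherian_chain)
  then obtain n1 where n1: "\<And>l. l \<ge> n1 \<Longrightarrow> ?A l = ?A n1" by blast
  have "\<exists>n. \<forall>l\<ge>n. ?T l = ?T n"
  proof (rule Suc.IH)
    fix n
    have "v \<in> carrier (free_module R k)" if "v \<in> ?T n" for v
    proof -
      have v: "v \<in> carrier (free_module R (Suc k))" "v k = \<zero>" using s(2)[of v n] that by auto
      have "v i = \<zero>" if "k \<le> i" for i using v that by (cases "i = k") auto
      then show ?thesis using v(1) by simp
    qed
    then have "?T n \<subseteq> carrier (free_module R k)" by blast
    then show "submodule (?T n) R (free_module R k)"
      unfolding submodule_iff[OF W] using s(3)[of n] s(4)[of _ n] s(7)[of _ _ n] by auto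
    show "?T n \<subseteq> ?T (Suc n)" using Suc.prems(2) by blast
  qed
  then obtain n2 where n2: "\<And>l. l \<ge> n2 \<Longrightarrow> ?T l = ?T n2" by blast
  let ?n = "max n1 n2"
  have "S l \<subseteq> S ?n" if l: "l \<ge> ?n" for l
  proof
    fix v assume v: "v \<in> S l"
    then have "v k \<in> ?A l" by blast
    then have "v k \<in> ?A ?n" using n1[of l] n1[of ?n] l by simp
    then obtain w where w: "w \<in> S ?n" "w k = v k" by auto
    have wl: "w \<in> S l" using w mono[OF l] by blast
    let ?d = "v \<ominus>\<^bsub>free_module R (Suc k)\<^esub> w"
    have d: "?d \<in> S l" using s(6)[OF v wl] .
    have vd: "?d \<oplus>\<^bsub>free_module R (Suc k)\<^esub> w = v"
      using s(2)[OF v] s(2)[OF wl] by (simp only: V.M.minus_eq V.M.a_assoc V.M.a_inv_closed V.M.l_neg V.M.r_zero)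
    then have "?d k \<oplus> w k = v k" by (auto dest!: fun_cong)
    then have "?d k = \<zero>" using w c[OF v, of k] c[OF d, of k] by simp
    then have "?d \<in> ?T l" using d by simp
    then have "?d \<in> ?T ?n" using n2[of l] n2[of ?n] l by simp
    then have "?d \<in> S ?n" by simp
    then show "v \<in> S ?n" using s(4)[OF _ w(1)] vd by metis
  qed
  then have "\<forall>l\<ge>?n. S l = S ?n" using mono by blast
  then show ?case by blast
qed

end

lemma linear_on_image_submodule:
  assumes V: "module R V" and N: "module R N" and K: "submodule K R V" and h: "linear_on R V K N h"
  shows "submodule (h ` K) R N"
  unfolding submodule_iff[OF N]
proof (intro conjI ballI)
  note s = submodule_mem[OF V K] and l = linear_onD[OF h]
  show "h ` K \<subseteq> carrier N" using l(1) by auto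
  show "\<zero>\<^bsub>N\<^esub> \<in> h ` K" by (rule image_eqI[of _ h]) (use linear_on_zero[OF V N K h] s(3) in simp_all)
  fix x assume "x \<in> h ` K"
  then obtain a where a: "a \<in> K" "x = h a" by auto
  { fix y assume "y \<in> h ` K"
    then obtain b where b: "b \<in> K" "y = h b" by auto
    show "x \<oplus>\<^bsub>N\<^esub> y \<in> h ` K"
      by (rule image_eqI[of _ _ "a \<oplus>\<^bsub>V\<^esub> b"]) (use a b l(2) s(4) in auto) }
  { fix r assume r: "r \<in> carrier R"
    show "r \<odot>\<^bsub>N\<^esub> x \<in> h ` K"
      by (rule image_eqI[of _ _ "r \<odot>\<^bsub>V\<^esub> a"]) (use a r l(3) s(7) in auto) }
qed

context noetherian_cring
begin

text \<open>Otherwise elements of K could be chosen for ever, each outside the span of its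
  predecessors, and the spans would form a strictly increasing chain.\<close>

lemma free_module_submodule_generated:
  assumes K: "submodule K R (free_module R k)"
  shows "\<exists>m g. (\<forall>i<m. g i \<in> K) \<and> (\<forall>v\<in>K. \<exists>c\<in>carrier (free_module R m). v = lincomb (free_module R k) g m c)"
proof -
  let ?V = "free_module R k"
  note V = free_module_module[of k]
  interpret V: module R ?V by (rule V)
  let ?span = "\<lambda>g m. lincomb ?V g m ` carrier (free_module R m)"
  have "\<exists>g m. (\<forall>i<m. g i \<in> K) \<and> K \<subseteq> ?span g m"
  proof (rule ccontr)
    assume neg: "\<nexists>g m. (\<forall>i<m. g i \<in> K) \<and> K \<subseteq> ?span g m"
    have "\<exists>g. \<forall>n. g n \<in> K \<and> g n \<notin> ?span g n"
    proof -
      define pick where "pick g n = (SOME x. x \<in> K \<and> x \<notin> ?span g n)" for g n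
      have pick: "pick g n \<in> K \<and> pick g n \<notin> ?span g n" if "\<forall>i<n. g i \<in> K" for g n
      proof -
        have "\<not> ((\<forall>i<n. g i \<in> K) \<and> K \<subseteq> ?span g n)"
          using neg by (rule contrapos_nn) (intro exI, assumption)
        then have "\<not> K \<subseteq> ?span g n" using that by (rule contrapos_nn[OF _ conjI])
        then have "\<exists>x. x \<in> K \<and> x \<notin> ?span g n" by (auto simp only: subset_iff)
        then show ?thesis unfolding pick_def by (rule someI_ex)
      qed
      \<comment> \<open>The n-th choice depends on all earlier ones, so the recursion carries the
        whole function. The initial function is a filler: at stage n only values below n enter the
        span.\<close>
      define G where "G = rec_nat (\<lambda>_. pick undefined 0) (\<lambda>n g. g(n := pick g n))"
      define g where "g n = G (Suc n) n" for n
      have G: "G (Suc n) = (G n)(n := pick (G n) n)" for n by (simp add: G_def)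
      have Gg: "i < n \<Longrightarrow> G n i = g i" for n i
      proof (induction n)
        case (Suc n)
        then show ?case by (cases "i = n") (auto simp: g_def G)
      qed simp
      have sp: "?span (G n) n = ?span g n" for n
        by (rule image_cong[OF refl]) (rule V.lincomb_cong, simp_all add: Gg)
      have gn: "g n = pick (G n) n" for n by (simp add: g_def G)
      have "g n \<in> K \<and> g n \<notin> ?span g n" for n
      proof (induction n rule: less_induct)
        case (less n)
        then have "\<forall>i<n. G n i \<in> K" using Gg by simp
        from pick[OF this] show ?case by (simp add: gn[symmetric] sp)
      qed
      then show ?thesis by blast
    qed
    then obtain g where g: "\<And>n. g n \<in> K" "\<And>n. g n \<notin> ?span g n" by blast
    have gV: "g n \<in> carrier ?V" for n using submodule_mem(2)[OF V K g(1)] .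
    have "\<exists>n. \<forall>l\<ge>n. ?span g l = ?span g n"
    proof (rule free_module_chain)
      fix n
      interpret W: module R "free_module R n" by (rule free_module_module)
      show "submodule (?span g n) R ?V"
        by (rule linear_on_image_submodule[OF W.module_axioms V W.carrier_is_submodule V.lincomb_linear[OF gV]])
      show "?span g n \<subseteq> ?span g (Suc n)"
      proof (rule image_subsetI)
        fix c assume c: "c \<in> carrier (free_module R n)"
        have "c n = \<zero>" using c by simp
        moreover have "lincomb ?V g n c \<in> carrier ?V" by (rule V.lincomb_closed) (use c gV in auto)
        ultimately have "lincomb ?V g (Suc n) c = lincomb ?V g n c"
          using gV[of n] by (simp only: lincomb.simps V.smult_l_null V.M.r_zero)
        moreover have "c \<in> carrier (free_module R (Suc n))" using c by (auto simp: less_Suc_eq)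
        ultimately show "lincomb ?V g n c \<in> ?span g (Suc n)" by (metis image_eqI)
      qed
    qed
    then obtain n where n: "\<forall>l\<ge>n. ?span g l = ?span g n" ..
    have "g n = lincomb ?V g (Suc n) (unit_vector R n)" using V.lincomb_unit_vector[of "Suc n" g n] gV by simp
    then have "g n \<in> ?span g (Suc n)" using unit_vector_carrier[of n "Suc n"] by blast
    moreover have "?span g (Suc n) = ?span g n" using n by (meson le_Suc_eq order_refl)
    ultimately show False using g(2) by blast
  qed
  then obtain g m where "\<forall>i<m. g i \<in> K" "K \<subseteq> ?span g m" by blast
  then show ?thesis by blast
qed

end

section \<open>Operations on linear maps, lifting and extendability\<close>

lemma linear_on_comp:
  assumes "linear_on R V K N h" "linear_on R N L P g" "\<And>x. x \<in> K \<Longrightarrow> h x \<in> L"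
  shows "linear_on R V K P (\<lambda>x. g (h x))"
  unfolding linear_on_def using linear_onD[OF assms(1)] linear_onD[OF assms(2)] assms(3) by simp

lemma linear_on_lin:
  assumes N: "module R N" and "linear_on R V K N h" "linear_on R V K N g" "a \<in> carrier R"
  shows "linear_on R V K N (\<lambda>x. h x \<oplus>\<^bsub>N\<^esub> a \<odot>\<^bsub>N\<^esub> g x)"
proof -
  interpret N: module R N by fact
  note h = linear_onD[OF assms(2)] and g = linear_onD[OF assms(3)]
  show ?thesis
    unfolding linear_on_def
  proof (intro conjI ballI)
    fix x assume x: "x \<in> K"
    show "h x \<oplus>\<^bsub>N\<^esub> a \<odot>\<^bsub>N\<^esub> g x \<in> carrier N" using x h g assms by simp
    { fix y assume y: "y \<in> K"
      show "h (x \<oplus>\<^bsub>V\<^esub> y) \<oplus>\<^bsub>N\<^esub> a \<odot>\<^bsub>N\<^esub> g (x \<oplus>\<^bsub>V\<^esub> y) = h x \<oplus>\<^bsub>N\<^esub> a \<odot>\<^bsub>N\<^esub> g x \<oplus>\<^bsub>N\<^esub> (h y \<oplus>\<^bsub>N\<^esub> a \<odot>\<^bsub>N\<^esub> g y)"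
        unfolding h(2)[OF x y] g(2)[OF x y] using x y h(1) g(1) assms(4)
        by (simp add: N.smult_r_distr N.M.a_ac) }
    { fix r assume r: "r \<in> carrier R"
      show "h (r \<odot>\<^bsub>V\<^esub> x) \<oplus>\<^bsub>N\<^esub> a \<odot>\<^bsub>N\<^esub> g (r \<odot>\<^bsub>V\<^esub> x) = r \<odot>\<^bsub>N\<^esub> (h x \<oplus>\<^bsub>N\<^esub> a \<odot>\<^bsub>N\<^esub> g x)"
        unfolding h(3)[OF r x] g(3)[OF r x] using x r h(1) g(1) assms(4)
        by (simp add: N.smult_r_distr N.smult_assoc1[symmetric] N.R.m_comm) }
  qed
qed

lemma linear_on_const_zero: "module R N \<Longrightarrow> linear_on R V K N (\<lambda>_. \<zero>\<^bsub>N\<^esub>)"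
proof -
  assume "module R N" then interpret N: module R N .
  show ?thesis by (simp add: linear_on_def)
qed

lemma linear_on_kernel_submodule:
  assumes V: "module R V" and N: "module R N" and K: "submodule K R V" and h: "linear_on R V K N h"
  shows "submodule {x \<in> K. h x = \<zero>\<^bsub>N\<^esub>} R V"
proof -
  interpret N: module R N by fact
  show ?thesis
    unfolding submodule_iff[OF V]
    using submodule_mem[OF V K] linear_onD[OF h] linear_on_zero[OF V N K h] by auto
qed

lemma linear_on_factor:
  assumes W: "module R W" and V: "module R V" and N: "module R N"
    and p: "linear_on R W (carrier W) V p" and h: "linear_on R W (carrier W) N h"
    and ker: "\<And>c. c \<in> carrier W \<Longrightarrow> p c = \<zero>\<^bsub>V\<^esub> \<Longrightarrow> h c = \<zero>\<^bsub>N\<^esub>"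
  shows "\<exists>f. linear_on R V (p ` carrier W) N f \<and> (\<forall>c\<in>carrier W. f (p c) = h c)"
proof -
  interpret W: module R W by fact
  interpret V: module R V by fact
  interpret N: module R N by fact
  note pD = linear_onD[OF p] and hD = linear_onD[OF h]
  define s where "s x = (SOME c. c \<in> carrier W \<and> p c = x)" for x
  have s: "s (p c) \<in> carrier W" "p (s (p c)) = p c" if "c \<in> carrier W" for c
  proof -
    have "s (p c) \<in> carrier W \<and> p (s (p c)) = p c"
      unfolding s_def by (rule someI[of _ c]) (use that in simp)
    then show "s (p c) \<in> carrier W" "p (s (p c)) = p c" by auto
  qed
  have f: "h (s (p c)) = h c" if c: "c \<in> carrier W" for c
  proof -
    have "p (s (p c) \<ominus>\<^bsub>W\<^esub> c) = p (s (p c)) \<ominus>\<^bsub>V\<^esub> p c"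
      by (rule linear_on_minus[OF W V W.carrier_is_submodule p]) (use c s in auto)
    also have "\<dots> = \<zero>\<^bsub>V\<^esub>" using s(2)[OF c] pD(1)[OF c] by (simp add: V.M.r_neg V.M.minus_eq)
    finally have "h (s (p c) \<ominus>\<^bsub>W\<^esub> c) = \<zero>\<^bsub>N\<^esub>" using ker s c by simp
    moreover have "h (s (p c) \<ominus>\<^bsub>W\<^esub> c) = h (s (p c)) \<ominus>\<^bsub>N\<^esub> h c"
      by (rule linear_on_minus[OF W N W.carrier_is_submodule h]) (use c s in auto)
    ultimately show ?thesis using N.M.minus_eq_zeroD[of "h (s (p c))" "h c"] hD(1) s(1) c by simp
  qed
  have "linear_on R V (p ` carrier W) N (\<lambda>x. h (s x))"
    unfolding linear_on_def
  proof (intro conjI ballI)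
    fix x assume "x \<in> p ` carrier W"
    then obtain c where c: "c \<in> carrier W" "x = p c" by auto
    show "h (s x) \<in> carrier N" using c s hD(1) by simp
    { fix y assume "y \<in> p ` carrier W"
      then obtain b where b: "b \<in> carrier W" "y = p b" by auto
      show "h (s (x \<oplus>\<^bsub>V\<^esub> y)) = h (s x) \<oplus>\<^bsub>N\<^esub> h (s y)"
        using f[of "c \<oplus>\<^bsub>W\<^esub> b"] f[OF c(1)] f[OF b(1)] pD(2)[OF c(1) b(1)] hD(2)[OF c(1) b(1)] b c by simp }
    { fix r assume r: "r \<in> carrier R"
      show "h (s (r \<odot>\<^bsub>V\<^esub> x)) = r \<odot>\<^bsub>N\<^esub> h (s x)"
        using f[of "r \<odot>\<^bsub>W\<^esub> c"] f[OF c(1)] pD(3)[OF r c(1)] hD(3)[OF r c(1)] c r by simp }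
  qed
  then show ?thesis using f by blast
qed

text \<open>Projectivity of R^k. Only the images of the unit vectors have to lie in the range of
  \<open>d\<close>, so the statement also applies to differentials, whose image may be a proper
  submodule.\<close>

lemma free_module_lift:
  assumes N: "module R N" and P: "module R P" and d: "linear_on R N (carrier N) P d"
    and h: "linear_on R (free_module R k) (carrier (free_module R k)) P h"
    and im: "\<And>i. i < k \<Longrightarrow> h (unit_vector R i) \<in> d ` carrier N"
  shows "\<exists>f. linear_on R (free_module R k) (carrier (free_module R k)) N f \<and>
    (\<forall>v\<in>carrier (free_module R k). d (f v) = h v)"
proof -
  interpret N: module R N by fact
  have "\<forall>i. \<exists>q. i < k \<longrightarrow> q \<in> carrier N \<and> d q = h (unit_vector R i)"
  proof
    fix i show "\<exists>q. i < k \<longrightarrow> q \<in> carrier N \<and> d q = h (unit_vector R i)"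
      using im[of i] by (cases "i < k") (auto simp: image_iff)
  qed
  then obtain q where "\<forall>i. i < k \<longrightarrow> q i \<in> carrier N \<and> d (q i) = h (unit_vector R i)" by (rule choice[THEN exE])
  then have q: "\<And>i. i < k \<Longrightarrow> q i \<in> carrier N \<and> d (q i) = h (unit_vector R i)" by blast
  have "d (lincomb N q k v) = h v" if v: "v \<in> carrier (free_module R k)" for v
  proof -
    have "d (lincomb N q k v) = lincomb P (\<lambda>i. d (q i)) k v"
      by (rule N.linear_on_lincomb[OF P N.carrier_is_submodule d]) (use v q in auto)
    also have "\<dots> = lincomb P (\<lambda>i. h (unit_vector R i)) k v"
      by (rule module.lincomb_cong[OF P]) (use q in auto)
    also have "\<dots> = h v" by (rule N.linear_on_free_module[OF P h v, symmetric])
    finally show ?thesis .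
  qed
  moreover have "linear_on R (free_module R k) (carrier (free_module R k)) N (lincomb N q k)"
    by (rule N.lincomb_linear) (use q in auto)
  ultimately show ?thesis by blast
qed

text \<open>For a linear map K -> Z this says that the class of \<open>h\<close> vanishes in
  Ext^1(R^k/K, Z), the cokernel of Hom(R^k, Z) -> Hom(K, Z). The target Z is kept as a subset of N
  because it will consist of the cocycles in a member of the resolution.\<close>

definition extendable ::
    "('a, 'm) ring_scheme \<Rightarrow> nat \<Rightarrow> (nat \<Rightarrow> 'a) set \<Rightarrow> ('a, 'b, 'k) module_scheme \<Rightarrow> 'b set \<Rightarrow> ((nat \<Rightarrow> 'a) \<Rightarrow> 'b) \<Rightarrow> bool" where
  "extendable R k K N Z h \<longleftrightarrow>
     (\<exists>e. linear_on R (free_module R k) (carrier (free_module R k)) N e \<and>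
        (\<forall>v\<in>carrier (free_module R k). e v \<in> Z) \<and> (\<forall>v\<in>K. h v = e v))"

lemma extendable_lin:
  assumes N: "module R N" and Z: "submodule Z R N" and "extendable R k K N Z h" "extendable R k K N Z g" "a \<in> carrier R"
  shows "extendable R k K N Z (\<lambda>v. h v \<oplus>\<^bsub>N\<^esub> a \<odot>\<^bsub>N\<^esub> g v)"
proof -
  from assms(3) obtain e where e: "linear_on R (free_module R k) (carrier (free_module R k)) N e"
    "\<forall>v\<in>carrier (free_module R k). e v \<in> Z" "\<forall>v\<in>K. h v = e v" unfolding extendable_def by blast
  from assms(4) obtain f where f: "linear_on R (free_module R k) (carrier (free_module R k)) N f"
    "\<forall>v\<in>carrier (free_module R k). f v \<in> Z" "\<forall>v\<in>K. g v = f v" unfolding extendable_def by blast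
  have "linear_on R (free_module R k) (carrier (free_module R k)) N (\<lambda>v. e v \<oplus>\<^bsub>N\<^esub> a \<odot>\<^bsub>N\<^esub> f v)"
    by (rule linear_on_lin[OF N e(1) f(1) assms(5)])
  moreover have "\<forall>v\<in>carrier (free_module R k). e v \<oplus>\<^bsub>N\<^esub> a \<odot>\<^bsub>N\<^esub> f v \<in> Z"
    using e(2) f(2) submodule_mem(4,7)[OF N Z] assms(5) by blast
  moreover have "\<forall>v\<in>K. h v \<oplus>\<^bsub>N\<^esub> a \<odot>\<^bsub>N\<^esub> g v = e v \<oplus>\<^bsub>N\<^esub> a \<odot>\<^bsub>N\<^esub> f v" using e(3) f(3) by simp
  ultimately show ?thesis unfolding extendable_def by blast
qed

lemma extendable_zero:
  assumes N: "module R N" and Z: "submodule Z R N"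
  shows "extendable R k K N Z (\<lambda>_. \<zero>\<^bsub>N\<^esub>)"
  unfolding extendable_def using linear_on_const_zero[OF N] submodule_mem(3)[OF N Z] by blast

lemma extendable_cong: "(\<And>v. v \<in> K \<Longrightarrow> h v = g v) \<Longrightarrow> extendable R k K N Z h \<longleftrightarrow> extendable R k K N Z g"
  unfolding extendable_def by simp

lemma extendable_linear:
  assumes "extendable R k K N Z h" "module R (free_module R k)" "submodule K R (free_module R k)"
  shows "linear_on R (free_module R k) K N h"
proof -
  from assms(1) obtain e where e: "linear_on R (free_module R k) (carrier (free_module R k)) N e"
    "\<forall>v\<in>K. h v = e v" unfolding extendable_def by blast
  have "linear_on R (free_module R k) K N e"
    using e(1) submodule_mem(1)[OF assms(2,3)] by (rule linear_on_subset)
  then show ?thesis unfolding linear_on_def using e(2) submodule_mem[OF assms(2,3)] by simp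
qed

section \<open>Local rings\<close>

locale local_noetherian_cring = noetherian_cring +
  assumes unique_maximal: "\<exists>!I. maximalideal I R"
begin

lemma max_ideal_maximal: "maximalideal (max_ideal R) R"
  unfolding max_ideal_def by (rule theI'[OF unique_maximal])

lemma max_ideal_eqI: "maximalideal I R \<Longrightarrow> I = max_ideal R"
  using unique_maximal max_ideal_maximal by blast

lemma max_ideal_prime: "primeideal (max_ideal R) R"
  by (rule maximalideal_prime[OF max_ideal_maximal])

lemma max_ideal_ideal: "ideal (max_ideal R) R"
  using max_ideal_prime primeideal.axioms(1) by blast

lemma proper_ideal_subset:
  assumes I: "ideal I R" "I \<noteq> carrier R" shows "I \<subseteq> max_ideal R"
proof -
  let ?S = "{J. ideal J R \<and> I \<subseteq> J \<and> J \<noteq> carrier R}"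
  have "?S \<noteq> {}" using I by blast
  moreover have "\<And>J. J \<in> ?S \<Longrightarrow> ideal J R" by blast
  ultimately obtain M where M: "M \<in> ?S" and mx: "\<And>J. J \<in> ?S \<Longrightarrow> M \<subseteq> J \<Longrightarrow> J = M"
    by (rule noetherian_maximal) blast+
  have "maximalideal M R"
  proof (rule maximalidealI)
    show "J = M \<or> J = carrier R" if "ideal J R" "M \<subseteq> J" "J \<subseteq> carrier R" for J
      using mx[of J] M that by blast
  qed (use M in auto)
  then show ?thesis using max_ideal_eqI M by blast
qed

lemma unit_outside_max_ideal:
  assumes a: "a \<in> carrier R" "a \<notin> max_ideal R"
  obtains b where "b \<in> carrier R" "b \<otimes> a = \<one>"
proof -
  let ?I = "adjoin R {\<zero>} a"
  have "ideal ?I R" by (rule adjoin_ideal[OF zeroideal a(1)])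
  moreover have "a \<in> ?I" by (rule adjoin_self[OF zeroideal a(1)])
  ultimately have "?I = carrier R" using proper_ideal_subset[of ?I] a by blast
  then have "\<one> \<in> ?I" by simp
  then obtain i b where *: "i \<in> {\<zero>}" "b \<in> carrier R" "\<one> = i \<oplus> b \<otimes> a" by (rule adjoin_memE)
  then show thesis using that[of b] a by simp
qed

lemma one_minus_max_ideal_unit:
  assumes x: "x \<in> max_ideal R"
  obtains b where "b \<in> carrier R" "b \<otimes> (\<one> \<ominus> x) = \<one>"
proof -
  have xc: "x \<in> carrier R" by (rule ideal_carrier[OF max_ideal_ideal x])
  have "\<one> \<ominus> x \<notin> max_ideal R"
    using minus_swap[OF max_ideal_ideal, of \<one> x] x xc prime_one_notin[OF max_ideal_prime] by auto
  then show thesis using unit_outside_max_ideal[of "\<one> \<ominus> x"] xc that by auto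
qed

text \<open>Nakayama's lemma for the cokernel of \<open>Hom(R\<^sup>k, Ru) \<rightarrow> Hom(K, Ru)\<close>: the element of \<open>h 0\<close> in
  this finitely generated module is infinitely divisible by \<open>x\<close>.\<close>

lemma divisible_extendable:
  assumes N: "module R N" and u: "u \<in> carrier N" and Zdef: "Z = {r \<odot>\<^bsub>N\<^esub> u | r. r \<in> carrier R}" and Z: "submodule Z R N"
    and K: "submodule K R (free_module R k)" and x: "x \<in> max_ideal R"
    and h: "\<And>j::nat. linear_on R (free_module R k) K N (h j)" "\<And>j v. v \<in> K \<Longrightarrow> h j v \<in> Z"
    and step: "\<And>j. extendable R k K N Z (\<lambda>v. h j v \<ominus>\<^bsub>N\<^esub> x \<odot>\<^bsub>N\<^esub> h (Suc j) v)"
  shows "extendable R k K N Z (h 0)"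
proof -
  interpret N: module R N by fact
  let ?V = "free_module R k"
  interpret V: module R ?V by (rule free_module_module)
  note V = V.module_axioms
  let ?E = "extendable R k K N Z"
  note lin = extendable_lin[OF N Z, where k = k and K = K] and cong = extendable_cong[of K _ _ R k N Z]
  have xc: "x \<in> carrier R" by (rule ideal_carrier[OF max_ideal_ideal x])
  have hc: "h j v \<in> carrier N" if "v \<in> K" for j v using linear_onD(1)[OF h(1) that] .
  have Ec: "w v \<in> carrier N" if "?E w" "v \<in> K" for w v
    using linear_onD(1)[OF extendable_linear[OF that(1) V K] that(2)] .
  define w where "w j v = h j v \<ominus>\<^bsub>N\<^esub> x \<odot>\<^bsub>N\<^esub> h (Suc j) v" for j v
  have Ew: "?E (w j)" for j using step[of j] unfolding w_def .
  have hw: "h j v = w j v \<oplus>\<^bsub>N\<^esub> x \<odot>\<^bsub>N\<^esub> h (Suc j) v" if "v \<in> K" for j v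
    unfolding w_def using that xc hc by (simp add: N.M.group_simps)
  obtain m g where g: "\<forall>i<m. g i \<in> K" "\<forall>v\<in>K. \<exists>c\<in>carrier (free_module R m). v = lincomb ?V g m c"
    using free_module_submodule_generated[OF K] by blast
  let ?W = "free_module R m"
  note W = free_module_module[of m]
  \<comment> \<open>Every value in Z is a multiple of u, so a map is recorded by a vector in R^m of
    coefficients of its values on the m generators of K. \<open>S j\<close> collects the records of
    extendable maps plus multiples of h j; it grows with j since h j is extendable up to x times its
    successor.\<close>
  define S where "S j = {v \<in> carrier ?W. \<exists>e r. ?E e \<and> r \<in> carrier R \<and>
     (\<forall>l<m. v l \<odot>\<^bsub>N\<^esub> u = e (g l) \<oplus>\<^bsub>N\<^esub> r \<odot>\<^bsub>N\<^esub> h j (g l))}" for j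
  have SI: "v \<in> S j" if "v \<in> carrier ?W" "?E e" "r \<in> carrier R"
      "\<And>l. l < m \<Longrightarrow> v l \<odot>\<^bsub>N\<^esub> u = e (g l) \<oplus>\<^bsub>N\<^esub> r \<odot>\<^bsub>N\<^esub> h j (g l)" for v j e r
    unfolding S_def using that by blast
  have SE: "\<exists>e r. v \<in> carrier ?W \<and> ?E e \<and> r \<in> carrier R \<and>
     (\<forall>l<m. v l \<odot>\<^bsub>N\<^esub> u = e (g l) \<oplus>\<^bsub>N\<^esub> r \<odot>\<^bsub>N\<^esub> h j (g l))" if "v \<in> S j" for v j
    using that unfolding S_def by blast
  have "\<exists>n. \<forall>l\<ge>n. S l = S n"
  proof (rule free_module_chain)
    fix j
    show "submodule (S j) R ?W"
      unfolding submodule_iff[OF W]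
    proof (intro conjI ballI)
      show "S j \<subseteq> carrier ?W" unfolding S_def by blast
      show "\<zero>\<^bsub>?W\<^esub> \<in> S j"
        by (rule SI[OF _ extendable_zero[OF N Z] zero_closed]) (use g hc u in auto)
    next
      fix v v' assume v: "v \<in> S j" "v' \<in> S j"
      then obtain e r e' r' where *: "v \<in> carrier ?W" "?E e" "r \<in> carrier R"
        "\<forall>l<m. v l \<odot>\<^bsub>N\<^esub> u = e (g l) \<oplus>\<^bsub>N\<^esub> r \<odot>\<^bsub>N\<^esub> h j (g l)"
        "v' \<in> carrier ?W" "?E e'" "r' \<in> carrier R"
        "\<forall>l<m. v' l \<odot>\<^bsub>N\<^esub> u = e' (g l) \<oplus>\<^bsub>N\<^esub> r' \<odot>\<^bsub>N\<^esub> h j (g l)"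
        using SE[OF v(1)] SE[OF v(2)] by blast
      show "v \<oplus>\<^bsub>?W\<^esub> v' \<in> S j"
      proof (rule SI[OF _ lin[OF *(2,6) one_closed]])
        show "v \<oplus>\<^bsub>?W\<^esub> v' \<in> carrier ?W" using * by simp
        show "r \<oplus> r' \<in> carrier R" using * by simp
        fix l assume l: "l < m"
        then have gl: "g l \<in> K" using g by simp
        have "(v \<oplus>\<^bsub>?W\<^esub> v') l \<odot>\<^bsub>N\<^esub> u = v l \<odot>\<^bsub>N\<^esub> u \<oplus>\<^bsub>N\<^esub> v' l \<odot>\<^bsub>N\<^esub> u" using * l u by (simp add: N.smult_l_distr)
        also have "\<dots> = (e (g l) \<oplus>\<^bsub>N\<^esub> r \<odot>\<^bsub>N\<^esub> h j (g l)) \<oplus>\<^bsub>N\<^esub> (e' (g l) \<oplus>\<^bsub>N\<^esub> r' \<odot>\<^bsub>N\<^esub> h j (g l))" using * l by simp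
        also have "\<dots> = e (g l) \<oplus>\<^bsub>N\<^esub> \<one> \<odot>\<^bsub>N\<^esub> e' (g l) \<oplus>\<^bsub>N\<^esub> (r \<oplus> r') \<odot>\<^bsub>N\<^esub> h j (g l)"
          using *(3,7) hc[OF gl] Ec[OF *(2) gl] Ec[OF *(6) gl] by (simp add: N.smult_l_distr N.M.a_ac)
        finally show "(v \<oplus>\<^bsub>?W\<^esub> v') l \<odot>\<^bsub>N\<^esub> u = e (g l) \<oplus>\<^bsub>N\<^esub> \<one> \<odot>\<^bsub>N\<^esub> e' (g l) \<oplus>\<^bsub>N\<^esub> (r \<oplus> r') \<odot>\<^bsub>N\<^esub> h j (g l)" .
      qed
    next
      fix s v assume s: "s \<in> carrier R" and "v \<in> S j"
      then obtain e r where *: "v \<in> carrier ?W" "?E e" "r \<in> carrier R"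
        "\<forall>l<m. v l \<odot>\<^bsub>N\<^esub> u = e (g l) \<oplus>\<^bsub>N\<^esub> r \<odot>\<^bsub>N\<^esub> h j (g l)"
        using SE[of v j] by blast
      show "s \<odot>\<^bsub>?W\<^esub> v \<in> S j"
      proof (rule SI[OF _ lin[OF extendable_zero[OF N Z] *(2) s]])
        show "s \<odot>\<^bsub>?W\<^esub> v \<in> carrier ?W" using * s by simp
        show "s \<otimes> r \<in> carrier R" using * s by simp
        fix l assume l: "l < m"
        then have gl: "g l \<in> K" using g by simp
        have "(s \<odot>\<^bsub>?W\<^esub> v) l \<odot>\<^bsub>N\<^esub> u = s \<odot>\<^bsub>N\<^esub> (v l \<odot>\<^bsub>N\<^esub> u)" using * l u s by (simp add: N.smult_assoc1)
        also have "\<dots> = s \<odot>\<^bsub>N\<^esub> (e (g l) \<oplus>\<^bsub>N\<^esub> r \<odot>\<^bsub>N\<^esub> h j (g l))" using * l by simp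
        also have "\<dots> = \<zero>\<^bsub>N\<^esub> \<oplus>\<^bsub>N\<^esub> s \<odot>\<^bsub>N\<^esub> e (g l) \<oplus>\<^bsub>N\<^esub> (s \<otimes> r) \<odot>\<^bsub>N\<^esub> h j (g l)"
          using *(3) s hc[OF gl] Ec[OF *(2) gl] by (simp add: N.smult_r_distr N.smult_assoc1)
        finally show "(s \<odot>\<^bsub>?W\<^esub> v) l \<odot>\<^bsub>N\<^esub> u = \<zero>\<^bsub>N\<^esub> \<oplus>\<^bsub>N\<^esub> s \<odot>\<^bsub>N\<^esub> e (g l) \<oplus>\<^bsub>N\<^esub> (s \<otimes> r) \<odot>\<^bsub>N\<^esub> h j (g l)" .
      qed
    qed
    show "S j \<subseteq> S (Suc j)"
    proof
      fix v assume "v \<in> S j"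
      then obtain e r where *: "v \<in> carrier ?W" "?E e" "r \<in> carrier R"
        "\<forall>l<m. v l \<odot>\<^bsub>N\<^esub> u = e (g l) \<oplus>\<^bsub>N\<^esub> r \<odot>\<^bsub>N\<^esub> h j (g l)"
        using SE[of v j] by blast
      show "v \<in> S (Suc j)"
      proof (rule SI[OF *(1) lin[OF *(2) Ew *(3), of j]])
        show "r \<otimes> x \<in> carrier R" using * xc by simp
        fix l assume l: "l < m"
        then have gl: "g l \<in> K" using g by simp
        have "v l \<odot>\<^bsub>N\<^esub> u = e (g l) \<oplus>\<^bsub>N\<^esub> r \<odot>\<^bsub>N\<^esub> (w j (g l) \<oplus>\<^bsub>N\<^esub> x \<odot>\<^bsub>N\<^esub> h (Suc j) (g l))"
          using * l hw[OF gl, of j] by simp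
        also have "\<dots> = e (g l) \<oplus>\<^bsub>N\<^esub> r \<odot>\<^bsub>N\<^esub> w j (g l) \<oplus>\<^bsub>N\<^esub> (r \<otimes> x) \<odot>\<^bsub>N\<^esub> h (Suc j) (g l)"
          using *(3) xc hc[OF gl] Ec[OF *(2) gl] Ec[OF Ew gl] by (simp add: N.smult_r_distr N.smult_assoc1 N.M.a_assoc)
        finally show "v l \<odot>\<^bsub>N\<^esub> u = e (g l) \<oplus>\<^bsub>N\<^esub> r \<odot>\<^bsub>N\<^esub> w j (g l) \<oplus>\<^bsub>N\<^esub> (r \<otimes> x) \<odot>\<^bsub>N\<^esub> h (Suc j) (g l)" .
      qed
    qed
  qed
  then obtain n where "\<forall>l\<ge>n. S l = S n" ..
  then have n: "S (Suc n) = S n" by (meson le_Suc_eq order_refl)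
  let ?h = "h (Suc n)"
  have "\<forall>l. \<exists>r. l < m \<longrightarrow> r \<in> carrier R \<and> ?h (g l) = r \<odot>\<^bsub>N\<^esub> u"
    using h(2)[of _ "Suc n"] g(1) unfolding Zdef by blast
  then obtain c where "\<forall>l. l < m \<longrightarrow> c l \<in> carrier R \<and> ?h (g l) = c l \<odot>\<^bsub>N\<^esub> u" by (rule choice[THEN exE])
  then have c: "\<And>l. l < m \<Longrightarrow> c l \<in> carrier R \<and> ?h (g l) = c l \<odot>\<^bsub>N\<^esub> u" by blast
  \<comment> \<open>Stationarity at n puts the record of h (n+1) into \<open>S n\<close>, so h (n+1)
    = e + r h n with e extendable. Substituting h n = w n + x h (n+1) leaves the unit 1 - rx in
    front of h (n+1).\<close>
  have "(\<lambda>l. if l < m then c l else \<zero>) \<in> S (Suc n)"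
    by (rule SI[OF _ extendable_zero[OF N Z] one_closed]) (use c u in auto)
  then obtain e r where *: "?E e" "r \<in> carrier R"
    "\<forall>l<m. (if l < m then c l else \<zero>) \<odot>\<^bsub>N\<^esub> u = e (g l) \<oplus>\<^bsub>N\<^esub> r \<odot>\<^bsub>N\<^esub> h n (g l)"
    using SE[of _ n] n by blast
  have eqg: "?h (g l) = e (g l) \<oplus>\<^bsub>N\<^esub> r \<odot>\<^bsub>N\<^esub> h n (g l)" if "l < m" for l
    using *(3) that c[OF that] by simp
  have eq: "?h v = e v \<oplus>\<^bsub>N\<^esub> r \<odot>\<^bsub>N\<^esub> h n v" if v: "v \<in> K" for v
  proof -
    obtain a where a: "a \<in> carrier ?W" "v = lincomb ?V g m a" using g(2) v by blast
    have "?h v = lincomb N (\<lambda>i. ?h (g i)) m a" unfolding a(2)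
      by (rule V.linear_on_lincomb[OF N K h(1)]) (use a g in auto)
    also have "\<dots> = lincomb N (\<lambda>i. e (g i) \<oplus>\<^bsub>N\<^esub> r \<odot>\<^bsub>N\<^esub> h n (g i)) m a"
      by (rule N.lincomb_cong) (use eqg in auto)
    also have "\<dots> = e v \<oplus>\<^bsub>N\<^esub> r \<odot>\<^bsub>N\<^esub> h n v" unfolding a(2)
      by (rule V.linear_on_lincomb[OF N K linear_on_lin[OF N extendable_linear[OF *(1) V K] h(1) *(2)], symmetric])
        (use a g in auto)
    finally show ?thesis .
  qed
  have rx: "r \<otimes> x \<in> max_ideal R" using x *(2) by (simp add: ideal_lmult[OF max_ideal_ideal])
  then obtain b where b: "b \<in> carrier R" "b \<otimes> (\<one> \<ominus> r \<otimes> x) = \<one>" by (rule one_minus_max_ideal_unit)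
  have E1: "?E (\<lambda>v. \<zero>\<^bsub>N\<^esub> \<oplus>\<^bsub>N\<^esub> b \<odot>\<^bsub>N\<^esub> (e v \<oplus>\<^bsub>N\<^esub> r \<odot>\<^bsub>N\<^esub> w n v))"
    by (rule lin[OF extendable_zero[OF N Z] lin[OF *(1) Ew *(2)] b(1)])
  have E2: "\<zero>\<^bsub>N\<^esub> \<oplus>\<^bsub>N\<^esub> b \<odot>\<^bsub>N\<^esub> (e v \<oplus>\<^bsub>N\<^esub> r \<odot>\<^bsub>N\<^esub> w n v) = ?h v" if v: "v \<in> K" for v
  proof -
    have cc: "e v \<in> carrier N" "w n v \<in> carrier N" "?h v \<in> carrier N"
      using Ec[OF *(1) v] Ec[OF Ew v] hc[OF v] by auto
    have "?h v = e v \<oplus>\<^bsub>N\<^esub> r \<odot>\<^bsub>N\<^esub> (w n v \<oplus>\<^bsub>N\<^esub> x \<odot>\<^bsub>N\<^esub> ?h v)" using eq[OF v] unfolding hw[OF v, of n] .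
    also have "\<dots> = (e v \<oplus>\<^bsub>N\<^esub> r \<odot>\<^bsub>N\<^esub> w n v) \<oplus>\<^bsub>N\<^esub> (r \<otimes> x) \<odot>\<^bsub>N\<^esub> ?h v"
      using cc *(2) xc by (simp add: N.smult_r_distr N.smult_assoc1 N.M.a_assoc)
    finally have e1: "?h v = (e v \<oplus>\<^bsub>N\<^esub> r \<odot>\<^bsub>N\<^esub> w n v) \<oplus>\<^bsub>N\<^esub> (r \<otimes> x) \<odot>\<^bsub>N\<^esub> ?h v" .
    have "e v \<oplus>\<^bsub>N\<^esub> r \<odot>\<^bsub>N\<^esub> w n v = ((e v \<oplus>\<^bsub>N\<^esub> r \<odot>\<^bsub>N\<^esub> w n v) \<oplus>\<^bsub>N\<^esub> (r \<otimes> x) \<odot>\<^bsub>N\<^esub> ?h v) \<ominus>\<^bsub>N\<^esub> (r \<otimes> x) \<odot>\<^bsub>N\<^esub> ?h v"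
      using cc *(2) xc by (simp add: N.M.group_simps)
    also have "\<dots> = ?h v \<ominus>\<^bsub>N\<^esub> (r \<otimes> x) \<odot>\<^bsub>N\<^esub> ?h v" by (simp only: e1[symmetric])
    also have "\<dots> = (\<one> \<ominus> r \<otimes> x) \<odot>\<^bsub>N\<^esub> ?h v"
      using cc *(2) xc by (simp add: a_minus_def N.smult_l_distr N.smult_l_minus)
    finally have "b \<odot>\<^bsub>N\<^esub> (e v \<oplus>\<^bsub>N\<^esub> r \<odot>\<^bsub>N\<^esub> w n v) = (b \<otimes> (\<one> \<ominus> r \<otimes> x)) \<odot>\<^bsub>N\<^esub> ?h v"
      using cc *(2) xc b(1) by (simp add: N.smult_assoc1)
    then show ?thesis using b(2) cc by simp
  qed
  have "?E ?h" by (rule cong[THEN iffD1, OF E2 E1])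
  \<comment> \<open>Descent from n+1 to 0: h j is the sum of the extendable w j and x times its
    successor.\<close>
  have "?E (h (Suc n - i))" for i
  proof (induction i)
    case (Suc i)
    show ?case
    proof (cases "i < Suc n")
      case True
      then have i: "Suc n - i = Suc (Suc n - Suc i)" by simp
      have "?E (\<lambda>v. w (Suc n - Suc i) v \<oplus>\<^bsub>N\<^esub> x \<odot>\<^bsub>N\<^esub> h (Suc (Suc n - Suc i)) v)"
        using Suc i by (intro lin[OF Ew _ xc]) simp
      moreover have "?E (h j) \<longleftrightarrow> ?E (\<lambda>v. w j v \<oplus>\<^bsub>N\<^esub> x \<odot>\<^bsub>N\<^esub> h (Suc j) v)" for j
        by (rule cong) (rule hw)
      ultimately show ?thesis by simp
    next
      case False
      then show ?thesis using Suc by simp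
    qed
  qed (use \<open>?E ?h\<close> in simp)
  from this[of "Suc n"] show ?thesis by simp
qed

end

section \<open>Injective resolutions and vanishing of Ext\<close>

text \<open>\<open>injective_module\<close> tests only modules on the type of the resolution, which
  here consists of pairs with a natural number. Ideals are copied there with tag 0; multiplication
  and unit are fillers.\<close>

definition ideal_copy :: "('a, 'm) ring_scheme \<Rightarrow> 'a set \<Rightarrow> ('a, 'a \<times> nat) module" where
  "ideal_copy R B = \<lparr>carrier = (\<lambda>a. (a, 0)) ` B, monoid.mult = (\<lambda>u v. u), one = (\<zero>\<^bsub>R\<^esub>, 0), ring.zero = (\<zero>\<^bsub>R\<^esub>, 0),
     add = (\<lambda>u v. (fst u \<oplus>\<^bsub>R\<^esub> fst v, 0)), smult = (\<lambda>r u. (r \<otimes>\<^bsub>R\<^esub> fst u, 0))\<rparr>"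

lemma ideal_copy_simps [simp]:
  "carrier (ideal_copy R B) = (\<lambda>a. (a, 0)) ` B" "ring.zero (ideal_copy R B) = (\<zero>\<^bsub>R\<^esub>, 0)"
  "add (ideal_copy R B) = (\<lambda>u v. (fst u \<oplus>\<^bsub>R\<^esub> fst v, 0))"
  "smult (ideal_copy R B) = (\<lambda>r u. (r \<otimes>\<^bsub>R\<^esub> fst u, 0))"
  by (auto simp: ideal_copy_def)

lemma (in cring) ideal_copy_module:
  assumes B: "ideal B R" shows "module R (ideal_copy R B)"
proof (rule moduleI)
  note c = ideal_carrier[OF B] and cl = ideal_closed[OF B]
  show "abelian_group (ideal_copy R B)"
  proof (rule abelian_groupI)
    fix x assume "x \<in> carrier (ideal_copy R B)"
    then obtain a where a: "a \<in> B" "x = (a, 0)" by auto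
    show "\<exists>y\<in>carrier (ideal_copy R B). y \<oplus>\<^bsub>ideal_copy R B\<^esub> x = \<zero>\<^bsub>ideal_copy R B\<^esub>"
      by (rule bexI[of _ "(\<ominus> a, 0)"]) (use a c cl in \<open>auto simp: l_neg\<close>)
  qed (use c cl in \<open>auto simp: a_ac\<close>)
qed (use ideal_closed[OF B] ideal_carrier[OF B] in \<open>auto simp: l_distr r_distr m_assoc is_cring\<close>)

text \<open>The inclusion of B into R is tested on copies of both. The resulting condition refers to
  no test module any more, so it can be applied to maps from modules on any type.\<close>

lemma (in cring) injective_module_baer:
  assumes Q: "injective_module R (Q :: ('a, 'a \<times> nat) module)"
  shows "baer R {\<zero>} Q"
  unfolding baer_def
proof (intro allI impI)
  fix B h assume B: "ideal B R" and h: "linear_on R (self_module R) B Q h"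
  note hD = linear_onD[OF h, simplified] and c = ideal_carrier[OF B]
  let ?M = "ideal_copy R B" and ?N = "ideal_copy R (carrier R)"
  have inj: "\<And>(M :: ('a, 'a \<times> nat) module) (N :: ('a, 'a \<times> nat) module) h g.
        module R M \<and> module R N \<and> h \<in> module_hom R M N \<and> inj_on h (carrier M)
          \<and> g \<in> module_hom R M Q
        \<longrightarrow> (\<exists>g'\<in>module_hom R N Q. \<forall>x\<in>carrier M. g' (h x) = g x)"
    using Q unfolding injective_module_def by blast
  have "module R ?M \<and> module R ?N \<and> (\<lambda>x. x) \<in> module_hom R ?M ?N \<and> inj_on (\<lambda>x. x) (carrier ?M)
      \<and> (\<lambda>u. h (fst u)) \<in> module_hom R ?M Q"
    using ideal_copy_module[OF B] ideal_copy_module[OF oneideal] c hD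
    unfolding module_hom_def by auto
  then have "\<exists>g'\<in>module_hom R ?N Q. \<forall>x\<in>carrier ?M. g' ((\<lambda>x. x) x) = h (fst x)"
    by (rule inj[rule_format])
  then obtain g where g: "g \<in> module_hom R ?N Q" "\<forall>x\<in>carrier ?M. g x = h (fst x)" by auto
  have "h b = b \<odot>\<^bsub>Q\<^esub> g (\<one>, 0)" if b: "b \<in> B" for b
  proof -
    have "linear_on R ?N (carrier ?N) Q g" using g(1) by (simp only: linear_on_module_hom)
    then have "g (b \<odot>\<^bsub>?N\<^esub> (\<one>, 0)) = b \<odot>\<^bsub>Q\<^esub> g (\<one>, 0)"
      by (rule linear_onD(3)) (use c[OF b] in auto)
    then have "g (b, 0) = b \<odot>\<^bsub>Q\<^esub> g (\<one>, 0)" using c[OF b] by simp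
    then show ?thesis using g(2) b by simp
  qed
  moreover have "g (\<one>, 0) \<in> carrier Q" using g(1) unfolding module_hom_def by auto
  ultimately show "\<exists>q\<in>carrier Q. \<forall>b\<in>B. h b = b \<odot>\<^bsub>Q\<^esub> q" by blast
qed

text \<open>Evaluation at 1 identifies Hom(R/B, M) with these elements when B is an ideal, so the
  complex Hom(R/B, J) can be studied inside J.\<close>

definition annihilated :: "('a, 'b, 'k) module_scheme \<Rightarrow> 'a set \<Rightarrow> 'b set" where
  "annihilated M B = {y \<in> carrier M. \<forall>b\<in>B. b \<odot>\<^bsub>M\<^esub> y = \<zero>\<^bsub>M\<^esub>}"

lemma annihilatedD: "y \<in> annihilated M B \<Longrightarrow> y \<in> carrier M" "y \<in> annihilated M B \<Longrightarrow> b \<in> B \<Longrightarrow> b \<odot>\<^bsub>M\<^esub> y = \<zero>\<^bsub>M\<^esub>"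
  by (auto simp: annihilated_def)

lemma (in module) annihilated_submodule:
  assumes "B \<subseteq> carrier R" shows "submodule (annihilated M B) R M"
  unfolding submodule_iff[OF module_axioms] annihilated_def
  using assms by (auto simp: smult_r_distr smult_assoc1[symmetric] subset_iff R.m_comm)
   (simp add: smult_assoc1)

lemma (in module) annihilated_adjoin:
  assumes I: "ideal I R" and a: "a \<in> carrier R"
  shows "y \<in> annihilated M (adjoin R I a) \<longleftrightarrow> y \<in> annihilated M I \<and> a \<odot>\<^bsub>M\<^esub> y = \<zero>\<^bsub>M\<^esub>"
proof
  assume "y \<in> annihilated M (adjoin R I a)"
  then show "y \<in> annihilated M I \<and> a \<odot>\<^bsub>M\<^esub> y = \<zero>\<^bsub>M\<^esub>"
    using adjoin_superset[OF I a] adjoin_self[OF I a] by (auto simp: annihilated_def)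
next
  assume y: "y \<in> annihilated M I \<and> a \<odot>\<^bsub>M\<^esub> y = \<zero>\<^bsub>M\<^esub>"
  show "y \<in> annihilated M (adjoin R I a)"
    using y a ideal_carrier[OF I] 
    by (auto simp: annihilated_def smult_l_distr smult_assoc1 elim!: adjoin_memE)
qed

text \<open>The homomorphism \<open>R/(I : a) \<rightarrow> N\<close> with value \<open>y\<close> at \<open>1\<close> extends along
  multiplication by \<open>a\<close>, from \<open>R/(I : a)\<close> to \<open>R/I\<close>.\<close>

lemma baer_divide:
  assumes N: "module R N" and baer: "baer R {\<zero>\<^bsub>R\<^esub>} N" and I: "ideal I R" and a: "a \<in> carrier R"
    and y: "y \<in> annihilated N (colon R I a)"
  shows "\<exists>q\<in>annihilated N I. a \<odot>\<^bsub>N\<^esub> q = y"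
proof -
  interpret N: module R N by fact
  have yc: "y \<in> carrier N" by (rule annihilatedD(1)[OF y])
  note Ic = ideal_carrier[OF I]
  let ?B = "adjoin R I a"
  note B = N.adjoin_ideal[OF I a]
  \<comment> \<open>This is a coefficient of a in b modulo I. It is unique only up to
    \<open>colon R I a\<close>, but that ideal kills y, so its product with y is well
    defined.\<close>
  define s where "s b = (SOME r. r \<in> carrier R \<and> b \<ominus>\<^bsub>R\<^esub> r \<otimes>\<^bsub>R\<^esub> a \<in> I)" for b
  have s: "s b \<odot>\<^bsub>N\<^esub> y = r \<odot>\<^bsub>N\<^esub> y" "s b \<in> carrier R" if r: "r \<in> carrier R" "b \<ominus>\<^bsub>R\<^esub> r \<otimes>\<^bsub>R\<^esub> a \<in> I" and b: "b \<in> carrier R" for r b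
  proof -
    have "s b \<in> carrier R \<and> b \<ominus>\<^bsub>R\<^esub> s b \<otimes>\<^bsub>R\<^esub> a \<in> I"
      unfolding s_def by (rule someI[of _ r]) (use r in simp)
    then have sb: "s b \<in> carrier R" "b \<ominus>\<^bsub>R\<^esub> s b \<otimes>\<^bsub>R\<^esub> a \<in> I" by auto
    have "(s b \<ominus>\<^bsub>R\<^esub> r) \<otimes>\<^bsub>R\<^esub> a = (b \<ominus>\<^bsub>R\<^esub> r \<otimes>\<^bsub>R\<^esub> a) \<ominus>\<^bsub>R\<^esub> (b \<ominus>\<^bsub>R\<^esub> s b \<otimes>\<^bsub>R\<^esub> a)"
      using sb(1) r(1) a b by Ring.algebra
    then have "s b \<ominus>\<^bsub>R\<^esub> r \<in> colon R I a"
      using ideal_minus[OF I r(2) sb(2)] sb(1) r(1) by (simp add: colon_def)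
    then have "(s b \<ominus>\<^bsub>R\<^esub> r) \<odot>\<^bsub>N\<^esub> y = \<zero>\<^bsub>N\<^esub>" by (rule annihilatedD(2)[OF y])
    then have "s b \<odot>\<^bsub>N\<^esub> y \<ominus>\<^bsub>N\<^esub> r \<odot>\<^bsub>N\<^esub> y = \<zero>\<^bsub>N\<^esub>"
      using sb(1) r(1) yc by (simp add: a_minus_def N.smult_l_distr N.smult_l_minus)
    then show "s b \<odot>\<^bsub>N\<^esub> y = r \<odot>\<^bsub>N\<^esub> y" by (rule N.M.minus_eq_zeroD[rotated 2]) (use sb(1) r(1) yc in auto)
    show "s b \<in> carrier R" by (rule sb(1))
  qed
  have mem: "(i \<oplus>\<^bsub>R\<^esub> r \<otimes>\<^bsub>R\<^esub> a) \<ominus>\<^bsub>R\<^esub> r \<otimes>\<^bsub>R\<^esub> a \<in> I" if "i \<in> I" "r \<in> carrier R" for i r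
  proof -
    have "(i \<oplus>\<^bsub>R\<^esub> r \<otimes>\<^bsub>R\<^esub> a) \<ominus>\<^bsub>R\<^esub> r \<otimes>\<^bsub>R\<^esub> a = i" using that Ic a by (simp add: N.R.group_simps)
    then show ?thesis using that by simp
  qed
  have val: "s (i \<oplus>\<^bsub>R\<^esub> r \<otimes>\<^bsub>R\<^esub> a) \<odot>\<^bsub>N\<^esub> y = r \<odot>\<^bsub>N\<^esub> y" if "i \<in> I" "r \<in> carrier R" for i r
    by (rule s(1)[OF that(2) mem[OF that]]) (use that Ic a in auto)
  have lin: "linear_on R (self_module R) ?B N (\<lambda>b. s b \<odot>\<^bsub>N\<^esub> y)"
    unfolding linear_on_def
  proof (intro conjI ballI)
    fix b assume "b \<in> ?B"
    then obtain i r where b: "i \<in> I" "r \<in> carrier R" "b = i \<oplus>\<^bsub>R\<^esub> r \<otimes>\<^bsub>R\<^esub> a" by (rule N.adjoin_memE)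
    have vb: "s b \<odot>\<^bsub>N\<^esub> y = r \<odot>\<^bsub>N\<^esub> y" unfolding b(3) by (rule val[OF b(1,2)])
    show "s b \<odot>\<^bsub>N\<^esub> y \<in> carrier N" using vb b yc by simp
    { fix t assume t: "t \<in> carrier R"
      have "t \<otimes>\<^bsub>R\<^esub> b = t \<otimes>\<^bsub>R\<^esub> i \<oplus>\<^bsub>R\<^esub> (t \<otimes>\<^bsub>R\<^esub> r) \<otimes>\<^bsub>R\<^esub> a" unfolding b(3) using b(1,2) t a Ic by Ring.algebra
      then have "s (t \<otimes>\<^bsub>R\<^esub> b) \<odot>\<^bsub>N\<^esub> y = (t \<otimes>\<^bsub>R\<^esub> r) \<odot>\<^bsub>N\<^esub> y"
        using val[OF ideal_lmult[OF I t b(1)], of "t \<otimes>\<^bsub>R\<^esub> r"] t b by simp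
      then show "s (t \<odot>\<^bsub>self_module R\<^esub> b) \<odot>\<^bsub>N\<^esub> y = t \<odot>\<^bsub>N\<^esub> (s b \<odot>\<^bsub>N\<^esub> y)"
        using vb t b yc by (simp add: N.smult_assoc1) }
    { fix c assume "c \<in> ?B"
      then obtain j t where c: "j \<in> I" "t \<in> carrier R" "c = j \<oplus>\<^bsub>R\<^esub> t \<otimes>\<^bsub>R\<^esub> a" by (rule N.adjoin_memE)
      have vc: "s c \<odot>\<^bsub>N\<^esub> y = t \<odot>\<^bsub>N\<^esub> y" unfolding c(3) by (rule val[OF c(1,2)])
      have "b \<oplus>\<^bsub>R\<^esub> c = (i \<oplus>\<^bsub>R\<^esub> j) \<oplus>\<^bsub>R\<^esub> (r \<oplus>\<^bsub>R\<^esub> t) \<otimes>\<^bsub>R\<^esub> a" unfolding b(3) c(3) using b(1,2) c(1,2) a Ic by Ring.algebra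
      then have "s (b \<oplus>\<^bsub>R\<^esub> c) \<odot>\<^bsub>N\<^esub> y = (r \<oplus>\<^bsub>R\<^esub> t) \<odot>\<^bsub>N\<^esub> y"
        using val[OF ideal_add[OF I b(1) c(1)], of "r \<oplus>\<^bsub>R\<^esub> t"] b c by simp
      then show "s (b \<oplus>\<^bsub>self_module R\<^esub> c) \<odot>\<^bsub>N\<^esub> y = s b \<odot>\<^bsub>N\<^esub> y \<oplus>\<^bsub>N\<^esub> s c \<odot>\<^bsub>N\<^esub> y"
        using vb vc b c yc by (simp add: N.smult_l_distr) }
  qed
  have valI: "s i \<odot>\<^bsub>N\<^esub> y = \<zero>\<^bsub>N\<^esub>" if "i \<in> I" for i
    using val[OF that, of "\<zero>\<^bsub>R\<^esub>"] that Ic a yc by simp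
  have "\<exists>q\<in>carrier N. \<forall>b\<in>?B. s b \<odot>\<^bsub>N\<^esub> y = b \<odot>\<^bsub>N\<^esub> q"
    by (rule baerD[OF baer B _ lin]) (use ideal_zero[OF B] valI ideal_zero[OF I] in auto)
  then obtain q where q: "q \<in> carrier N" "\<forall>b\<in>?B. s b \<odot>\<^bsub>N\<^esub> y = b \<odot>\<^bsub>N\<^esub> q" by blast
  have "a \<odot>\<^bsub>N\<^esub> q = s a \<odot>\<^bsub>N\<^esub> y" using q(2) N.adjoin_self[OF I a] by simp
  also have "\<dots> = y" using val[OF ideal_zero[OF I] N.R.one_closed] a yc by simp
  finally have "a \<odot>\<^bsub>N\<^esub> q = y" .
  moreover have "q \<in> annihilated N I"
    unfolding annihilated_def
  proof (intro CollectI conjI ballI)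
    fix i assume i: "i \<in> I"
    then have "i \<in> ?B" using N.adjoin_superset[OF I a] by blast
    then have "s i \<odot>\<^bsub>N\<^esub> y = i \<odot>\<^bsub>N\<^esub> q" using q(2) by blast
    then show "i \<odot>\<^bsub>N\<^esub> q = \<zero>\<^bsub>N\<^esub>" using valI[OF i] by simp
  qed (rule q(1))
  ultimately show ?thesis by blast
qed

locale resolved_local_ring = local_noetherian_cring R for R :: "('a, 'm) ring_scheme" (structure) +
  fixes J :: "nat \<Rightarrow> ('a, 'a \<times> nat) module" and aug :: "'a \<Rightarrow> 'a \<times> nat" and d :: "nat \<Rightarrow> 'a \<times> nat \<Rightarrow> 'a \<times> nat"
  assumes resolution: "injective_resolution R (self_module R) J aug d"
begin

lemma J_module: "module R (J i)"
  using resolution by (simp add: injective_resolution_def injective_module_def)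

lemma J_baer: "baer R {\<zero>} (J i)"
  using resolution injective_module_baer by (simp add: injective_resolution_def)

lemma d_linear: "linear_on R (J i) (carrier (J i)) (J (Suc i)) (d i)"
  using resolution by (simp add: injective_resolution_def linear_on_module_hom)

lemma d_image: "d i ` carrier (J i) = {x \<in> carrier (J (Suc i)). d (Suc i) x = \<zero>\<^bsub>J (Suc (Suc i))\<^esub>}"
  using resolution by (simp only: injective_resolution_def)

lemma exact:
  assumes "z \<in> carrier (J (Suc i))" "d (Suc i) z = \<zero>\<^bsub>J (Suc (Suc i))\<^esub>" shows "\<exists>j\<in>carrier (J i). d i j = z"
proof -
  have "z \<in> d i ` carrier (J i)" unfolding d_image using assms by simp
  then show ?thesis by (auto simp only: image_iff)
qed

lemma d_d: 
  assumes "j \<in> carrier (J i)" shows "d (Suc i) (d i j) = \<zero>\<^bsub>J (Suc (Suc i))\<^esub>"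
proof -
  have "d i j \<in> d i ` carrier (J i)" using assms by (rule imageI)
  then show ?thesis unfolding d_image by simp
qed

lemma d_closed: "j \<in> carrier (J i) \<Longrightarrow> d i j \<in> carrier (J (Suc i))"
  using linear_onD(1)[OF d_linear] .

lemma d_add: "x \<in> carrier (J i) \<Longrightarrow> y \<in> carrier (J i) \<Longrightarrow> d i (x \<oplus>\<^bsub>J i\<^esub> y) = d i x \<oplus>\<^bsub>J (Suc i)\<^esub> d i y"
  using linear_onD(2)[OF d_linear] .

lemma d_smult: "r \<in> carrier R \<Longrightarrow> x \<in> carrier (J i) \<Longrightarrow> d i (r \<odot>\<^bsub>J i\<^esub> x) = r \<odot>\<^bsub>J (Suc i)\<^esub> d i x"
  using linear_onD(3)[OF d_linear] .

lemma d_minus: "x \<in> carrier (J i) \<Longrightarrow> y \<in> carrier (J i) \<Longrightarrow> d i (x \<ominus>\<^bsub>J i\<^esub> y) = d i x \<ominus>\<^bsub>J (Suc i)\<^esub> d i y"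
  using linear_on_minus[OF J_module J_module carrier_submodule[OF J_module] d_linear] .

lemma d_zero: "d i \<zero>\<^bsub>J i\<^esub> = \<zero>\<^bsub>J (Suc i)\<^esub>"
  using linear_on_zero[OF J_module J_module carrier_submodule[OF J_module] d_linear] .

definition cocycles :: "nat \<Rightarrow> ('a \<times> nat) set" where
  "cocycles i = {z \<in> carrier (J i). d i z = \<zero>\<^bsub>J (Suc i)\<^esub>}"

lemma cocycles_submodule: "submodule (cocycles i) R (J i)"
  unfolding cocycles_def by (rule linear_on_kernel_submodule[OF J_module J_module carrier_submodule[OF J_module] d_linear])

lemma aug_linear: "linear_on R (self_module R) (carrier R) (J 0) aug"
  using resolution linear_on_module_hom[of R "self_module R" "J 0" aug] by (simp add: injective_resolution_def)

text \<open>The cocycles of degree 0 are the image of R, hence cyclic, which is the shape that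
  \<open>divisible_extendable\<close> asks for.\<close>

lemma cocycles_0: "cocycles 0 = {r \<odot>\<^bsub>J 0\<^esub> aug \<one> | r. r \<in> carrier R}"
proof -
  have "cocycles 0 = aug ` carrier R"
    using resolution by (simp add: injective_resolution_def cocycles_def)
  also have "\<dots> = (\<lambda>r. r \<odot>\<^bsub>J 0\<^esub> aug \<one>) ` carrier R"
  proof (rule image_cong[OF refl])
    show "aug r = r \<odot>\<^bsub>J 0\<^esub> aug \<one>" if "r \<in> carrier R" for r
      using linear_onD(3)[OF aug_linear that one_closed] that by simp
  qed
  finally show ?thesis by (simp only: Setcompr_eq_image)
qed

lemma aug_one: "aug \<one> \<in> carrier (J 0)"
  using linear_onD(1)[OF aug_linear] by simp

lemma aug_smult_zero: "r \<in> carrier R \<Longrightarrow> r \<odot>\<^bsub>J 0\<^esub> aug \<one> = \<zero>\<^bsub>J 0\<^esub> \<Longrightarrow> r = \<zero>"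
proof -
  assume r: "r \<in> carrier R" "r \<odot>\<^bsub>J 0\<^esub> aug \<one> = \<zero>\<^bsub>J 0\<^esub>"
  have "aug r = \<zero>\<^bsub>J 0\<^esub>" using linear_onD(3)[OF aug_linear r(1) one_closed] r by simp
  moreover have "aug \<zero> = \<zero>\<^bsub>J 0\<^esub>"
    using linear_on_zero[OF self_module_module J_module _ aug_linear] carrier_submodule[OF self_module_module] by simp
  moreover have "inj_on aug (carrier R)" using resolution by (simp add: injective_resolution_def)
  ultimately show "r = \<zero>" using r(1) inj_onD[of aug "carrier R" r \<zero>] by simp
qed

text \<open>An infinitely divisible element of \<open>Ext\<^sup>i\<^sup>+\<^sup>1(R\<^sup>k/K, R)\<close> vanishes: dimension shifting by a
  syzygy of \<open>K\<close> reduces this to the finitely generated case \<open>i = 0\<close>.\<close>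

lemma cocycles_divisible_extendable:
  assumes "submodule K R (free_module R k)" "x \<in> max_ideal R"
    and "\<And>j::nat. linear_on R (free_module R k) K (J i) (h j)" "\<And>j v. v \<in> K \<Longrightarrow> h j v \<in> cocycles i"
    and "\<And>j. extendable R k K (J i) (cocycles i) (\<lambda>v. h j v \<ominus>\<^bsub>J i\<^esub> x \<odot>\<^bsub>J i\<^esub> h (Suc j) v)"
  shows "extendable R k K (J i) (cocycles i) (h 0)"
  using assms
proof (induction i arbitrary: k K h)
  case 0
  show ?case
    by (rule divisible_extendable[OF J_module aug_one cocycles_0 cocycles_submodule "0.prems"(1,2)])
      (rule "0.prems", assumption?)+
next
  case (Suc i)
  note K = Suc.prems(1)
  let ?V = "free_module R k"
  interpret V: module R ?V by (rule free_module_module)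
  note V = V.module_axioms
  interpret N: module R "J i" by (rule J_module)
  interpret P: module R "J (Suc i)" by (rule J_module)
  note NM = N.module_axioms and PM = P.module_axioms
  have xc: "x \<in> carrier R" by (rule ideal_carrier[OF max_ideal_ideal Suc.prems(2)])
  obtain m g where g: "\<forall>l<m. g l \<in> K" "\<forall>v\<in>K. \<exists>c\<in>carrier (free_module R m). v = lincomb ?V g m c"
    using free_module_submodule_generated[OF K] by blast
  let ?W = "free_module R m"
  interpret W: module R ?W by (rule free_module_module)
  note W = W.module_axioms
  let ?p = "lincomb ?V g m"
  have gV: "\<And>l. l < m \<Longrightarrow> g l \<in> carrier ?V" using g(1) submodule_mem(2)[OF V K] by blast
  have p: "linear_on R ?W (carrier ?W) ?V ?p" by (rule V.lincomb_linear[OF gV])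
  have pK: "?p c \<in> K" if "c \<in> carrier ?W" for c
    by (rule V.lincomb_submodule[OF K]) (use that g in auto)
  have pimg: "?p ` carrier ?W = K" using pK g(2) by blast
  \<comment> \<open>This is the module of relations among the generators of K. Lifting a map from K
    to cocycles along the differential and restricting to the relations lowers the degree of the
    cocycles by one, so the induction hypothesis applies in R^m.\<close>
  let ?K' = "{c \<in> carrier ?W. ?p c = \<zero>\<^bsub>?V\<^esub>}"
  have K': "submodule ?K' R ?W" by (rule linear_on_kernel_submodule[OF W V W.carrier_is_submodule p])
  have lift: "\<exists>f. linear_on R (free_module R k') (carrier (free_module R k')) (J i) f \<and>
      (\<forall>v\<in>carrier (free_module R k'). d i (f v) = h' v)"
    if h': "linear_on R (free_module R k') (carrier (free_module R k')) (J (Suc i)) h'"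
      "\<And>v. v \<in> carrier (free_module R k') \<Longrightarrow> h' v \<in> cocycles (Suc i)" for k' h'
  proof (rule free_module_lift[OF NM PM d_linear h'(1)])
    fix l assume "l < k'"
    then have "h' (unit_vector R l) \<in> cocycles (Suc i)" using h'(2) unit_vector_carrier by blast
    then show "h' (unit_vector R l) \<in> d i ` carrier (J i)"
      unfolding d_image cocycles_def .
  qed
  have "\<exists>G. linear_on R ?W (carrier ?W) (J i) G \<and> (\<forall>c\<in>carrier ?W. d i (G c) = h j (?p c))" for j
    by (rule lift[OF linear_on_comp[OF p Suc.prems(3) pK]]) (use pK Suc.prems(4) in blast)+
  then have "\<forall>j. \<exists>G. linear_on R ?W (carrier ?W) (J i) G \<and> (\<forall>c\<in>carrier ?W. d i (G c) = h j (?p c))" by blast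
  then obtain G where G': "\<forall>j. linear_on R ?W (carrier ?W) (J i) (G j) \<and> (\<forall>c\<in>carrier ?W. d i (G j c) = h j (?p c))"
    by (rule choice[THEN exE])
  then have G: "linear_on R ?W (carrier ?W) (J i) (G j)" and dG: "\<And>c. c \<in> carrier ?W \<Longrightarrow> d i (G j c) = h j (?p c)" for j
    by blast+
  note Gc = linear_onD(1)[OF G]
  have "extendable R m ?K' (J i) (cocycles i) (G 0)"
  proof (rule Suc.IH[OF K' Suc.prems(2)])
    fix j
    show "linear_on R ?W ?K' (J i) (G j)" by (rule linear_on_subset[OF G]) blast
    show "G j c \<in> cocycles i" if "c \<in> ?K'" for c
    proof -
      have "d i (G j c) = h j \<zero>\<^bsub>?V\<^esub>" using dG[of c j] that by simp
      also have "\<dots> = \<zero>\<^bsub>J (Suc i)\<^esub>" by (rule linear_on_zero[OF V PM K Suc.prems(3)])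
      finally show ?thesis using Gc[of c j] that unfolding cocycles_def by simp
    qed
    obtain e where e: "linear_on R ?V (carrier ?V) (J (Suc i)) e" "\<forall>v\<in>carrier ?V. e v \<in> cocycles (Suc i)"
      "\<forall>v\<in>K. h j v \<ominus>\<^bsub>J (Suc i)\<^esub> x \<odot>\<^bsub>J (Suc i)\<^esub> h (Suc j) v = e v"
      using Suc.prems(5)[of j] unfolding extendable_def by blast
    obtain f where f: "linear_on R ?V (carrier ?V) (J i) f" "\<forall>v\<in>carrier ?V. d i (f v) = e v"
      using lift[OF e(1)] e(2) by blast
    have fp: "linear_on R ?W (carrier ?W) (J i) (\<lambda>c. f (?p c))"
      by (rule linear_on_comp[OF p f(1)]) (use submodule_mem(2)[OF V K] pK in blast)
    \<comment> \<open>The map f lifts the extension e of h j - x h (j+1). Subtracting f composed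
      with p turns G j - x G (j+1) into a map with cocycle values on all of R^m and does not change
      it on the relations.\<close>
    let ?w = "\<lambda>c. (G j c \<oplus>\<^bsub>J i\<^esub> (\<ominus> x) \<odot>\<^bsub>J i\<^esub> G (Suc j) c) \<oplus>\<^bsub>J i\<^esub> (\<ominus> \<one>) \<odot>\<^bsub>J i\<^esub> f (?p c)"
    have w: "linear_on R ?W (carrier ?W) (J i) ?w"
      by (rule linear_on_lin[OF NM linear_on_lin[OF NM G G] fp]) (use xc in auto)
    have fc: "f (?p c) \<in> carrier (J i)" if "c \<in> carrier ?W" for c using linear_onD(1)[OF fp that] .
    show "extendable R m ?K' (J i) (cocycles i) (\<lambda>v. G j v \<ominus>\<^bsub>J i\<^esub> x \<odot>\<^bsub>J i\<^esub> G (Suc j) v)"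
      unfolding extendable_def
    proof (intro exI conjI ballI)
      show "linear_on R ?W (carrier ?W) (J i) ?w" by (rule w)
      fix c assume c: "c \<in> carrier ?W"
      have pc: "?p c \<in> carrier ?V" using submodule_mem(2)[OF V K pK[OF c]] .
      have hc: "h j (?p c) \<in> carrier (J (Suc i))" for j using linear_onD(1)[OF Suc.prems(3) pK[OF c]] .
      have "d i (?w c) = (h j (?p c) \<oplus>\<^bsub>J (Suc i)\<^esub> (\<ominus> x) \<odot>\<^bsub>J (Suc i)\<^esub> h (Suc j) (?p c)) \<oplus>\<^bsub>J (Suc i)\<^esub> (\<ominus> \<one>) \<odot>\<^bsub>J (Suc i)\<^esub> e (?p c)"
        using c xc Gc fc dG f(2) pc by (simp add: d_add d_smult)
      also have "e (?p c) = h j (?p c) \<ominus>\<^bsub>J (Suc i)\<^esub> x \<odot>\<^bsub>J (Suc i)\<^esub> h (Suc j) (?p c)"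
        using e(3) pK[OF c] by simp
      finally have "d i (?w c) = \<zero>\<^bsub>J (Suc i)\<^esub>"
        using hc xc by (simp add: P.smult_l_minus P.M.group_simps)
      then show "?w c \<in> cocycles i" unfolding cocycles_def using linear_onD(1)[OF w c] by simp
    next
      fix c assume c: "c \<in> ?K'"
      have "f (?p c) = \<zero>\<^bsub>J i\<^esub>" using c linear_on_zero[OF V NM V.carrier_is_submodule f(1)] by simp
      then show "G j c \<ominus>\<^bsub>J i\<^esub> x \<odot>\<^bsub>J i\<^esub> G (Suc j) c = ?w c"
        using c Gc[of c j] Gc[of c "Suc j"] xc by (simp add: N.smult_l_minus a_minus_def)
    qed
  qed
  then obtain \<gamma> where \<gamma>: "linear_on R ?W (carrier ?W) (J i) \<gamma>" "\<forall>c\<in>carrier ?W. \<gamma> c \<in> cocycles i"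
    "\<forall>c\<in>?K'. G 0 c = \<gamma> c" unfolding extendable_def by blast
  \<comment> \<open>Since G 0 minus \<gamma> vanishes on the relations, it descends to a map K -> J
    i, which extends to R^k by injectivity. Applying d to that extension gives the desired extension
    of h 0, because d kills \<gamma>.\<close>
  let ?\<psi> = "\<lambda>c. G 0 c \<oplus>\<^bsub>J i\<^esub> (\<ominus> \<one>) \<odot>\<^bsub>J i\<^esub> \<gamma> c"
  have \<gamma>c: "\<gamma> c \<in> carrier (J i)" if "c \<in> carrier ?W" for c using linear_onD(1)[OF \<gamma>(1) that] .
  have \<psi>: "linear_on R ?W (carrier ?W) (J i) ?\<psi>" by (rule linear_on_lin[OF NM G \<gamma>(1)]) simp
  have "?\<psi> c = \<zero>\<^bsub>J i\<^esub>" if "c \<in> carrier ?W" "?p c = \<zero>\<^bsub>?V\<^esub>" for c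
    using \<gamma>(3) that Gc[OF that(1), of 0] \<gamma>c[OF that(1)] by (simp add: N.smult_l_minus N.M.r_neg)
  then obtain \<phi> where \<phi>: "linear_on R ?V K (J i) \<phi>" "\<forall>c\<in>carrier ?W. \<phi> (?p c) = ?\<psi> c"
    using linear_on_factor[OF W V NM p \<psi>] unfolding pimg by blast
  have "\<exists>f. linear_on R ?V (carrier ?V) (J i) f \<and> (\<forall>x\<in>K. f x = \<phi> x)"
  proof (rule baer_extend[OF NM J_baer zeroideal K \<phi>(1)])
    fix v assume "v \<in> K" "\<And>j. v j \<in> {\<zero>}"
    then have "v = \<zero>\<^bsub>?V\<^esub>" by (simp add: fun_eq_iff)
    then show "\<phi> v = \<zero>\<^bsub>J i\<^esub>" using linear_on_zero[OF V NM K \<phi>(1)] by simp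
  qed
  then obtain f where f: "linear_on R ?V (carrier ?V) (J i) f" "\<forall>x\<in>K. f x = \<phi> x" by blast
  show ?case
    unfolding extendable_def
  proof (intro exI conjI ballI)
    show "linear_on R ?V (carrier ?V) (J (Suc i)) (\<lambda>v. d i (f v))"
      by (rule linear_on_comp[OF f(1) d_linear linear_onD(1)[OF f(1)]])
    show "d i (f v) \<in> cocycles (Suc i)" if "v \<in> carrier ?V" for v
      using linear_onD(1)[OF f(1) that] by (simp add: cocycles_def d_closed d_d)
    fix v assume v: "v \<in> K"
    then obtain c where c: "c \<in> carrier ?W" "v = ?p c" using g(2) by blast
    have "d i (f v) = d i (?\<psi> c)" using f(2) \<phi>(2) v c by simp
    also have "\<dots> = h 0 v \<oplus>\<^bsub>J (Suc i)\<^esub> (\<ominus> \<one>) \<odot>\<^bsub>J (Suc i)\<^esub> d i (\<gamma> c)"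
      using c(1) Gc \<gamma>c dG by (simp add: d_add d_smult c(2))
    also have "d i (\<gamma> c) = \<zero>\<^bsub>J (Suc i)\<^esub>" using \<gamma>(2) c(1) by (simp add: cocycles_def)
    finally show "h 0 v = d i (f v)" using linear_onD(1)[OF Suc.prems(3) v] by simp
  qed
qed

end

section \<open>Regular sequences of maximal length\<close>

primrec seq_ideal :: "('a, 'm) ring_scheme \<Rightarrow> (nat \<Rightarrow> 'a) \<Rightarrow> nat \<Rightarrow> 'a set" where
  "seq_ideal R x 0 = {\<zero>\<^bsub>R\<^esub>}"
| "seq_ideal R x (Suc t) = adjoin R (seq_ideal R x t) (x t)"

text \<open>Regularity in the weak sense, expressed by annihilators. That the terms lie in the
  maximal ideal is stated separately where R is local.\<close>

definition regular_seq :: "('a, 'm) ring_scheme \<Rightarrow> (nat \<Rightarrow> 'a) \<Rightarrow> nat \<Rightarrow> bool" where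
  "regular_seq R x t \<longleftrightarrow> (\<forall>i<t. x i \<in> carrier R \<and> colon R (seq_ideal R x i) (x i) = seq_ideal R x i)"

lemma regular_seqD:
  "regular_seq R x t \<Longrightarrow> i < t \<Longrightarrow> x i \<in> carrier R"
  "regular_seq R x t \<Longrightarrow> i < t \<Longrightarrow> colon R (seq_ideal R x i) (x i) = seq_ideal R x i"
  by (auto simp: regular_seq_def)

lemma regular_seq_Suc: 
  "regular_seq R x (Suc t) \<longleftrightarrow> regular_seq R x t \<and> x t \<in> carrier R \<and> colon R (seq_ideal R x t) (x t) = seq_ideal R x t"
  by (auto simp: regular_seq_def less_Suc_eq)

lemma seq_ideal_cong: "(\<And>i. i < t \<Longrightarrow> x i = y i) \<Longrightarrow> seq_ideal R x t = seq_ideal R y t"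
  by (induction t) auto

lemma regular_seq_cong:
  assumes "\<And>i. i < t \<Longrightarrow> x i = y i" shows "regular_seq R x t \<longleftrightarrow> regular_seq R y t"
proof -
  have "seq_ideal R x i = seq_ideal R y i" if "i < t" for i using assms that by (intro seq_ideal_cong) simp
  then show ?thesis using assms by (simp add: regular_seq_def)
qed

section \<open>Regular sequences and prime avoidance\<close>

context cring
begin

lemma seq_ideal_ideal: "(\<And>i. i < t \<Longrightarrow> x i \<in> carrier R) \<Longrightarrow> ideal (seq_ideal R x t) R"
  by (induction t) (auto simp: zeroideal adjoin_ideal)

lemma regular_seq_ideal: "regular_seq R x t \<Longrightarrow> ideal (seq_ideal R x t) R"
  by (rule seq_ideal_ideal) (simp add: regular_seq_def)

lemma regular_seq_cancel:
  assumes "regular_seq R x t" "i < t" "r \<in> carrier R" "r \<otimes> x i \<in> seq_ideal R x i"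
  shows "r \<in> seq_ideal R x i"
proof -
  have "r \<in> colon R (seq_ideal R x i) (x i)" using assms(3,4) by (simp add: colon_def)
  then show ?thesis using regular_seqD(2)[OF assms(1,2)] by simp
qed

text \<open>The witness is a product of an element of A and one element of each q, all outside p;
  primality keeps the product outside p.\<close>

lemma prime_avoidance_aux:
  assumes A: "ideal A R" and p: "primeideal p R" "\<not> A \<subseteq> p" and F: "finite F"
    "\<And>q. q \<in> F \<Longrightarrow> ideal q R" "\<And>q. q \<in> F \<Longrightarrow> \<not> q \<subseteq> p"
  shows "\<exists>y\<in>A. y \<notin> p \<and> (\<forall>q\<in>F. y \<in> q)"
  using F
proof (induction F)
  case empty
  then show ?case using p by auto
next
  case (insert q F)
  then obtain y where y: "y \<in> A" "y \<notin> p" "\<forall>q\<in>F. y \<in> q" by auto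
  obtain z where z: "z \<in> q" "z \<notin> p" using insert.prems(2)[of q] by auto
  have c: "y \<in> carrier R" "z \<in> carrier R"
    using ideal_carrier[OF A y(1)] ideal_carrier[of q R z] insert.prems(1)[of q] z by auto
  have "z \<otimes> y \<in> A" "z \<otimes> y \<notin> p" using c y z A prime_mult_notin[OF p(1)] by (auto intro: ideal_lmult)
  moreover have "z \<otimes> y \<in> q'" if "q' \<in> insert q F" for q'
    using that c y z insert.prems(1)[of q'] by (auto intro: ideal_lmult ideal_rmult)
  ultimately show ?case by blast
qed

text \<open>If x avoids all primes of F but lies in p, then an element y of A that lies in every
  prime of F but not in p is added. Such a y exists because the primes are pairwise
  incomparable.\<close>

lemma prime_avoidance:
  assumes A: "ideal A R" and F: "finite F" "\<And>p. p \<in> F \<Longrightarrow> primeideal p R" "\<And>p. p \<in> F \<Longrightarrow> \<not> A \<subseteq> p"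
    "\<And>p q. p \<in> F \<Longrightarrow> q \<in> F \<Longrightarrow> q \<subseteq> p \<Longrightarrow> q = p"
  shows "\<exists>x\<in>A. \<forall>p\<in>F. x \<notin> p"
  using F
proof (induction F)
  case empty
  then show ?case using ideal_zero[OF A] by auto
next
  case (insert p F)
  have "\<exists>x\<in>A. \<forall>q\<in>F. x \<notin> q" by (rule insert.IH) (use insert.prems in simp_all)
  then obtain x where x: "x \<in> A" "\<forall>q\<in>F. x \<notin> q" by blast
  show ?case
  proof (cases "x \<in> p")
    case False
    then show ?thesis using x by auto
  next
    case True
    have id: "ideal q R" if "q \<in> insert p F" for q using insert.prems(1)[OF that] by (rule primeideal.axioms(1))
    have "\<exists>y\<in>A. y \<notin> p \<and> (\<forall>q\<in>F. y \<in> q)"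
    proof (rule prime_avoidance_aux[OF A])
      show "\<not> q \<subseteq> p" if "q \<in> F" for q
      proof
        assume "q \<subseteq> p"
        then have "q = p" by (rule insert.prems(3)[rotated 2]) (use that in simp_all)
        then show False using insert.hyps that by simp
      qed
      show "primeideal p R" "\<not> A \<subseteq> p" using insert.prems by simp_all
    qed (use insert.hyps id in simp_all)
    then obtain y where y: "y \<in> A" "y \<notin> p" "\<forall>q\<in>F. y \<in> q" by auto
    have c: "x \<in> carrier R" "y \<in> carrier R" using ideal_carrier[OF A] x y by auto
    have "x \<oplus> y \<in> A" using x y A by (simp add: ideal_add)
    moreover have "x \<oplus> y \<notin> p"
    proof
      assume "x \<oplus> y \<in> p"
      then have "(x \<oplus> y) \<ominus> x \<in> p" using True id by (simp add: ideal_minus)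
      moreover have "(x \<oplus> y) \<ominus> x = y" using c by Ring.algebra
      ultimately show False using y by simp
    qed
    moreover have "x \<oplus> y \<notin> q" if "q \<in> F" for q
    proof
      assume "x \<oplus> y \<in> q"
      then have "(x \<oplus> y) \<ominus> y \<in> q" using y that id by (simp add: ideal_minus)
      moreover have "(x \<oplus> y) \<ominus> y = x" using c by Ring.algebra
      ultimately show False using x that by simp
    qed
    ultimately show ?thesis by blast
  qed
qed

end

context noetherian_cring
begin

text \<open>For distinct primes p 0, p 1, ... let \<open>C n\<close> consist of all r that p 0
  \<inter> ... \<inter> p (n-1) multiplies into I. This chain of ideals increases, and g n lies in C
  (n+1). Stationarity would force p n to contain that intersection, but the primes are
  incomparable.\<close>

lemma maximal_annihilators_finite:
  assumes I: "ideal I R"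
  shows "finite {colon R I g | g. maximal_annihilator I g}" (is "finite ?P")
proof (rule ccontr)
  assume "infinite ?P"
  then obtain p :: "nat \<Rightarrow> 'a set" where p: "inj p" "range p \<subseteq> ?P"
    using infinite_countable_subset by blast
  have "\<forall>i. \<exists>g. p i = colon R I g \<and> maximal_annihilator I g" using p(2) by blast
  then obtain g where "\<forall>i. p i = colon R I (g i) \<and> maximal_annihilator I (g i)" by (rule choice[THEN exE])
  then have g: "p i = colon R I (g i)" "maximal_annihilator I (g i)" for i by blast+
  have gc: "g i \<in> carrier R" "g i \<notin> I" for i using g(2)[of i] by (auto simp: maximal_annihilator_def)
  have pr: "primeideal (p i) R" for i unfolding g(1) by (rule maximal_annihilator_prime[OF I g(2)])
  have pi: "ideal (p i) R" for i using pr by (rule primeideal.axioms(1))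
  have incomp: "\<not> p i \<subseteq> p j" if "i \<noteq> j" for i j
  proof
    assume "p i \<subseteq> p j"
    then have "p j = p i" using g(2)[of i] gc[of j] g(1)[of i] g(1)[of j] by (simp add: maximal_annihilator_def)
    then show False using p(1) that by (auto dest: injD)
  qed
  define C where "C n = {r \<in> carrier R. \<forall>y\<in>carrier R. (\<forall>i<n. y \<in> p i) \<longrightarrow> y \<otimes> r \<in> I}" for n
  have "\<exists>n. \<forall>k\<ge>n. C k = C n"
  proof (rule noetherian_chain)
    show "ideal (C n) R" for n
    proof (rule cring_idealI)
      show "r \<otimes> x \<in> C n" if "r \<in> carrier R" "x \<in> C n" for r x
        using that I m_lcomm[of _ r x] by (auto simp: C_def ideal_lmult)
    qed (auto simp: C_def r_distr ideal_closed[OF I])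
    show "C n \<subseteq> C (Suc n)" for n by (auto simp: C_def)
  qed
  then obtain n where "\<forall>k\<ge>n. C k = C n" ..
  then have n: "C (Suc n) = C n" by (meson le_Suc_eq order_refl)
  have "g n \<in> C (Suc n)" using gc g(1)[of n] by (auto simp: C_def colon_def)
  then have gn: "g n \<in> C n" using n by simp
  have "\<exists>y\<in>carrier R. y \<notin> p n \<and> (\<forall>q\<in>p ` {..<n}. y \<in> q)"
    by (rule prime_avoidance_aux[OF oneideal pr])
      (use pi incomp primeideal.I_notcarr[OF pr[of n]] ideal_subset[OF pi[of n]] in auto)
  then obtain y where y: "y \<in> carrier R" "y \<notin> p n" "\<forall>i<n. y \<in> p i" by auto
  then have "y \<otimes> g n \<in> I" using gn by (simp add: C_def)
  then have "y \<in> p n" using y(1) g(1)[of n] by (simp add: colon_def)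
  then show False using y by simp
qed

end

context local_noetherian_cring
begin

text \<open>The first case is depth zero of R/I. If the maximal ideal is not the annihilator of a
  nonzero class, it lies in none of the finitely many maximal annihilators, so prime avoidance gives
  an element outside all of them: a nonzerodivisor on R/I.\<close>

lemma depth_dichotomy:
  assumes I: "ideal I R"
  obtains s where "s \<in> carrier R" "s \<notin> I" "colon R I s = max_ideal R"
  | x where "x \<in> max_ideal R" "colon R I x = I"
proof (cases "\<exists>s\<in>carrier R. s \<notin> I \<and> colon R I s = max_ideal R")
  case False
  let ?P = "{colon R I g | g. maximal_annihilator I g}"
  have "\<exists>x\<in>max_ideal R. \<forall>p\<in>?P. x \<notin> p"
  proof (rule prime_avoidance[OF max_ideal_ideal maximal_annihilators_finite[OF I]])
    show "primeideal p R" if "p \<in> ?P" for p using that maximal_annihilator_prime[OF I] by auto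
    show "\<not> max_ideal R \<subseteq> p" if "p \<in> ?P" for p
    proof
      assume m: "max_ideal R \<subseteq> p"
      from that obtain g where g: "p = colon R I g" "maximal_annihilator I g" by auto
      have "primeideal p R" unfolding g(1) by (rule maximal_annihilator_prime[OF I g(2)])
      then have "p \<subseteq> max_ideal R"
        using proper_ideal_subset[of p] primeideal.axioms(1) primeideal.I_notcarr by metis
      then show False using m g False by (auto simp: maximal_annihilator_def)
    qed
    show "q = p" if "p \<in> ?P" "q \<in> ?P" "q \<subseteq> p" for p q
      using that by (auto simp: maximal_annihilator_def)
  qed
  then obtain x where x: "x \<in> max_ideal R" "\<forall>p\<in>?P. x \<notin> p" by blast
  have xc: "x \<in> carrier R" by (rule ideal_carrier[OF max_ideal_ideal x(1)])
  have "r \<in> I" if "r \<in> colon R I x" for r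
  proof (rule ccontr)
    assume r: "r \<notin> I"
    have rc: "r \<in> carrier R" "r \<otimes> x \<in> I" using that by (auto simp: colon_def)
    obtain g where g: "maximal_annihilator I g" "colon R I r \<subseteq> colon R I g"
      by (rule maximal_annihilator_exists[OF I rc(1) r])
    have "x \<in> colon R I r" using rc xc by (simp add: colon_def m_comm)
    then show False using g x(2) by blast
  qed
  then have "colon R I x = I" using colon_superset[OF I xc] by blast
  then show thesis using x that(2) by blast
qed (use that in blast)

end

section \<open>Long exact sequences for Ext of cyclic modules, and devissage\<close>

context resolved_local_ring
begin

text \<open>\<open>ext_vanishes l B\<close> says that \<open>Ext\<^sup>l\<^sup>+\<^sup>1(R/B, R) = 0\<close>.\<close>

definition ext_vanishes :: "nat \<Rightarrow> 'a set \<Rightarrow> bool" where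
  "ext_vanishes l B \<longleftrightarrow> (\<forall>z\<in>annihilated (J (Suc l)) B. d (Suc l) z = \<zero>\<^bsub>J (Suc (Suc l))\<^esub> \<longrightarrow>
     (\<exists>j\<in>annihilated (J l) B. d l j = z))"

lemma ext_vanishesD:
  "ext_vanishes l B \<Longrightarrow> z \<in> annihilated (J (Suc l)) B \<Longrightarrow> d (Suc l) z = \<zero>\<^bsub>J (Suc (Suc l))\<^esub> \<Longrightarrow>
    \<exists>j\<in>annihilated (J l) B. d l j = z"
  by (simp add: ext_vanishes_def)

lemma annihilated_mem:
  assumes "ideal B R"
  shows "y \<in> annihilated (J i) B \<Longrightarrow> y \<in> carrier (J i)"
    "y \<in> annihilated (J i) B \<Longrightarrow> z \<in> annihilated (J i) B \<Longrightarrow> y \<oplus>\<^bsub>J i\<^esub> z \<in> annihilated (J i) B"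
    "y \<in> annihilated (J i) B \<Longrightarrow> z \<in> annihilated (J i) B \<Longrightarrow> y \<ominus>\<^bsub>J i\<^esub> z \<in> annihilated (J i) B"
    "r \<in> carrier R \<Longrightarrow> y \<in> annihilated (J i) B \<Longrightarrow> r \<odot>\<^bsub>J i\<^esub> y \<in> annihilated (J i) B"
proof -
  note s = submodule_mem[OF J_module module.annihilated_submodule[OF J_module ideal_subset[OF assms]]]
  show "y \<in> annihilated (J i) B \<Longrightarrow> y \<in> carrier (J i)"
    "y \<in> annihilated (J i) B \<Longrightarrow> z \<in> annihilated (J i) B \<Longrightarrow> y \<oplus>\<^bsub>J i\<^esub> z \<in> annihilated (J i) B"
    "y \<in> annihilated (J i) B \<Longrightarrow> z \<in> annihilated (J i) B \<Longrightarrow> y \<ominus>\<^bsub>J i\<^esub> z \<in> annihilated (J i) B"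
    "r \<in> carrier R \<Longrightarrow> y \<in> annihilated (J i) B \<Longrightarrow> r \<odot>\<^bsub>J i\<^esub> y \<in> annihilated (J i) B"
    by (fact s(2), fact s(4), fact s(6), fact s(7))
qed

lemma annihilated_d:
  assumes B: "ideal B R" and y: "y \<in> annihilated (J i) B"
  shows "d i y \<in> annihilated (J (Suc i)) B"
  unfolding annihilated_def
proof (intro CollectI conjI ballI)
  have yc: "y \<in> carrier (J i)" by (rule annihilatedD(1)[OF y])
  show "d i y \<in> carrier (J (Suc i))" by (rule d_closed[OF yc])
  fix b assume b: "b \<in> B"
  show "b \<odot>\<^bsub>J (Suc i)\<^esub> d i y = \<zero>\<^bsub>J (Suc i)\<^esub>"
    using d_smult[OF ideal_carrier[OF B b] yc] annihilatedD(2)[OF y b] d_zero by simp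
qed

lemma annihilated_mono: "A \<subseteq> B \<Longrightarrow> y \<in> annihilated M B \<Longrightarrow> y \<in> annihilated M A"
  by (auto simp: annihilated_def)

lemma annihilated_adjoin_iff:
  "ideal I R \<Longrightarrow> a \<in> carrier R \<Longrightarrow>
    y \<in> annihilated (J i) (adjoin R I a) \<longleftrightarrow> y \<in> annihilated (J i) I \<and> a \<odot>\<^bsub>J i\<^esub> y = \<zero>\<^bsub>J i\<^esub>"
  by (rule module.annihilated_adjoin[OF J_module])

lemma annihilated_smult_colon:
  assumes "ideal I R" "a \<in> carrier R" "y \<in> annihilated (J i) I"
  shows "a \<odot>\<^bsub>J i\<^esub> y \<in> annihilated (J i) (colon R I a)"
proof -
  interpret M: module R "J i" by (rule J_module)
  show ?thesis
    using assms by (auto simp: annihilated_def colon_def M.smult_assoc1[symmetric])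
qed

text \<open>Surjectivity of Ext^(l+1)(R/I, R) -> Ext^(l+1)(R/(I:a), R), as the next term is
  Ext^(l+2)(R/(I+aR), R). Injectivity of the resolution allows z to be divided by a. The quotient y
  need not be a cocycle, but d y is killed by I + aR, so it is d y' for some y' killed by I +
  aR.\<close>

lemma cocycle_divide:
  assumes I: "ideal I R" and a: "a \<in> carrier R" and ext: "ext_vanishes (Suc l) (adjoin R I a)"
    and z: "z \<in> annihilated (J (Suc l)) (colon R I a)" "d (Suc l) z = \<zero>\<^bsub>J (Suc (Suc l))\<^esub>"
  shows "\<exists>y\<in>annihilated (J (Suc l)) I. d (Suc l) y = \<zero>\<^bsub>J (Suc (Suc l))\<^esub> \<and> a \<odot>\<^bsub>J (Suc l)\<^esub> y = z"
proof -
  interpret M: module R "J (Suc l)" by (rule J_module)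
  interpret N: module R "J (Suc (Suc l))" by (rule J_module)
  obtain y where y: "y \<in> annihilated (J (Suc l)) I" "a \<odot>\<^bsub>J (Suc l)\<^esub> y = z"
    using baer_divide[OF J_module J_baer I a z(1)] by blast
  have yc: "y \<in> carrier (J (Suc l))" by (rule annihilatedD(1)[OF y(1)])
  have "d (Suc l) y \<in> annihilated (J (Suc (Suc l))) (adjoin R I a)"
    unfolding annihilated_adjoin_iff[OF I a]
    using annihilated_d[OF I y(1)] d_smult[OF a yc] y(2) z(2) by simp
  then obtain y' where y': "y' \<in> annihilated (J (Suc l)) (adjoin R I a)" "d (Suc l) y' = d (Suc l) y"
    using ext_vanishesD[OF ext] d_d[OF yc] by blast
  have y'I: "y' \<in> annihilated (J (Suc l)) I" "a \<odot>\<^bsub>J (Suc l)\<^esub> y' = \<zero>\<^bsub>J (Suc l)\<^esub>"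
    using y'(1) unfolding annihilated_adjoin_iff[OF I a] by auto
  have yc': "y' \<in> carrier (J (Suc l))" by (rule annihilatedD(1)[OF y'I(1)])
  have "d (Suc l) (y \<ominus>\<^bsub>J (Suc l)\<^esub> y') = \<zero>\<^bsub>J (Suc (Suc l))\<^esub>"
    using d_minus[OF yc yc'] y'(2) d_closed[OF yc] by (simp add: N.M.r_neg a_minus_def)
  moreover have "a \<odot>\<^bsub>J (Suc l)\<^esub> (y \<ominus>\<^bsub>J (Suc l)\<^esub> y') = z"
    using y(2) y'I(2) yc yc' a by (simp add: a_minus_def M.smult_r_distr M.smult_r_minus) (use annihilatedD(1)[OF z(1)] in simp)
  moreover have "y \<ominus>\<^bsub>J (Suc l)\<^esub> y' \<in> annihilated (J (Suc l)) I" using annihilated_mem(3)[OF I y(1) y'I(1)] .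
  ultimately show ?thesis by blast
qed

text \<open>By 0 -> R/I -> R/I -> R/(I+xR) -> 0, the group Ext^(l+2)(R/(I+xR), R) lies between
  Ext^(l+1)(R/I, R) and Ext^(l+2)(R/I, R).\<close>

lemma ext_vanishes_adjoin_regular:
  assumes I: "ideal I R" and x: "x \<in> carrier R" "colon R I x = I"
    and ext: "ext_vanishes l I" "ext_vanishes (Suc l) I"
  shows "ext_vanishes (Suc l) (adjoin R I x)"
  unfolding ext_vanishes_def
proof (intro ballI impI)
  fix z assume z: "z \<in> annihilated (J (Suc (Suc l))) (adjoin R I x)" "d (Suc (Suc l)) z = \<zero>\<^bsub>J (Suc (Suc (Suc l)))\<^esub>"
  interpret M: module R "J (Suc l)" by (rule J_module)
  interpret N: module R "J (Suc (Suc l))" by (rule J_module)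
  have z': "z \<in> annihilated (J (Suc (Suc l))) I" "x \<odot>\<^bsub>J (Suc (Suc l))\<^esub> z = \<zero>\<^bsub>J (Suc (Suc l))\<^esub>"
    using z(1) unfolding annihilated_adjoin_iff[OF I x(1)] by auto
  obtain j where j: "j \<in> annihilated (J (Suc l)) I" "d (Suc l) j = z" using ext_vanishesD[OF ext(2) z'(1) z(2)] by blast
  have jc: "j \<in> carrier (J (Suc l))" by (rule annihilatedD(1)[OF j(1)])
  have "x \<odot>\<^bsub>J (Suc l)\<^esub> j \<in> annihilated (J (Suc l)) I" by (rule annihilated_mem(4)[OF I x(1) j(1)])
  moreover have "d (Suc l) (x \<odot>\<^bsub>J (Suc l)\<^esub> j) = \<zero>\<^bsub>J (Suc (Suc l))\<^esub>" using d_smult[OF x(1) jc] j(2) z'(2) by simp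
  ultimately obtain w where w: "w \<in> annihilated (J l) I" "d l w = x \<odot>\<^bsub>J (Suc l)\<^esub> j"
    using ext_vanishesD[OF ext(1)] by blast
  have "w \<in> annihilated (J l) (colon R I x)" using w(1) x(2) by simp
  then obtain w' where w': "w' \<in> annihilated (J l) I" "x \<odot>\<^bsub>J l\<^esub> w' = w"
    using baer_divide[OF J_module J_baer I x(1)] by blast
  have wc': "w' \<in> carrier (J l)" by (rule annihilatedD(1)[OF w'(1)])
  let ?j = "j \<ominus>\<^bsub>J (Suc l)\<^esub> d l w'"
  have xd: "x \<odot>\<^bsub>J (Suc l)\<^esub> d l w' = x \<odot>\<^bsub>J (Suc l)\<^esub> j" using d_smult[OF x(1) wc'] w'(2) w(2) by simp
  have "?j \<in> annihilated (J (Suc l)) I" by (rule annihilated_mem(3)[OF I j(1) annihilated_d[OF I w'(1)]])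
  moreover have "x \<odot>\<^bsub>J (Suc l)\<^esub> ?j = \<zero>\<^bsub>J (Suc l)\<^esub>"
    using xd x(1) jc d_closed[OF wc'] by (simp add: a_minus_def M.smult_r_distr M.smult_r_minus M.M.r_neg)
  ultimately have "?j \<in> annihilated (J (Suc l)) (adjoin R I x)" unfolding annihilated_adjoin_iff[OF I x(1)] by simp
  moreover have "d (Suc l) ?j = z"
    using d_minus[OF jc d_closed[OF wc']] d_d[OF wc'] j(2) annihilatedD(1)[OF z(1)] by (simp add: a_minus_def)
  ultimately show "\<exists>j\<in>annihilated (J (Suc l)) (adjoin R I x). d (Suc l) j = z" by blast
qed

text \<open>Ext^(l+1)(R/(I:s), R) lies between Ext^(l+1)(R/I, R) and Ext^(l+2)(R/(I+sR), R). It will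
  be used for a socle element \<open>s\<close> modulo I, where the colon ideal is the maximal
  ideal.\<close>

lemma ext_vanishes_colon:
  assumes I: "ideal I R" and s: "s \<in> carrier R"
    and ext: "ext_vanishes l I" "ext_vanishes (Suc l) (adjoin R I s)"
  shows "ext_vanishes l (colon R I s)"
  unfolding ext_vanishes_def
proof (intro ballI impI)
  fix z assume z: "z \<in> annihilated (J (Suc l)) (colon R I s)" "d (Suc l) z = \<zero>\<^bsub>J (Suc (Suc l))\<^esub>"
  obtain y where y: "y \<in> annihilated (J (Suc l)) I" "d (Suc l) y = \<zero>\<^bsub>J (Suc (Suc l))\<^esub>" "s \<odot>\<^bsub>J (Suc l)\<^esub> y = z"
    using cocycle_divide[OF I s ext(2) z] by blast
  obtain j where j: "j \<in> annihilated (J l) I" "d l j = y" using ext_vanishesD[OF ext(1) y(1,2)] by blast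
  have "d l (s \<odot>\<^bsub>J l\<^esub> j) = z" using d_smult[OF s annihilatedD(1)[OF j(1)]] j(2) y(3) by simp
  then show "\<exists>j\<in>annihilated (J l) (colon R I s). d l j = z"
    using annihilated_smult_colon[OF I s j(1)] by blast
qed

text \<open>The middle term of the sequence for R/(I:a), R/I and R/(I+aR): a cocycle z is first
  changed by a coboundary until \<open>a\<close> kills it, and then belongs to R/(I+aR).\<close>

lemma ext_vanishes_extension:
  assumes I: "ideal I R" and a: "a \<in> carrier R"
    and ext: "ext_vanishes l (colon R I a)" "ext_vanishes l (adjoin R I a)"
  shows "ext_vanishes l I"
  unfolding ext_vanishes_def
proof (intro ballI impI)
  fix z assume z: "z \<in> annihilated (J (Suc l)) I" "d (Suc l) z = \<zero>\<^bsub>J (Suc (Suc l))\<^esub>"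
  interpret M: module R "J l" by (rule J_module)
  interpret N: module R "J (Suc l)" by (rule J_module)
  interpret P: module R "J (Suc (Suc l))" by (rule J_module)
  have zc: "z \<in> carrier (J (Suc l))" by (rule annihilatedD(1)[OF z(1)])
  have "d (Suc l) (a \<odot>\<^bsub>J (Suc l)\<^esub> z) = \<zero>\<^bsub>J (Suc (Suc l))\<^esub>" using d_smult[OF a zc] z(2) a by simp
  then obtain j where j: "j \<in> annihilated (J l) (colon R I a)" "d l j = a \<odot>\<^bsub>J (Suc l)\<^esub> z"
    using ext_vanishesD[OF ext(1) annihilated_smult_colon[OF I a z(1)]] by blast
  obtain j' where j': "j' \<in> annihilated (J l) I" "a \<odot>\<^bsub>J l\<^esub> j' = j"
    using baer_divide[OF J_module J_baer I a j(1)] by blast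
  have jc': "j' \<in> carrier (J l)" by (rule annihilatedD(1)[OF j'(1)])
  note dc = d_closed[OF jc']
  have ad: "a \<odot>\<^bsub>J (Suc l)\<^esub> d l j' = a \<odot>\<^bsub>J (Suc l)\<^esub> z" using d_smult[OF a jc'] j'(2) j(2) by simp
  let ?z = "z \<ominus>\<^bsub>J (Suc l)\<^esub> d l j'"
  have "?z \<in> annihilated (J (Suc l)) I" by (rule annihilated_mem(3)[OF I z(1) annihilated_d[OF I j'(1)]])
  moreover have "a \<odot>\<^bsub>J (Suc l)\<^esub> ?z = \<zero>\<^bsub>J (Suc l)\<^esub>"
    using ad a zc dc by (simp add: a_minus_def N.smult_r_distr N.smult_r_minus N.M.r_neg)
  ultimately have "?z \<in> annihilated (J (Suc l)) (adjoin R I a)" unfolding annihilated_adjoin_iff[OF I a] by simp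
  moreover have "d (Suc l) ?z = \<zero>\<^bsub>J (Suc (Suc l))\<^esub>" using d_minus[OF zc dc] d_d[OF jc'] z(2) by (simp add: a_minus_def)
  ultimately obtain k where k: "k \<in> annihilated (J l) (adjoin R I a)" "d l k = ?z"
    using ext_vanishesD[OF ext(2)] by blast
  have k': "k \<in> annihilated (J l) I" using k(1) unfolding annihilated_adjoin_iff[OF I a] by simp
  have "d l (j' \<oplus>\<^bsub>J l\<^esub> k) = z"
    using d_add[OF jc' annihilatedD(1)[OF k']] k(2) zc dc by (simp add: N.M.group_simps)
  then show "\<exists>j\<in>annihilated (J l) I. d l j = z" using annihilated_mem(2)[OF I j'(1) k'] by blast
qed

lemma ext_vanishes_carrier: "ext_vanishes l (carrier R)"
  unfolding ext_vanishes_def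
proof (intro ballI impI)
  fix z assume z: "z \<in> annihilated (J (Suc l)) (carrier R)"
  interpret M: module R "J l" by (rule J_module)
  interpret N: module R "J (Suc l)" by (rule J_module)
  have "z = \<zero>\<^bsub>J (Suc l)\<^esub>" using annihilatedD(2)[OF z one_closed] annihilatedD(1)[OF z] by simp
  moreover have "\<zero>\<^bsub>J l\<^esub> \<in> annihilated (J l) (carrier R)" by (auto simp: annihilated_def)
  ultimately show "\<exists>j\<in>annihilated (J l) (carrier R). d l j = z" using d_zero by blast
qed

lemma ext_vanishes_zero: "ext_vanishes l {\<zero>}"
  unfolding ext_vanishes_def
proof (intro ballI impI)
  fix z assume z: "z \<in> annihilated (J (Suc l)) {\<zero>}" "d (Suc l) z = \<zero>\<^bsub>J (Suc (Suc l))\<^esub>"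
  interpret M: module R "J l" by (rule J_module)
  obtain j where "j \<in> carrier (J l)" "d l j = z" using exact[OF annihilatedD(1)[OF z(1)] z(2)] by blast
  moreover from this have "j \<in> annihilated (J l) {\<zero>}" by (simp add: annihilated_def)
  ultimately show "\<exists>j\<in>annihilated (J l) {\<zero>}. d l j = z" by blast
qed

text \<open>Some x in the maximal ideal lies outside p and is a nonzerodivisor on R/p. As
  Ext^(l+2)(R/(p+xR), R) = 0, multiplication by x is surjective on Ext^(l+1)(R/p, R), so each
  element there is infinitely divisible by x and must vanish.\<close>

lemma ext_vanishes_prime:
  assumes ext: "\<And>B. ideal B R \<Longrightarrow> ext_vanishes (Suc l) B"
    and p: "primeideal p R" "p \<noteq> max_ideal R"
  shows "ext_vanishes l p"
  unfolding ext_vanishes_def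
proof (intro ballI impI)
  fix z assume z: "z \<in> annihilated (J (Suc l)) p" "d (Suc l) z = \<zero>\<^bsub>J (Suc (Suc l))\<^esub>"
  note ip = primeideal.axioms(1)[OF p(1)]
  interpret M: module R "J l" by (rule J_module)
  interpret N: module R "J (Suc l)" by (rule J_module)
  have "p \<subseteq> max_ideal R" using proper_ideal_subset[OF ip] primeideal.I_notcarr[OF p(1)] by blast
  then obtain x where x: "x \<in> max_ideal R" "x \<notin> p" using p(2) by blast
  have xc: "x \<in> carrier R" by (rule ideal_carrier[OF max_ideal_ideal x(1)])
  have col: "colon R p x = p"
    using primeideal.I_prime[OF p(1)] x(2) xc colon_superset[OF ip xc] by (auto simp: colon_def)
  let ?P = "\<lambda>z. z \<in> annihilated (J (Suc l)) p \<and> d (Suc l) z = \<zero>\<^bsub>J (Suc (Suc l))\<^esub>"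
  have div: "\<exists>y. ?P y \<and> x \<odot>\<^bsub>J (Suc l)\<^esub> y = z" if "?P z" for z
  proof -
    have "z \<in> annihilated (J (Suc l)) (colon R p x)" using that col by simp
    then show ?thesis using cocycle_divide[OF ip xc ext[OF adjoin_ideal[OF ip xc]]] that by blast
  qed
  have "\<exists>Z. \<forall>n. (?P (Z n) \<and> (n = 0 \<longrightarrow> Z n = z)) \<and> x \<odot>\<^bsub>J (Suc l)\<^esub> Z (Suc n) = Z n"
  proof (rule dependent_nat_choice)
    show "\<exists>y. ?P y \<and> ((0::nat) = 0 \<longrightarrow> y = z)" using z by blast
    fix y and n :: nat assume "?P y \<and> (n = 0 \<longrightarrow> y = z)"
    then have "?P y" by blast
    from div[OF this] show "\<exists>y'. (?P y' \<and> (Suc n = 0 \<longrightarrow> y' = z)) \<and> x \<odot>\<^bsub>J (Suc l)\<^esub> y' = y" by blast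
  qed
  then obtain Z where Z: "\<And>n. Z n \<in> annihilated (J (Suc l)) p" "\<And>n. d (Suc l) (Z n) = \<zero>\<^bsub>J (Suc (Suc l))\<^esub>"
    "Z 0 = z" "\<And>n. x \<odot>\<^bsub>J (Suc l)\<^esub> Z (Suc n) = Z n" by blast
  have "\<forall>n. \<exists>q. q \<in> carrier (J l) \<and> d l q = Z n" using exact annihilatedD(1)[OF Z(1)] Z(2) by blast
  then obtain q where "\<forall>n. q n \<in> carrier (J l) \<and> d l (q n) = Z n" by (rule choice[THEN exE])
  then have q: "\<And>n. q n \<in> carrier (J l)" "\<And>n. d l (q n) = Z n" by blast+
  let ?V = "free_module R 1"
  interpret V: module R ?V by (rule free_module_module)
  let ?K = "{v \<in> carrier ?V. v 0 \<in> p}"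
  have K: "submodule ?K R ?V"
    unfolding submodule_iff[OF V.module_axioms] using ideal_closed[OF ip] by auto
  \<comment> \<open>The ideal p is viewed as a submodule of R^1. With d (q n) = Z n, multiplication
    of q n takes cocycle values on p because p kills Z n; this map represents the class of Z n as an
    element of Ext^1(R/p, cocycles).\<close>
  let ?h = "\<lambda>n v. v 0 \<odot>\<^bsub>J l\<^esub> q n"
  have lin: "linear_on R ?V (carrier ?V) (J l) (\<lambda>v. v 0 \<odot>\<^bsub>J l\<^esub> w)" if "w \<in> carrier (J l)" for w
    unfolding linear_on_def using that by (auto simp: M.smult_l_distr M.smult_assoc1)
  have "extendable R 1 ?K (J l) (cocycles l) (?h 0)"
  proof (rule cocycles_divisible_extendable[OF K x(1), where h = ?h])
    fix n
    show "linear_on R ?V ?K (J l) (?h n)" by (rule linear_on_subset[OF lin[OF q(1)]]) blast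
    show "?h n v \<in> cocycles l" if "v \<in> ?K" for v
      using that q annihilatedD(2)[OF Z(1), of "v 0" n] by (simp add: cocycles_def d_smult)
    show "extendable R 1 ?K (J l) (cocycles l) (\<lambda>v. ?h n v \<ominus>\<^bsub>J l\<^esub> x \<odot>\<^bsub>J l\<^esub> ?h (Suc n) v)"
      unfolding extendable_def
    proof (intro exI conjI ballI)
      let ?w = "q n \<ominus>\<^bsub>J l\<^esub> x \<odot>\<^bsub>J l\<^esub> q (Suc n)"
      have wc: "?w \<in> carrier (J l)" using q xc by simp
      show "linear_on R ?V (carrier ?V) (J l) (\<lambda>v. v 0 \<odot>\<^bsub>J l\<^esub> ?w)" by (rule lin[OF wc])
      have "d l ?w = Z n \<ominus>\<^bsub>J (Suc l)\<^esub> x \<odot>\<^bsub>J (Suc l)\<^esub> Z (Suc n)" using d_minus d_smult q xc by simp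
      then have dw: "d l ?w = \<zero>\<^bsub>J (Suc l)\<^esub>"
        using Z(4)[of n] annihilatedD(1)[OF Z(1)] by (simp add: a_minus_def N.M.r_neg)
      show "v 0 \<odot>\<^bsub>J l\<^esub> ?w \<in> cocycles l" if "v \<in> carrier ?V" for v
        using that wc dw by (simp add: cocycles_def d_smult del: M.minus_closed)
      show "?h n v \<ominus>\<^bsub>J l\<^esub> x \<odot>\<^bsub>J l\<^esub> ?h (Suc n) v = v 0 \<odot>\<^bsub>J l\<^esub> ?w" if "v \<in> ?K" for v
        using that q(1) xc by (simp add: a_minus_def M.smult_r_distr M.smult_r_minus M.smult_assoc1[symmetric] m_comm)
    qed
  qed
  then obtain e where e: "linear_on R ?V (carrier ?V) (J l) e" "\<forall>v\<in>carrier ?V. e v \<in> cocycles l"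
    "\<forall>v\<in>?K. ?h 0 v = e v" unfolding extendable_def by blast
  let ?u = "unit_vector R 0"
  have u: "?u \<in> carrier ?V" by (rule unit_vector_carrier) simp
  have w: "e ?u \<in> carrier (J l)" "d l (e ?u) = \<zero>\<^bsub>J (Suc l)\<^esub>" using e(2) u by (auto simp: cocycles_def)
  \<comment> \<open>The extension e is multiplication by its value at the unit vector, a cocycle.
    Subtracting that cocycle from q 0 leaves an element killed by p with the same
    differential.\<close>
  let ?j = "q 0 \<ominus>\<^bsub>J l\<^esub> e ?u"
  have "b \<odot>\<^bsub>J l\<^esub> ?j = \<zero>\<^bsub>J l\<^esub>" if b: "b \<in> p" for b
  proof -
    have bc: "b \<in> carrier R" by (rule ideal_carrier[OF ip b])
    let ?v = "b \<odot>\<^bsub>?V\<^esub> ?u"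
    have v: "?v \<in> ?K" using b bc V.smult_closed[OF bc u] by (simp add: unit_vector_def)
    have "b \<odot>\<^bsub>J l\<^esub> q 0 = ?h 0 ?v" using bc by (simp add: unit_vector_def)
    also have "\<dots> = e ?v" using e(3) v by blast
    also have "\<dots> = b \<odot>\<^bsub>J l\<^esub> e ?u" by (rule linear_onD(3)[OF e(1) bc u])
    finally show ?thesis using q(1) w(1) bc by (simp add: a_minus_def M.smult_r_distr M.smult_r_minus M.M.r_neg)
  qed
  then have "?j \<in> annihilated (J l) p" using q(1) w(1) by (simp add: annihilated_def)
  moreover have "d l ?j = z" using d_minus[OF q(1) w(1)] q(2) w(2) Z(3) annihilatedD(1)[OF z(1)] by (simp add: a_minus_def)
  ultimately show "\<exists>j\<in>annihilated (J l) p. d l j = z" by blast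
qed

text \<open>A maximal counterexample B is prime: if ab lies in B but neither factor does, then B +
  aR and (B:a) are both larger, and the extension step applies. Primes other than the maximal ideal
  are already settled.\<close>

lemma ext_vanishes_of_max_ideal:
  assumes ext: "\<And>B. ideal B R \<Longrightarrow> ext_vanishes (Suc l) B" and m: "ext_vanishes l (max_ideal R)"
    and I: "ideal I R"
  shows "ext_vanishes l I"
proof (rule ccontr)
  assume "\<not> ext_vanishes l I"
  let ?S = "{B. ideal B R \<and> \<not> ext_vanishes l B}"
  have "?S \<noteq> {}" using I \<open>\<not> ext_vanishes l I\<close> by blast
  moreover have "\<And>B. B \<in> ?S \<Longrightarrow> ideal B R" by blast
  ultimately obtain B where B: "B \<in> ?S" and mx: "\<And>D. D \<in> ?S \<Longrightarrow> B \<subseteq> D \<Longrightarrow> D = B"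
    by (rule noetherian_maximal) blast+
  have iB: "ideal B R" and nB: "\<not> ext_vanishes l B" using B by auto
  have ne: "carrier R \<noteq> B" using ext_vanishes_carrier nB by blast
  have "\<not> primeideal B R" using ext_vanishes_prime[OF ext] m nB by blast
  then obtain a b where ab: "a \<in> carrier R" "b \<in> carrier R" "a \<otimes> b \<in> B" "a \<notin> B" "b \<notin> B"
    using primeidealI[OF iB is_cring ne] by blast
  have "adjoin R B a \<noteq> B" using adjoin_self[OF iB ab(1)] ab(4) by blast
  then have "ext_vanishes l (adjoin R B a)"
    using mx[of "adjoin R B a"] adjoin_ideal[OF iB ab(1)] adjoin_superset[OF iB ab(1)] by blast
  moreover have "b \<in> colon R B a" using ab by (simp add: colon_def m_comm)
  then have "colon R B a \<noteq> B" using ab(5) by blast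
  then have "ext_vanishes l (colon R B a)"
    using mx[of "colon R B a"] colon_ideal[OF iB ab(1)] colon_superset[OF iB ab(1)] by blast
  ultimately show False using ext_vanishes_extension[OF iB ab(1)] nB by blast
qed

text \<open>The quotient by a regular sequence of length t has projective dimension at most t, and
  the degree l + 1 exceeds t.\<close>

lemma ext_vanishes_regular_seq:
  "regular_seq R x t \<Longrightarrow> t \<le> l \<Longrightarrow> ext_vanishes l (seq_ideal R x t)"
proof (induction t arbitrary: l)
  case 0
  then show ?case by (simp add: ext_vanishes_zero)
next
  case (Suc t)
  then obtain k where k: "l = Suc k" "t \<le> k" by (cases l) auto
  have x: "regular_seq R x t" "x t \<in> carrier R" "colon R (seq_ideal R x t) (x t) = seq_ideal R x t"
    using Suc.prems(1) by (auto simp: regular_seq_Suc)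
  show ?case unfolding k(1) seq_ideal.simps
    by (rule ext_vanishes_adjoin_regular[OF regular_seq_ideal[OF x(1)] x(2,3)])
      (use Suc.IH[OF x(1)] k in auto)
qed

text \<open>Here N is the injective dimension of R, and a regular sequence of length N is built. If
  one of length below N could not be prolonged, the maximal ideal m would be the annihilator of a
  class modulo the sequence; this forces Ext^N(R/m, R) = 0, hence by devissage Ext^N(R/B, R) = 0 for
  all B, against minimality of N.\<close>

lemma maximal_regular_seq:
  assumes fin: "\<forall>i>n. carrier (J i) = {\<zero>\<^bsub>J i\<^esub>}"
  shows "\<exists>t x. regular_seq R x t \<and> (\<forall>i<t. x i \<in> max_ideal R) \<and> (\<forall>B. ideal B R \<longrightarrow> ext_vanishes t B)"
proof -
  let ?Q = "\<lambda>n. \<forall>l\<ge>n. \<forall>B. ideal B R \<longrightarrow> ext_vanishes l B"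
  have "?Q n"
    unfolding ext_vanishes_def
  proof (intro allI impI ballI)
    fix l B z assume "n \<le> l" "ideal B R" "z \<in> annihilated (J (Suc l)) B"
    interpret M: module R "J l" by (rule J_module)
    have "z = \<zero>\<^bsub>J (Suc l)\<^esub>" using fin \<open>n \<le> l\<close> annihilatedD(1)[OF \<open>z \<in> annihilated (J (Suc l)) B\<close>] by auto
    moreover have "\<zero>\<^bsub>J l\<^esub> \<in> annihilated (J l) B" using ideal_carrier[OF \<open>ideal B R\<close>] by (auto simp: annihilated_def)
    ultimately show "\<exists>j\<in>annihilated (J l) B. d l j = z" using d_zero by blast
  qed
  define N where "N = (LEAST n. ?Q n)"
  have QN: "?Q N" unfolding N_def using \<open>?Q n\<close> by (rule LeastI)
  have least: "\<not> ?Q k" if "k < N" for k using that unfolding N_def by (rule not_less_Least)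
  have "\<exists>x. regular_seq R x t \<and> (\<forall>i<t. x i \<in> max_ideal R)" if "t \<le> N" for t
    using that
  proof (induction t)
    case 0
    then show ?case by (simp add: regular_seq_def)
  next
    case (Suc t)
    then obtain x where x: "regular_seq R x t" "\<forall>i<t. x i \<in> max_ideal R" by auto
    let ?I = "seq_ideal R x t"
    note I = regular_seq_ideal[OF x(1)]
    from I show ?case
    proof (cases rule: depth_dichotomy)
      case (1 s)
      obtain k where k: "N = Suc k" "t \<le> k" using Suc.prems by (cases N) auto
      have "ext_vanishes k (colon R ?I s)"
        by (rule ext_vanishes_colon[OF I 1(1) ext_vanishes_regular_seq[OF x(1) k(2)]])
          (use QN k adjoin_ideal[OF I 1(1)] in simp)
      then have "ext_vanishes k (max_ideal R)" using 1(3) by simp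
      then have "ext_vanishes k B" if "ideal B R" for B
        using ext_vanishes_of_max_ideal[of k B] QN k that by simp
      then have "?Q k" using QN k(1) by (metis Suc_leI order_le_imp_less_or_eq)
      then show ?thesis using least[of k] k by simp
    next
      case (2 y)
      let ?x = "x(t := y)"
      have "regular_seq R ?x t" using x(1) regular_seq_cong[of t x ?x R] by simp
      moreover have "seq_ideal R ?x t = ?I" by (rule seq_ideal_cong) simp
      moreover have "y \<in> carrier R" by (rule ideal_carrier[OF max_ideal_ideal 2(1)])
      ultimately have "regular_seq R ?x (Suc t)" using 2 by (simp add: regular_seq_Suc)
      moreover have "\<forall>i<Suc t. ?x i \<in> max_ideal R" using x(2) 2(1) by (simp add: less_Suc_eq)
      ultimately show ?thesis by blast
    qed
  qed
  then obtain x where "regular_seq R x N" "\<forall>i<N. x i \<in> max_ideal R" by blast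
  then show ?thesis using QN by blast
qed

end

section \<open>Quotients of the ring as modules\<close>

text \<open>The case I = {0} is used as well, so that R and its quotients by the members of a
  regular sequence form one family of modules on the same type.\<close>

definition quot_module :: "('a, 'm) ring_scheme \<Rightarrow> 'a set \<Rightarrow> ('a, 'a set) module" where
  "quot_module R I = \<lparr>carrier = carrier (R Quot I), monoid.mult = monoid.mult (R Quot I), one = one (R Quot I),
     ring.zero = ring.zero (R Quot I), add = add (R Quot I), smult = (\<lambda>r. monoid.mult (R Quot I) (a_r_coset R I r))\<rparr>"

context cring
begin

lemma coset_eq_iff:
  assumes "ideal I R" "a \<in> carrier R" "b \<in> carrier R" shows "I +> a = I +> b \<longleftrightarrow> a \<ominus> b \<in> I"
  using quotient_eq_iff_same_a_r_cos[OF assms] by blast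

lemma quot_module_simps:
  assumes I: "ideal I R"
  shows "carrier (quot_module R I) = (\<lambda>a. I +> a) ` carrier R"
    "\<zero>\<^bsub>quot_module R I\<^esub> = I +> \<zero>"
    "a \<in> carrier R \<Longrightarrow> b \<in> carrier R \<Longrightarrow> (I +> a) \<oplus>\<^bsub>quot_module R I\<^esub> (I +> b) = I +> (a \<oplus> b)"
    "a \<in> carrier R \<Longrightarrow> r \<in> carrier R \<Longrightarrow> r \<odot>\<^bsub>quot_module R I\<^esub> (I +> a) = I +> (r \<otimes> a)"
proof -
  interpret I: ideal I R by (rule I)
  note hom = I.rcos_ring_hom
  show "carrier (quot_module R I) = (\<lambda>a. I +> a) ` carrier R"
    by (auto simp: quot_module_def FactRing_def A_RCOSETS_def' image_def)
  show "\<zero>\<^bsub>quot_module R I\<^esub> = I +> \<zero>"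
    using a_coset_add_zero[of I] ideal_subset[OF I] by (simp add: quot_module_def FactRing_def)
  show "a \<in> carrier R \<Longrightarrow> b \<in> carrier R \<Longrightarrow> (I +> a) \<oplus>\<^bsub>quot_module R I\<^esub> (I +> b) = I +> (a \<oplus> b)"
    using ring_hom_add[OF hom] by (simp add: quot_module_def)
  show "a \<in> carrier R \<Longrightarrow> r \<in> carrier R \<Longrightarrow> r \<odot>\<^bsub>quot_module R I\<^esub> (I +> a) = I +> (r \<otimes> a)"
    using ring_hom_mult[OF hom] by (simp add: quot_module_def)
qed

lemma quot_module_module:
  assumes I: "ideal I R" shows "module R (quot_module R I)"
proof (rule moduleI)
  note q = quot_module_simps[OF I]
  show "abelian_group (quot_module R I)"
  proof (rule abelian_groupI)
    fix Y assume "Y \<in> carrier (quot_module R I)"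
    then obtain a where a: "a \<in> carrier R" "Y = I +> a" unfolding q by auto
    show "\<exists>Z\<in>carrier (quot_module R I). Z \<oplus>\<^bsub>quot_module R I\<^esub> Y = \<zero>\<^bsub>quot_module R I\<^esub>"
      by (rule bexI[of _ "I +> \<ominus> a"]) (use a in \<open>auto simp: q l_neg\<close>)
  qed (auto simp: q a_ac)
qed (auto simp: quot_module_simps[OF I] l_distr r_distr m_assoc is_cring)

lemma coset_linear:
  assumes I: "ideal I R" shows "linear_on R (self_module R) (carrier R) (quot_module R I) (\<lambda>a. I +> a)"
  unfolding linear_on_def by (auto simp: quot_module_simps[OF I])

lemma coset_eq_zero_iff:
  assumes I: "ideal I R" and "a \<in> carrier R" shows "I +> a = \<zero>\<^bsub>quot_module R I\<^esub> \<longleftrightarrow> a \<in> I"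
  unfolding quot_module_simps(2)[OF I] coset_eq_iff[OF I assms(2) zero_closed]
  using assms by (simp add: a_minus_def)

end

text \<open>Quotients by a nonzerodivisor are unique, hence linear in the argument. The division is
  applied by f on R and by members of a regular sequence on R/I.\<close>

lemma linear_on_divide:
  assumes V: "module R V" and N: "module R N" and K: "submodule K R V" and g: "linear_on R V K N g"
    and x: "x \<in> carrier R" and inj: "\<And>Y. Y \<in> carrier N \<Longrightarrow> x \<odot>\<^bsub>N\<^esub> Y = \<zero>\<^bsub>N\<^esub> \<Longrightarrow> Y = \<zero>\<^bsub>N\<^esub>"
    and im: "\<And>v. v \<in> K \<Longrightarrow> \<exists>Y\<in>carrier N. x \<odot>\<^bsub>N\<^esub> Y = g v"
  shows "\<exists>h. linear_on R V K N h \<and> (\<forall>v\<in>K. x \<odot>\<^bsub>N\<^esub> h v = g v)"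
proof -
  interpret N: module R N by fact
  define h where "h v = (SOME Y. Y \<in> carrier N \<and> x \<odot>\<^bsub>N\<^esub> Y = g v)" for v
  have h: "h v \<in> carrier N" "x \<odot>\<^bsub>N\<^esub> h v = g v" if "v \<in> K" for v
  proof -
    have "h v \<in> carrier N \<and> x \<odot>\<^bsub>N\<^esub> h v = g v"
      unfolding h_def by (rule someI_ex) (use im[OF that] in blast)
    then show "h v \<in> carrier N" "x \<odot>\<^bsub>N\<^esub> h v = g v" by auto
  qed
  have uniq: "Y = Z" if "Y \<in> carrier N" "Z \<in> carrier N" "x \<odot>\<^bsub>N\<^esub> Y = x \<odot>\<^bsub>N\<^esub> Z" for Y Z
  proof -
    have "x \<odot>\<^bsub>N\<^esub> (Y \<ominus>\<^bsub>N\<^esub> Z) = \<zero>\<^bsub>N\<^esub>"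
      using that x by (simp add: a_minus_def N.smult_r_distr N.smult_r_minus N.M.r_neg)
    then have "Y \<ominus>\<^bsub>N\<^esub> Z = \<zero>\<^bsub>N\<^esub>" using inj that by simp
    then show ?thesis using N.M.minus_eq_zeroD that by simp
  qed
  note Ks = submodule_mem[OF V K] and gD = linear_onD[OF g]
  have "linear_on R V K N h"
    unfolding linear_on_def
  proof (intro conjI ballI)
    fix v assume v: "v \<in> K"
    show "h v \<in> carrier N" by (rule h(1)[OF v])
    show "h (v \<oplus>\<^bsub>V\<^esub> w) = h v \<oplus>\<^bsub>N\<^esub> h w" if w: "w \<in> K" for w
      by (rule uniq) (use v w x h Ks(4)[OF v w] gD(2)[OF v w] in \<open>auto simp: N.smult_r_distr\<close>)
    show "h (r \<odot>\<^bsub>V\<^esub> v) = r \<odot>\<^bsub>N\<^esub> h v" if r: "r \<in> carrier R" for r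
    proof (rule uniq)
      have "x \<odot>\<^bsub>N\<^esub> (r \<odot>\<^bsub>N\<^esub> h v) = r \<odot>\<^bsub>N\<^esub> (x \<odot>\<^bsub>N\<^esub> h v)"
        using r x h(1)[OF v] by (simp add: N.smult_assoc1[symmetric] N.R.m_comm)
      then show "x \<odot>\<^bsub>N\<^esub> h (r \<odot>\<^bsub>V\<^esub> v) = x \<odot>\<^bsub>N\<^esub> (r \<odot>\<^bsub>N\<^esub> h v)"
        using h(2)[OF Ks(7)[OF r v]] h(2)[OF v] gD(3)[OF r v] by simp
    qed (use h(1) Ks(7)[OF r v] v r in auto)
  qed
  then show ?thesis using h by blast
qed

section \<open>Self-injectivity modulo a regular sequence of maximal length\<close>

context resolved_local_ring
begin

definition coboundaries :: "nat \<Rightarrow> 'a set \<Rightarrow> ('a \<times> nat) set" where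
  "coboundaries t I = (case t of 0 \<Rightarrow> {\<zero>\<^bsub>J 0\<^esub>} | Suc l \<Rightarrow> d l ` annihilated (J l) I)"

lemma coboundaries_smult:
  assumes I: "ideal I R" and r: "r \<in> carrier R" and c: "c \<in> coboundaries t I"
  shows "r \<odot>\<^bsub>J t\<^esub> c \<in> coboundaries t I"
proof (cases t)
  case 0
  interpret M: module R "J 0" by (rule J_module)
  show ?thesis using c r by (simp add: coboundaries_def 0)
next
  case (Suc l)
  then obtain k where k: "k \<in> annihilated (J l) I" "c = d l k" using c by (auto simp: coboundaries_def)
  have "r \<odot>\<^bsub>J t\<^esub> c = d l (r \<odot>\<^bsub>J l\<^esub> k)" unfolding Suc k(2)
    by (rule d_smult[OF r annihilatedD(1)[OF k(1)], symmetric])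
  then show ?thesis using annihilated_mem(4)[OF I r k(1)] by (simp add: coboundaries_def Suc)
qed

text \<open>A coboundary d k is divided by dividing k, which is possible because x is regular modulo
  I and the modules of the resolution are injective. The quotient is therefore again a
  cocycle.\<close>

lemma coboundaries_divide:
  assumes I: "ideal I R" and x: "x \<in> carrier R" "colon R I x = I" and c: "c \<in> coboundaries t I"
  shows "\<exists>c'\<in>annihilated (J t) I. d t c' = \<zero>\<^bsub>J (Suc t)\<^esub> \<and> x \<odot>\<^bsub>J t\<^esub> c' = c"
proof (cases t)
  case 0
  interpret M: module R "J 0" by (rule J_module)
  have "\<zero>\<^bsub>J 0\<^esub> \<in> annihilated (J 0) I" using ideal_carrier[OF I] by (simp add: annihilated_def)
  moreover have "c = \<zero>\<^bsub>J 0\<^esub>" using c by (simp add: coboundaries_def 0)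
  ultimately show ?thesis unfolding 0 using d_zero x(1) by (intro bexI[of _ "\<zero>\<^bsub>J 0\<^esub>"]) simp_all
next
  case (Suc l)
  then obtain k where k: "k \<in> annihilated (J l) I" "c = d l k" using c by (auto simp: coboundaries_def)
  have "k \<in> annihilated (J l) (colon R I x)" using k(1) x(2) by simp
  then obtain k' where k': "k' \<in> annihilated (J l) I" "x \<odot>\<^bsub>J l\<^esub> k' = k"
    using baer_divide[OF J_module J_baer I x(1)] by blast
  have kc: "k' \<in> carrier (J l)" by (rule annihilatedD(1)[OF k'(1)])
  have "d l k' \<in> annihilated (J (Suc l)) I" by (rule annihilated_d[OF I k'(1)])
  moreover have "d (Suc l) (d l k') = \<zero>\<^bsub>J (Suc (Suc l))\<^esub>" by (rule d_d[OF kc])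
  moreover have "x \<odot>\<^bsub>J (Suc l)\<^esub> d l k' = c" using d_smult[OF x(1) kc] k'(2) k(2) by simp
  ultimately show ?thesis unfolding Suc by blast
qed

text \<open>\<open>Ext\<^sup>t(R/I, R)\<close> is \<open>R/I\<close>, for \<open>I\<close> generated by a regular sequence of length \<open>t\<close>.\<close>

lemma cohomology_generator:
  "regular_seq R x t \<Longrightarrow> \<exists>u\<in>annihilated (J t) (seq_ideal R x t). d t u = \<zero>\<^bsub>J (Suc t)\<^esub> \<and>
     (\<forall>z\<in>annihilated (J t) (seq_ideal R x t). d t z = \<zero>\<^bsub>J (Suc t)\<^esub> \<longrightarrow>
        (\<exists>r\<in>carrier R. z \<ominus>\<^bsub>J t\<^esub> r \<odot>\<^bsub>J t\<^esub> u \<in> coboundaries t (seq_ideal R x t))) \<and>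
     (\<forall>r\<in>carrier R. r \<odot>\<^bsub>J t\<^esub> u \<in> coboundaries t (seq_ideal R x t) \<longrightarrow> r \<in> seq_ideal R x t)"
proof (induction t)
  case 0
  interpret M: module R "J 0" by (rule J_module)
  show ?case
  proof (intro bexI[of _ "aug \<one>"] conjI ballI impI)
    have "\<one> \<odot>\<^bsub>J 0\<^esub> aug \<one> \<in> cocycles 0" unfolding cocycles_0 by blast
    then show "d 0 (aug \<one>) = \<zero>\<^bsub>J (Suc 0)\<^esub>" using aug_one by (simp add: cocycles_def)
    show "aug \<one> \<in> annihilated (J 0) (seq_ideal R x 0)" using aug_one by (simp add: annihilated_def)
    fix z assume z: "z \<in> annihilated (J 0) (seq_ideal R x 0)" "d 0 z = \<zero>\<^bsub>J (Suc 0)\<^esub>"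
    have "z \<in> cocycles 0" using z annihilatedD(1)[OF z(1)] by (simp add: cocycles_def)
    then obtain r where r: "r \<in> carrier R" "z = r \<odot>\<^bsub>J 0\<^esub> aug \<one>" unfolding cocycles_0 by auto
    then have "z \<ominus>\<^bsub>J 0\<^esub> r \<odot>\<^bsub>J 0\<^esub> aug \<one> = \<zero>\<^bsub>J 0\<^esub>" using aug_one by (simp add: a_minus_def M.M.r_neg)
    then show "\<exists>r\<in>carrier R. z \<ominus>\<^bsub>J 0\<^esub> r \<odot>\<^bsub>J 0\<^esub> aug \<one> \<in> coboundaries 0 (seq_ideal R x 0)"
      using r(1) by (auto simp: coboundaries_def)
  next
    fix r assume "r \<in> carrier R" "r \<odot>\<^bsub>J 0\<^esub> aug \<one> \<in> coboundaries 0 (seq_ideal R x 0)"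
    then show "r \<in> seq_ideal R x 0" using aug_smult_zero by (simp add: coboundaries_def)
  qed
next
  case (Suc t)
  let ?I = "seq_ideal R x t" and ?x = "x t"
  have x: "regular_seq R x t" "?x \<in> carrier R" "colon R ?I ?x = ?I" using Suc.prems by (auto simp: regular_seq_Suc)
  note I = regular_seq_ideal[OF x(1)]
  note xc = x(2)
  interpret M: module R "J t" by (rule J_module)
  interpret N: module R "J (Suc t)" by (rule J_module)
  obtain u where u: "u \<in> annihilated (J t) ?I" "d t u = \<zero>\<^bsub>J (Suc t)\<^esub>"
    and ua: "\<And>z. z \<in> annihilated (J t) ?I \<Longrightarrow> d t z = \<zero>\<^bsub>J (Suc t)\<^esub> \<Longrightarrow>
        \<exists>r\<in>carrier R. z \<ominus>\<^bsub>J t\<^esub> r \<odot>\<^bsub>J t\<^esub> u \<in> coboundaries t ?I"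
    and ub: "\<And>r. r \<in> carrier R \<Longrightarrow> r \<odot>\<^bsub>J t\<^esub> u \<in> coboundaries t ?I \<Longrightarrow> r \<in> ?I"
    using Suc.IH[OF x(1)] by blast
  have uc: "u \<in> carrier (J t)" by (rule annihilatedD(1)[OF u(1)])
  \<comment> \<open>Connecting homomorphism: u is divided by x inside J t, and the differential of
    the quotient w generates the cohomology one degree higher.\<close>
  have "u \<in> annihilated (J t) (colon R ?I ?x)" using u(1) x(3) by simp
  then obtain w where w: "w \<in> annihilated (J t) ?I" "?x \<odot>\<^bsub>J t\<^esub> w = u"
    using baer_divide[OF J_module J_baer I xc] by blast
  have wc: "w \<in> carrier (J t)" by (rule annihilatedD(1)[OF w(1)])
  note adj = annihilated_adjoin_iff[OF I xc]
  show ?case unfolding seq_ideal.simps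
  proof (intro bexI[of _ "d t w"] conjI ballI impI)
    show "d (Suc t) (d t w) = \<zero>\<^bsub>J (Suc (Suc t))\<^esub>" by (rule d_d[OF wc])
    show "d t w \<in> annihilated (J (Suc t)) (adjoin R ?I ?x)"
      unfolding adj using annihilated_d[OF I w(1)] d_smult[OF xc wc] w(2) u(2) by simp
  next
    fix z assume z: "z \<in> annihilated (J (Suc t)) (adjoin R ?I ?x)" "d (Suc t) z = \<zero>\<^bsub>J (Suc (Suc t))\<^esub>"
    have z': "z \<in> annihilated (J (Suc t)) ?I" "?x \<odot>\<^bsub>J (Suc t)\<^esub> z = \<zero>\<^bsub>J (Suc t)\<^esub>" using z(1) unfolding adj by auto
    have zc: "z \<in> carrier (J (Suc t))" by (rule annihilatedD(1)[OF z(1)])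
    obtain j where j: "j \<in> annihilated (J t) ?I" "d t j = z"
      using ext_vanishesD[OF ext_vanishes_regular_seq[OF x(1) order_refl] z'(1) z(2)] by blast
    have jc: "j \<in> carrier (J t)" by (rule annihilatedD(1)[OF j(1)])
    have "d t (?x \<odot>\<^bsub>J t\<^esub> j) = \<zero>\<^bsub>J (Suc t)\<^esub>" using d_smult[OF xc jc] j(2) z'(2) by simp
    then obtain r where r: "r \<in> carrier R" "?x \<odot>\<^bsub>J t\<^esub> j \<ominus>\<^bsub>J t\<^esub> r \<odot>\<^bsub>J t\<^esub> u \<in> coboundaries t ?I"
      using ua[OF annihilated_mem(4)[OF I xc j(1)]] by blast
    obtain c where c: "c \<in> annihilated (J t) ?I" "d t c = \<zero>\<^bsub>J (Suc t)\<^esub>" "?x \<odot>\<^bsub>J t\<^esub> c = ?x \<odot>\<^bsub>J t\<^esub> j \<ominus>\<^bsub>J t\<^esub> r \<odot>\<^bsub>J t\<^esub> u"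
      using coboundaries_divide[OF I xc x(3) r(2)] by blast
    have cc: "c \<in> carrier (J t)" by (rule annihilatedD(1)[OF c(1)])
    \<comment> \<open>Here z = d j, and xj is a cocycle of the form ru + xc with c a cocycle.
      Removing rw and c from j leaves a preimage of z - r d w that x kills.\<close>
    let ?y = "(j \<ominus>\<^bsub>J t\<^esub> r \<odot>\<^bsub>J t\<^esub> w) \<ominus>\<^bsub>J t\<^esub> c"
    have "?y \<in> annihilated (J t) ?I"
      by (rule annihilated_mem(3)[OF I annihilated_mem(3)[OF I j(1) annihilated_mem(4)[OF I r(1) w(1)]] c(1)])
    moreover have "?x \<odot>\<^bsub>J t\<^esub> ?y = \<zero>\<^bsub>J t\<^esub>"
    proof -
      have "?x \<odot>\<^bsub>J t\<^esub> (r \<odot>\<^bsub>J t\<^esub> w) = r \<odot>\<^bsub>J t\<^esub> u"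
        using w(2) r(1) xc wc by (metis M.smult_assoc1 m_comm)
      then have "?x \<odot>\<^bsub>J t\<^esub> ?y = (?x \<odot>\<^bsub>J t\<^esub> j \<ominus>\<^bsub>J t\<^esub> r \<odot>\<^bsub>J t\<^esub> u) \<ominus>\<^bsub>J t\<^esub> ?x \<odot>\<^bsub>J t\<^esub> c"
        using xc jc wc cc r(1) by (simp add: a_minus_def M.smult_r_distr M.smult_r_minus)
      also have "\<dots> = \<zero>\<^bsub>J t\<^esub>" unfolding c(3) using xc jc uc r(1) by (simp add: a_minus_def M.M.r_neg)
      finally show ?thesis .
    qed
    ultimately have "?y \<in> annihilated (J t) (adjoin R ?I ?x)" unfolding adj by simp
    moreover have "d t ?y = z \<ominus>\<^bsub>J (Suc t)\<^esub> r \<odot>\<^bsub>J (Suc t)\<^esub> d t w"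
      using d_minus d_smult jc wc cc r(1) c(2) j(2) zc d_closed[OF wc] by (simp add: a_minus_def)
    ultimately show "\<exists>r\<in>carrier R. z \<ominus>\<^bsub>J (Suc t)\<^esub> r \<odot>\<^bsub>J (Suc t)\<^esub> d t w \<in> coboundaries (Suc t) (adjoin R ?I ?x)"
      using r(1) unfolding coboundaries_def by (intro bexI[of _ r]) (auto intro: image_eqI[of _ _ ?y])
  next
    fix r assume r: "r \<in> carrier R" "r \<odot>\<^bsub>J (Suc t)\<^esub> d t w \<in> coboundaries (Suc t) (adjoin R ?I ?x)"
    then obtain j where "j \<in> annihilated (J t) (adjoin R ?I ?x)" "r \<odot>\<^bsub>J (Suc t)\<^esub> d t w = d t j"
      by (auto simp: coboundaries_def)
    then have j: "j \<in> annihilated (J t) ?I" "?x \<odot>\<^bsub>J t\<^esub> j = \<zero>\<^bsub>J t\<^esub>" "r \<odot>\<^bsub>J (Suc t)\<^esub> d t w = d t j" unfolding adj by auto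
    have jc: "j \<in> carrier (J t)" by (rule annihilatedD(1)[OF j(1)])
    \<comment> \<open>This is a cocycle, so it equals su up to a coboundary. Multiplying by x shows
      that (r - xs)u is a coboundary, whence r - xs lies in the smaller ideal.\<close>
    let ?z = "r \<odot>\<^bsub>J t\<^esub> w \<ominus>\<^bsub>J t\<^esub> j"
    have "d t ?z = \<zero>\<^bsub>J (Suc t)\<^esub>"
      using d_minus[of "r \<odot>\<^bsub>J t\<^esub> w" t j] d_smult[OF r(1) wc] j(3) jc wc r(1) d_closed[OF jc] by (simp add: a_minus_def N.M.r_neg)
    moreover have "?z \<in> annihilated (J t) ?I"
      by (rule annihilated_mem(3)[OF I annihilated_mem(4)[OF I r(1) w(1)] j(1)])
    ultimately obtain s where s: "s \<in> carrier R" "?z \<ominus>\<^bsub>J t\<^esub> s \<odot>\<^bsub>J t\<^esub> u \<in> coboundaries t ?I"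
      using ua by blast
    have "?x \<odot>\<^bsub>J t\<^esub> (r \<odot>\<^bsub>J t\<^esub> w) = r \<odot>\<^bsub>J t\<^esub> u"
      using w(2) r(1) xc wc by (metis M.smult_assoc1 m_comm)
    then have "?x \<odot>\<^bsub>J t\<^esub> (?z \<ominus>\<^bsub>J t\<^esub> s \<odot>\<^bsub>J t\<^esub> u) = (r \<odot>\<^bsub>J t\<^esub> u \<ominus>\<^bsub>J t\<^esub> ?x \<odot>\<^bsub>J t\<^esub> j) \<ominus>\<^bsub>J t\<^esub> ?x \<odot>\<^bsub>J t\<^esub> (s \<odot>\<^bsub>J t\<^esub> u)"
      using xc jc wc uc r(1) s(1) by (simp add: a_minus_def M.smult_r_distr M.smult_r_minus)
    also have "\<dots> = (r \<ominus> ?x \<otimes> s) \<odot>\<^bsub>J t\<^esub> u"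
      unfolding j(2) using xc uc r(1) s(1) by (simp add: a_minus_def M.smult_l_distr M.smult_l_minus M.smult_assoc1)
    finally have "(r \<ominus> ?x \<otimes> s) \<odot>\<^bsub>J t\<^esub> u \<in> coboundaries t ?I"
      using coboundaries_smult[OF I xc s(2)] by simp
    then have "r \<ominus> ?x \<otimes> s \<in> ?I" using ub r(1) s(1) xc by simp
    moreover have "r = (r \<ominus> ?x \<otimes> s) \<oplus> s \<otimes> ?x" using r(1) s(1) xc by Ring.algebra
    ultimately show "r \<in> adjoin R ?I ?x" by (rule adjoin_memI[OF I _ s(1)])
  qed
qed

text \<open>A generator u of Ext^t(R/I, R) = R/I carries h into J t, where it extends to
  multiplication of some y. The element y need not be a cocycle, but B kills d y, and Ext^(t+1)(R/B,
  R) = 0 replaces y by a cocycle with the same multiples by B. That cocycle is cu up to a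
  coboundary, and h(b) = bc.\<close>

lemma quot_regular_seq_baer:
  assumes x: "regular_seq R x t" and ext: "\<And>B. ideal B R \<Longrightarrow> ext_vanishes t B"
  shows "baer R (seq_ideal R x t) (quot_module R (seq_ideal R x t))"
  unfolding baer_def
proof (intro allI impI)
  let ?I = "seq_ideal R x t"
  let ?Q = "quot_module R ?I"
  note I = regular_seq_ideal[OF x]
  interpret M: module R "J t" by (rule J_module)
  interpret N: module R "J (Suc t)" by (rule J_module)
  note q = quot_module_simps[OF I]
  fix B h assume B: "ideal B R" and IB: "?I \<subseteq> B" and h: "linear_on R (self_module R) B ?Q h"
    and hI: "\<forall>i\<in>?I. h i = \<zero>\<^bsub>?Q\<^esub>"
  note hD = linear_onD[OF h]
  obtain u where u: "u \<in> annihilated (J t) ?I" "d t u = \<zero>\<^bsub>J (Suc t)\<^esub>"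
    and ua: "\<And>z. z \<in> annihilated (J t) ?I \<Longrightarrow> d t z = \<zero>\<^bsub>J (Suc t)\<^esub> \<Longrightarrow>
        \<exists>r\<in>carrier R. z \<ominus>\<^bsub>J t\<^esub> r \<odot>\<^bsub>J t\<^esub> u \<in> coboundaries t ?I"
    and ub: "\<And>r. r \<in> carrier R \<Longrightarrow> r \<odot>\<^bsub>J t\<^esub> u \<in> coboundaries t ?I \<Longrightarrow> r \<in> ?I"
    using cohomology_generator[OF x] by blast
  have uc: "u \<in> carrier (J t)" by (rule annihilatedD(1)[OF u(1)])
  \<comment> \<open>The representatives are arbitrary; as I kills u, only their classes
    matter.\<close>
  define \<rho> where "\<rho> b = (SOME r. r \<in> carrier R \<and> ?I +> r = h b)" for b
  have \<rho>: "\<rho> b \<in> carrier R" "?I +> \<rho> b = h b" if "b \<in> B" for b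
  proof -
    have "\<rho> b \<in> carrier R \<and> ?I +> \<rho> b = h b"
      unfolding \<rho>_def by (rule someI_ex) (use hD(1)[OF that] q(1) in auto)
    then show "\<rho> b \<in> carrier R" "?I +> \<rho> b = h b" by auto
  qed
  have same: "r \<odot>\<^bsub>J t\<^esub> u = s \<odot>\<^bsub>J t\<^esub> u" if "r \<in> carrier R" "s \<in> carrier R" "?I +> r = ?I +> s" for r s
  proof -
    have "r \<ominus> s \<in> ?I" using coset_eq_iff[OF I that(1,2)] that(3) by simp
    then have "(r \<ominus> s) \<odot>\<^bsub>J t\<^esub> u = \<zero>\<^bsub>J t\<^esub>" by (rule annihilatedD(2)[OF u(1)])
    then have "r \<odot>\<^bsub>J t\<^esub> u \<ominus>\<^bsub>J t\<^esub> s \<odot>\<^bsub>J t\<^esub> u = \<zero>\<^bsub>J t\<^esub>"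
      using that uc by (simp add: a_minus_def M.smult_l_distr M.smult_l_minus)
    then show ?thesis by (rule M.M.minus_eq_zeroD[rotated 2]) (use that uc in auto)
  qed
  have lin: "linear_on R (self_module R) B (J t) (\<lambda>b. \<rho> b \<odot>\<^bsub>J t\<^esub> u)"
    unfolding linear_on_def
  proof (intro conjI ballI)
    fix b assume b: "b \<in> B"
    show "\<rho> b \<odot>\<^bsub>J t\<^esub> u \<in> carrier (J t)" using \<rho>(1)[OF b] uc by simp
    { fix c assume c: "c \<in> B"
      have bc: "b \<oplus> c \<in> B" using ideal_add[OF B b c] .
      have "?I +> \<rho> (b \<oplus> c) = ?I +> (\<rho> b \<oplus> \<rho> c)"
        using q(3)[OF \<rho>(1)[OF b] \<rho>(1)[OF c]] \<rho>(2)[OF bc] hD(2)[OF b c] unfolding \<rho>(2)[OF b] \<rho>(2)[OF c] by simp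
      then have "\<rho> (b \<oplus> c) \<odot>\<^bsub>J t\<^esub> u = (\<rho> b \<oplus> \<rho> c) \<odot>\<^bsub>J t\<^esub> u"
        using \<rho>(1) b c bc by (intro same) auto
      then show "\<rho> (b \<oplus>\<^bsub>self_module R\<^esub> c) \<odot>\<^bsub>J t\<^esub> u = \<rho> b \<odot>\<^bsub>J t\<^esub> u \<oplus>\<^bsub>J t\<^esub> \<rho> c \<odot>\<^bsub>J t\<^esub> u"
        using \<rho>(1)[OF b] \<rho>(1)[OF c] uc by (simp add: M.smult_l_distr) }
    { fix r assume r: "r \<in> carrier R"
      have rb: "r \<otimes> b \<in> B" using ideal_lmult[OF B r b] .
      have "?I +> \<rho> (r \<otimes> b) = ?I +> (r \<otimes> \<rho> b)"
        using q(4)[OF \<rho>(1)[OF b] r] \<rho>(2)[OF rb] hD(3)[OF r b] unfolding \<rho>(2)[OF b] by simp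
      then have "\<rho> (r \<otimes> b) \<odot>\<^bsub>J t\<^esub> u = (r \<otimes> \<rho> b) \<odot>\<^bsub>J t\<^esub> u"
        using \<rho>(1) b r rb by (intro same) auto
      then show "\<rho> (r \<odot>\<^bsub>self_module R\<^esub> b) \<odot>\<^bsub>J t\<^esub> u = r \<odot>\<^bsub>J t\<^esub> (\<rho> b \<odot>\<^bsub>J t\<^esub> u)"
        using \<rho>(1)[OF b] r uc by (simp add: M.smult_assoc1) }
  qed
  have kill: "\<rho> i \<odot>\<^bsub>J t\<^esub> u = \<zero>\<^bsub>J t\<^esub>" if "i \<in> ?I" for i
  proof -
    have i: "i \<in> B" using IB that by blast
    have "?I +> \<rho> i = ?I +> \<zero>" using \<rho>(2)[OF i] hI that q(2) by simp
    then have "\<rho> i \<odot>\<^bsub>J t\<^esub> u = \<zero> \<odot>\<^bsub>J t\<^esub> u" using \<rho>(1)[OF i] by (intro same) auto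
    then show ?thesis using uc by simp
  qed
  have "\<exists>y\<in>carrier (J t). \<forall>b\<in>B. \<rho> b \<odot>\<^bsub>J t\<^esub> u = b \<odot>\<^bsub>J t\<^esub> y"
    by (rule baerD[OF J_baer B _ lin]) (use ideal_zero[OF B] kill ideal_zero[OF I] in auto)
  then obtain y where y: "y \<in> carrier (J t)" "\<forall>b\<in>B. \<rho> b \<odot>\<^bsub>J t\<^esub> u = b \<odot>\<^bsub>J t\<^esub> y" by blast
  have yI: "y \<in> annihilated (J t) ?I"
    unfolding annihilated_def using y kill IB by (auto simp: subset_iff)
  have "d t y \<in> annihilated (J (Suc t)) B"
    unfolding annihilated_def
  proof (intro CollectI conjI ballI)
    show "d t y \<in> carrier (J (Suc t))" by (rule d_closed[OF y(1)])
    fix b assume b: "b \<in> B"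
    have "b \<odot>\<^bsub>J (Suc t)\<^esub> d t y = d t (\<rho> b \<odot>\<^bsub>J t\<^esub> u)"
      using d_smult[OF ideal_carrier[OF B b] y(1)] y(2) b by simp
    also have "\<dots> = \<zero>\<^bsub>J (Suc t)\<^esub>" using d_smult[OF \<rho>(1)[OF b] uc] u(2) \<rho>(1)[OF b] by simp
    finally show "b \<odot>\<^bsub>J (Suc t)\<^esub> d t y = \<zero>\<^bsub>J (Suc t)\<^esub>" .
  qed
  then obtain y' where y': "y' \<in> annihilated (J t) B" "d t y' = d t y"
    using ext_vanishesD[OF ext[OF B]] d_d[OF y(1)] by blast
  have yc': "y' \<in> carrier (J t)" by (rule annihilatedD(1)[OF y'(1)])
  have "y \<ominus>\<^bsub>J t\<^esub> y' \<in> annihilated (J t) ?I"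
    by (rule annihilated_mem(3)[OF I yI annihilated_mono[OF IB y'(1)]])
  moreover have "d t (y \<ominus>\<^bsub>J t\<^esub> y') = \<zero>\<^bsub>J (Suc t)\<^esub>"
    using d_minus[OF y(1) yc'] y'(2) d_closed[OF y(1)] by (simp add: a_minus_def N.M.r_neg)
  ultimately obtain c where c: "c \<in> carrier R" "(y \<ominus>\<^bsub>J t\<^esub> y') \<ominus>\<^bsub>J t\<^esub> c \<odot>\<^bsub>J t\<^esub> u \<in> coboundaries t ?I"
    using ua by blast
  show "\<exists>q\<in>carrier ?Q. \<forall>b\<in>B. h b = b \<odot>\<^bsub>?Q\<^esub> q"
  proof (intro bexI ballI)
    show "?I +> c \<in> carrier ?Q" using c(1) q(1) by blast
    fix b assume b: "b \<in> B"
    have bc: "b \<in> carrier R" by (rule ideal_carrier[OF B b])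
    note r = \<rho>[OF b]
    have "b \<odot>\<^bsub>J t\<^esub> ((y \<ominus>\<^bsub>J t\<^esub> y') \<ominus>\<^bsub>J t\<^esub> c \<odot>\<^bsub>J t\<^esub> u) = (b \<odot>\<^bsub>J t\<^esub> y \<ominus>\<^bsub>J t\<^esub> b \<odot>\<^bsub>J t\<^esub> y') \<ominus>\<^bsub>J t\<^esub> b \<odot>\<^bsub>J t\<^esub> (c \<odot>\<^bsub>J t\<^esub> u)"
      using bc y(1) yc' c(1) uc by (simp add: a_minus_def M.smult_r_distr M.smult_r_minus)
    also have "\<dots> = (\<rho> b \<odot>\<^bsub>J t\<^esub> u \<ominus>\<^bsub>J t\<^esub> \<zero>\<^bsub>J t\<^esub>) \<ominus>\<^bsub>J t\<^esub> b \<odot>\<^bsub>J t\<^esub> (c \<odot>\<^bsub>J t\<^esub> u)"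
      using y(2) b annihilatedD(2)[OF y'(1) b] by simp
    also have "\<dots> = (\<rho> b \<ominus> b \<otimes> c) \<odot>\<^bsub>J t\<^esub> u"
      using bc r(1) c(1) uc by (simp add: a_minus_def M.smult_l_distr M.smult_l_minus M.smult_assoc1)
    finally have "(\<rho> b \<ominus> b \<otimes> c) \<odot>\<^bsub>J t\<^esub> u \<in> coboundaries t ?I"
      using coboundaries_smult[OF I bc c(2)] by simp
    then have "\<rho> b \<ominus> b \<otimes> c \<in> ?I" using ub r(1) bc c(1) by simp
    then have "?I +> \<rho> b = ?I +> (b \<otimes> c)" using coset_eq_iff[OF I r(1)] bc c(1) by simp
    then show "h b = b \<odot>\<^bsub>?Q\<^esub> (?I +> c)" using r(2) q(4) bc c(1) by simp
  qed
qed

end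

section \<open>Descent from the quotient by a regular sequence to R\<close>

context local_noetherian_cring
begin

text \<open>\<open>Ext\<^sup>1(R\<^sup>k/K, R/(I + xR)) = 0\<close> implies \<open>Ext\<^sup>1(R\<^sup>k/K, R/I) = 0\<close>, as \<open>x\<close> acts surjectively on the
  latter.\<close>

lemma extendable_descend:
  assumes I: "ideal I R" and x: "x \<in> max_ideal R" "colon R I x = I" and K: "submodule K R (free_module R k)"
    and ext: "\<And>h. linear_on R (free_module R k) K (quot_module R (adjoin R I x)) h \<Longrightarrow>
      extendable R k K (quot_module R (adjoin R I x)) (carrier (quot_module R (adjoin R I x))) h"
    and h: "linear_on R (free_module R k) K (quot_module R I) h"
  shows "extendable R k K (quot_module R I) (carrier (quot_module R I)) h"
proof -
  have xc: "x \<in> carrier R" by (rule ideal_carrier[OF max_ideal_ideal x(1)])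
  let ?I' = "adjoin R I x" and ?V = "free_module R k"
  let ?N = "quot_module R I" and ?P = "quot_module R ?I'"
  note I' = adjoin_ideal[OF I xc]
  note N = quot_module_module[OF I] and P = quot_module_module[OF I']
  interpret V: module R ?V by (rule free_module_module)
  interpret N: module R ?N by (rule N)
  interpret P: module R ?P by (rule P)
  note V = V.module_axioms
  note q = quot_module_simps[OF I] and q' = quot_module_simps[OF I']
  have "\<exists>p. linear_on R ?N ((\<lambda>a. I +> a) ` carrier (self_module R)) ?P p \<and> (\<forall>a\<in>carrier (self_module R). p (I +> a) = ?I' +> a)"
  proof (rule linear_on_factor[OF self_module_module N P])
    show "linear_on R (self_module R) (carrier (self_module R)) ?N (\<lambda>a. I +> a)" using coset_linear[OF I] by simp
    show "linear_on R (self_module R) (carrier (self_module R)) ?P (\<lambda>a. ?I' +> a)" using coset_linear[OF I'] by simp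
    fix c assume "c \<in> carrier (self_module R)" "I +> c = \<zero>\<^bsub>?N\<^esub>"
    then have "c \<in> carrier R" "c \<in> ?I'" using coset_eq_zero_iff[OF I] adjoin_superset[OF I xc] by auto
    then show "?I' +> c = \<zero>\<^bsub>?P\<^esub>" using coset_eq_zero_iff[OF I'] by blast
  qed
  then obtain p where p: "linear_on R ?N (carrier ?N) ?P p" "\<And>a. a \<in> carrier R \<Longrightarrow> p (I +> a) = ?I' +> a"
    unfolding q(1) by auto
  have inj: "Y = \<zero>\<^bsub>?N\<^esub>" if Y: "Y \<in> carrier ?N" "x \<odot>\<^bsub>?N\<^esub> Y = \<zero>\<^bsub>?N\<^esub>" for Y
  proof -
    obtain a where a: "a \<in> carrier R" "Y = I +> a" using Y(1) unfolding q(1) by blast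
    then have "x \<otimes> a \<in> I" using Y(2) coset_eq_zero_iff[OF I, of "x \<otimes> a"] q(4)[OF a(1) xc] xc by simp
    then have "a \<in> colon R I x" using a(1) xc by (simp add: colon_def m_comm)
    then show ?thesis using x(2) a coset_eq_zero_iff[OF I a(1)] by simp
  qed
  \<comment> \<open>Modulo I + xR the map extends by assumption, and the extension lifts to a map e
    from R^k to R/I. Then h - e takes values in x(R/I) and can be divided by x, which gives h = e +
    x h'.\<close>
  have step: "\<exists>h'. linear_on R ?V K ?N h' \<and> extendable R k K ?N (carrier ?N) (\<lambda>v. h v \<ominus>\<^bsub>?N\<^esub> x \<odot>\<^bsub>?N\<^esub> h' v)"
    if h: "linear_on R ?V K ?N h" for h
  proof -
    have "linear_on R ?V K ?P (\<lambda>v. p (h v))" by (rule linear_on_comp[OF h p(1) linear_onD(1)[OF h]])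
    then obtain e' where e': "linear_on R ?V (carrier ?V) ?P e'" "\<forall>v\<in>K. p (h v) = e' v"
      using ext unfolding extendable_def by blast
    have "\<exists>e. linear_on R ?V (carrier ?V) ?N e \<and> (\<forall>v\<in>carrier ?V. p (e v) = e' v)"
    proof (rule free_module_lift[OF N P p(1) e'(1)])
      fix i assume "i < k"
      then have "e' (unit_vector R i) \<in> carrier ?P" using linear_onD(1)[OF e'(1)] unit_vector_carrier by blast
      then obtain a where a: "a \<in> carrier R" "e' (unit_vector R i) = ?I' +> a" unfolding q'(1) by blast
      show "e' (unit_vector R i) \<in> p ` carrier ?N"
        by (rule image_eqI[of _ _ "I +> a"]) (use a p(2) q(1) in auto)
    qed
    then obtain e where e: "linear_on R ?V (carrier ?V) ?N e" "\<forall>v\<in>carrier ?V. p (e v) = e' v" by blast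
    have eK: "linear_on R ?V K ?N e" by (rule linear_on_subset[OF e(1) submodule_mem(1)[OF V K]])
    let ?g = "\<lambda>v. h v \<oplus>\<^bsub>?N\<^esub> (\<ominus> \<one>) \<odot>\<^bsub>?N\<^esub> e v"
    have g: "linear_on R ?V K ?N ?g" by (rule linear_on_lin[OF N h eK]) simp
    have "\<exists>h'. linear_on R ?V K ?N h' \<and> (\<forall>v\<in>K. x \<odot>\<^bsub>?N\<^esub> h' v = ?g v)"
    proof (rule linear_on_divide[OF V N K g xc inj])
      fix v assume v: "v \<in> K"
      have hv: "h v \<in> carrier ?N" and ev: "e v \<in> carrier ?N" using linear_onD(1)[OF h v] linear_onD(1)[OF eK v] .
      have pc: "p (h v) \<in> carrier ?P" using linear_onD(1)[OF p(1) hv] .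
      have "p (?g v) = p (h v) \<oplus>\<^bsub>?P\<^esub> (\<ominus> \<one>) \<odot>\<^bsub>?P\<^esub> p (e v)"
        using linear_onD(2,3)[OF p(1)] hv ev by simp
      also have "p (e v) = p (h v)" using e(2) e'(2) v submodule_mem(2)[OF V K] by simp
      finally have pg: "p (?g v) = \<zero>\<^bsub>?P\<^esub>" using pc by (simp add: P.smult_l_minus P.M.r_neg)
      obtain a where a: "a \<in> carrier R" "?g v = I +> a" using linear_onD(1)[OF g v] unfolding q(1) by blast
      have "a \<in> ?I'" using pg a p(2)[OF a(1)] coset_eq_zero_iff[OF I' a(1)] by simp
      then obtain i r where ir: "i \<in> I" "r \<in> carrier R" "a = i \<oplus> r \<otimes> x" by (rule adjoin_memE)
      have ic: "i \<in> carrier R" by (rule ideal_carrier[OF I ir(1)])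
      have "a \<ominus> x \<otimes> r = i" unfolding ir(3) using ic ir(2) xc by Ring.algebra
      then have "I +> a = I +> (x \<otimes> r)" using coset_eq_iff[OF I a(1), of "x \<otimes> r"] xc ir by simp
      then have "x \<odot>\<^bsub>?N\<^esub> (I +> r) = ?g v" using a(2) q(4)[OF ir(2) xc] by simp
      moreover have "I +> r \<in> carrier ?N" using ir(2) q(1) by blast
      ultimately show "\<exists>Y\<in>carrier ?N. x \<odot>\<^bsub>?N\<^esub> Y = ?g v" by blast
    qed
    then obtain h' where h': "linear_on R ?V K ?N h'" "\<forall>v\<in>K. x \<odot>\<^bsub>?N\<^esub> h' v = ?g v" by blast
    have "extendable R k K ?N (carrier ?N) (\<lambda>v. h v \<ominus>\<^bsub>?N\<^esub> x \<odot>\<^bsub>?N\<^esub> h' v)"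
      unfolding extendable_def
    proof (intro exI conjI ballI)
      show "linear_on R ?V (carrier ?V) ?N e" by (rule e(1))
      show "e v \<in> carrier ?N" if "v \<in> carrier ?V" for v by (rule linear_onD(1)[OF e(1) that])
      show "h v \<ominus>\<^bsub>?N\<^esub> x \<odot>\<^bsub>?N\<^esub> h' v = e v" if v: "v \<in> K" for v
        using h'(2) v linear_onD(1)[OF h v] linear_onD(1)[OF eK v] by (simp add: N.smult_l_minus N.M.group_simps)
    qed
    then show ?thesis using h'(1) by blast
  qed
  \<comment> \<open>Iterated division produces the infinite sequence of successive quotients on
    which the Nakayama argument works.\<close>
  have "\<exists>H. \<forall>n. (linear_on R ?V K ?N (H n) \<and> (n = 0 \<longrightarrow> H n = h)) \<and>
      extendable R k K ?N (carrier ?N) (\<lambda>v. H n v \<ominus>\<^bsub>?N\<^esub> x \<odot>\<^bsub>?N\<^esub> H (Suc n) v)"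
  proof (rule dependent_nat_choice)
    show "\<exists>g. linear_on R ?V K ?N g \<and> ((0::nat) = 0 \<longrightarrow> g = h)" using h by blast
    fix g and n :: nat assume "linear_on R ?V K ?N g \<and> (n = 0 \<longrightarrow> g = h)"
    then have "linear_on R ?V K ?N g" by blast
    from step[OF this] show "\<exists>h'. (linear_on R ?V K ?N h' \<and> (Suc n = 0 \<longrightarrow> h' = h)) \<and>
        extendable R k K ?N (carrier ?N) (\<lambda>v. g v \<ominus>\<^bsub>?N\<^esub> x \<odot>\<^bsub>?N\<^esub> h' v)" by blast
  qed
  then obtain H where H: "\<And>n. linear_on R ?V K ?N (H n)" "H 0 = h"
    "\<And>n. extendable R k K ?N (carrier ?N) (\<lambda>v. H n v \<ominus>\<^bsub>?N\<^esub> x \<odot>\<^bsub>?N\<^esub> H (Suc n) v)" by blast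
  have "extendable R k K ?N (carrier ?N) (H 0)"
  proof (rule divisible_extendable[OF N _ _ N.carrier_is_submodule K x(1), where h = H])
    show "I +> \<one> \<in> carrier ?N" using q(1) by blast
    have "carrier ?N = (\<lambda>r. r \<odot>\<^bsub>?N\<^esub> (I +> \<one>)) ` carrier R"
      unfolding q(1) by (rule image_cong[OF refl]) (simp add: q(4))
    then show "carrier ?N = {r \<odot>\<^bsub>?N\<^esub> (I +> \<one>) | r. r \<in> carrier R}" by (simp only: Setcompr_eq_image)
    show "linear_on R ?V K ?N (H j)" for j by (rule H(1))
    show "H j v \<in> carrier ?N" if "v \<in> K" for j v by (rule linear_onD(1)[OF H(1) that])
    show "extendable R k K ?N (carrier ?N) (\<lambda>v. H j v \<ominus>\<^bsub>?N\<^esub> x \<odot>\<^bsub>?N\<^esub> H (Suc j) v)" for j by (rule H(3))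
  qed
  then show ?thesis unfolding H(2) .
qed

text \<open>The induction starts at the quotient by the whole sequence, where maps extend by
  self-injectivity. There \<open>kill\<close> says that maps vanish on the vectors of K with entries
  in the ideal, as required by the extension from K to R^k. The terms are then removed from the last
  to the first.\<close>

lemma extendable_regular_seq:
  assumes x: "regular_seq R x t" "\<forall>i<t. x i \<in> max_ideal R" and baer: "baer R (seq_ideal R x t) (quot_module R (seq_ideal R x t))"
    and K: "submodule K R (free_module R k)"
    and kill: "\<And>h v. linear_on R (free_module R k) K (quot_module R (seq_ideal R x t)) h \<Longrightarrow> v \<in> K \<Longrightarrow>
      (\<And>j. v j \<in> seq_ideal R x t) \<Longrightarrow> h v = \<zero>\<^bsub>quot_module R (seq_ideal R x t)\<^esub>"
    and h: "linear_on R (free_module R k) K (quot_module R {\<zero>}) h"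
  shows "extendable R k K (quot_module R {\<zero>}) (carrier (quot_module R {\<zero>})) h"
proof -
  let ?N = "\<lambda>s. quot_module R (seq_ideal R x s)"
  have id: "ideal (seq_ideal R x s) R" if "s \<le> t" for s
    by (rule seq_ideal_ideal) (use that regular_seqD(1)[OF x(1)] in simp)
  have "extendable R k K (?N (t - s)) (carrier (?N (t - s))) g"
    if "linear_on R (free_module R k) K (?N (t - s)) g" for g s
    using that
  proof (induction s arbitrary: g)
    case 0
    have "\<exists>f. linear_on R (free_module R k) (carrier (free_module R k)) (?N t) f \<and> (\<forall>v\<in>K. f v = g v)"
      by (rule baer_extend[OF quot_module_module[OF id[OF order_refl]] baer id[OF order_refl] K])
        (use 0 kill in auto)
    then obtain f where f: "linear_on R (free_module R k) (carrier (free_module R k)) (?N t) f" "\<forall>v\<in>K. f v = g v" by blast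
    then have "\<forall>v\<in>carrier (free_module R k). f v \<in> carrier (?N t)" using linear_onD(1)[OF f(1)] by blast
    then show ?case unfolding extendable_def using f by auto
  next
    case (Suc s)
    show ?case
    proof (cases "s < t")
      case True
      define l where "l = t - Suc s"
      have l: "t - s = Suc l" "l < t" using True by (auto simp: l_def)
      show ?thesis
        unfolding l_def[symmetric]
      proof (rule extendable_descend[OF id _ _ K])
        show "l \<le> t" "x l \<in> max_ideal R" "colon R (seq_ideal R x l) (x l) = seq_ideal R x l"
          using l x regular_seqD(2)[OF x(1)] by auto
        show "linear_on R (free_module R k) K (?N l) g" using Suc.prems unfolding l_def .
        fix h assume "linear_on R (free_module R k) K (quot_module R (adjoin R (seq_ideal R x l) (x l))) h"
        then show "extendable R k K (quot_module R (adjoin R (seq_ideal R x l) (x l)))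
            (carrier (quot_module R (adjoin R (seq_ideal R x l) (x l)))) h"
          using Suc.IH[of h] unfolding l(1) by simp
      qed
    next
      case False
      then show ?thesis using Suc by simp
    qed
  qed
  from this[of t h] show ?thesis using h by simp
qed

end

section \<open>Powers of regular sequences and vanishing of Tor\<close>

context cring
begin

lemma adjoin_mono: "I \<subseteq> J \<Longrightarrow> adjoin R I a \<subseteq> adjoin R J a"
  unfolding adjoin_def by blast

text \<open>\<open>0 \<rightarrow> R/(I, a) \<rightarrow> R/(I, ab) \<rightarrow> R/(I, b) \<rightarrow> 0\<close>, with first map multiplication by \<open>b\<close>, stays
  exact modulo the later members of the sequences, which are regular on both ends.\<close>

lemma regular_seq_mult:
  assumes i: "i < n" and ra: "regular_seq R (x(i := a)) n" and rb: "regular_seq R (x(i := b)) n"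
  shows "regular_seq R (x(i := a \<otimes> b)) n"
proof -
  let ?A = "seq_ideal R (x(i := a))" and ?B = "seq_ideal R (x(i := b))" and ?C = "seq_ideal R (x(i := a \<otimes> b))"
  have ac: "a \<in> carrier R" and bc: "b \<in> carrier R" using regular_seqD(1)[OF ra i] regular_seqD(1)[OF rb i] by auto
  have xc: "x s \<in> carrier R" if "s < n" "s \<noteq> i" for s using regular_seqD(1)[OF ra that(1)] that(2) by simp
  have iA: "ideal (?A s) R" if "s \<le> n" for s by (rule seq_ideal_ideal) (use that ac xc in auto)
  have iB: "ideal (?B s) R" if "s \<le> n" for s by (rule seq_ideal_ideal) (use that bc xc in auto)
  have iC: "ideal (?C s) R" if "s \<le> n" for s by (rule seq_ideal_ideal) (use that ac bc xc in auto)
  have low: "?A s = ?C s" "?B s = ?C s" if "s \<le> i" for s using that by (auto intro!: seq_ideal_cong)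
  \<comment> \<open>Exactness of 0 -> R/A -> R/C -> R/B -> 0 for the first s terms, spelt out on
    elements; the first map is multiplication by b.\<close>
  let ?P = "\<lambda>s. ?C s \<subseteq> ?B s \<and> (\<forall>z\<in>?B s. \<exists>w\<in>carrier R. z \<ominus> w \<otimes> b \<in> ?C s) \<and>
      (\<forall>w\<in>?A s. w \<otimes> b \<in> ?C s) \<and> (\<forall>w\<in>carrier R. w \<otimes> b \<in> ?C s \<longrightarrow> w \<in> ?A s) \<and> b \<in> ?B s"
  have P: "?P s" if "Suc i \<le> s" "s \<le> n" for s
    using that
  proof (induction s rule: dec_induct)
    case base
    let ?I = "?C i"
    have I: "ideal ?I R" by (rule iC) (use i in simp)
    note Ic = ideal_carrier[OF I]
    have A: "?A (Suc i) = adjoin R ?I a" and B: "?B (Suc i) = adjoin R ?I b" and C: "?C (Suc i) = adjoin R ?I (a \<otimes> b)"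
      using low[of i] by simp_all
    show ?case
      unfolding A B C
    proof (intro conjI ballI impI)
      show "adjoin R ?I (a \<otimes> b) \<subseteq> adjoin R ?I b"
        by (rule adjoin_minimal[OF adjoin_ideal[OF I bc] adjoin_superset[OF I bc]])
          (rule ideal_lmult[OF adjoin_ideal[OF I bc] ac adjoin_self[OF I bc]])
      show "b \<in> adjoin R ?I b" by (rule adjoin_self[OF I bc])
    next
      fix z assume "z \<in> adjoin R ?I b"
      then obtain j r where j: "j \<in> ?I" "r \<in> carrier R" "z = j \<oplus> r \<otimes> b" by (rule adjoin_memE)
      have "z \<ominus> r \<otimes> b = j" unfolding j(3) using Ic[OF j(1)] j(2) bc by Ring.algebra
      then have "z \<ominus> r \<otimes> b \<in> adjoin R ?I (a \<otimes> b)" using adjoin_superset[OF I, of "a \<otimes> b"] ac bc j(1) by auto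
      then show "\<exists>w\<in>carrier R. z \<ominus> w \<otimes> b \<in> adjoin R ?I (a \<otimes> b)" using j(2) by blast
    next
      fix w assume "w \<in> adjoin R ?I a"
      then obtain j r where j: "j \<in> ?I" "r \<in> carrier R" "w = j \<oplus> r \<otimes> a" by (rule adjoin_memE)
      have "w \<otimes> b = j \<otimes> b \<oplus> r \<otimes> (a \<otimes> b)" unfolding j(3) using Ic[OF j(1)] j(2) ac bc by Ring.algebra
      then show "w \<otimes> b \<in> adjoin R ?I (a \<otimes> b)" by (rule adjoin_memI[OF I ideal_rmult[OF I bc j(1)] j(2)])
    next
      fix w assume w: "w \<in> carrier R" "w \<otimes> b \<in> adjoin R ?I (a \<otimes> b)"
      from w(2) obtain j r where j: "j \<in> ?I" "r \<in> carrier R" "w \<otimes> b = j \<oplus> r \<otimes> (a \<otimes> b)" by (rule adjoin_memE)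
      have "(w \<ominus> r \<otimes> a) \<otimes> b = w \<otimes> b \<ominus> r \<otimes> (a \<otimes> b)" using w(1) j(2) ac bc by Ring.algebra
      also have "\<dots> = j" unfolding j(3) using Ic[OF j(1)] j(2) ac bc by Ring.algebra
      finally have "(w \<ominus> r \<otimes> a) \<otimes> b \<in> ?I" using j(1) by simp
      then have "w \<ominus> r \<otimes> a \<in> ?I"
        using regular_seq_cancel[OF rb i, of "w \<ominus> r \<otimes> a"] low(2)[of i] w(1) j(2) ac by simp
      moreover have "w = (w \<ominus> r \<otimes> a) \<oplus> r \<otimes> a" using w(1) j(2) ac by Ring.algebra
      ultimately show "w \<in> adjoin R ?I a" by (rule adjoin_memI[OF I _ j(2)])
    qed
  next
    case (step s)
    then have s: "s < n" "s \<noteq> i" "s \<le> n" by auto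
    let ?y = "x s"
    have yc: "?y \<in> carrier R" using xc s by blast
    note A = iA[OF s(3)] and B = iB[OF s(3)] and C = iC[OF s(3)]
    have IH: "?C s \<subseteq> ?B s" "\<And>z. z \<in> ?B s \<Longrightarrow> \<exists>w\<in>carrier R. z \<ominus> w \<otimes> b \<in> ?C s"
      "\<And>w. w \<in> ?A s \<Longrightarrow> w \<otimes> b \<in> ?C s" "\<And>w. w \<in> carrier R \<Longrightarrow> w \<otimes> b \<in> ?C s \<Longrightarrow> w \<in> ?A s" "b \<in> ?B s"
      using step.IH s by blast+
    have Suc_A: "?A (Suc s) = adjoin R (?A s) ?y" and Suc_B: "?B (Suc s) = adjoin R (?B s) ?y"
      and Suc_C: "?C (Suc s) = adjoin R (?C s) ?y" using s by simp_all
    show ?case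
      unfolding Suc_A Suc_B Suc_C
    proof (intro conjI ballI impI)
      show "adjoin R (?C s) ?y \<subseteq> adjoin R (?B s) ?y" by (rule adjoin_mono[OF IH(1)])
      show "b \<in> adjoin R (?B s) ?y" using adjoin_superset[OF B yc] IH(5) by blast
    next
      fix z assume "z \<in> adjoin R (?B s) ?y"
      then obtain j r where j: "j \<in> ?B s" "r \<in> carrier R" "z = j \<oplus> r \<otimes> ?y" by (rule adjoin_memE)
      obtain w where w: "w \<in> carrier R" "j \<ominus> w \<otimes> b \<in> ?C s" using IH(2)[OF j(1)] by blast
      have "z \<ominus> w \<otimes> b = (j \<ominus> w \<otimes> b) \<oplus> r \<otimes> ?y"
        unfolding j(3) using ideal_carrier[OF B j(1)] j(2) w(1) bc yc by Ring.algebra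
      then have "z \<ominus> w \<otimes> b \<in> adjoin R (?C s) ?y" by (rule adjoin_memI[OF C w(2) j(2)])
      then show "\<exists>w\<in>carrier R. z \<ominus> w \<otimes> b \<in> adjoin R (?C s) ?y" using w(1) by blast
    next
      fix w assume "w \<in> adjoin R (?A s) ?y"
      then obtain j r where j: "j \<in> ?A s" "r \<in> carrier R" "w = j \<oplus> r \<otimes> ?y" by (rule adjoin_memE)
      have "w \<otimes> b = j \<otimes> b \<oplus> (r \<otimes> b) \<otimes> ?y" unfolding j(3) using ideal_carrier[OF A j(1)] j(2) bc yc by Ring.algebra
      then show "w \<otimes> b \<in> adjoin R (?C s) ?y" by (rule adjoin_memI[OF C IH(3)[OF j(1)], rotated]) (use j bc in simp)
    next
      fix w assume w: "w \<in> carrier R" "w \<otimes> b \<in> adjoin R (?C s) ?y"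
      from w(2) obtain c r where c: "c \<in> ?C s" "r \<in> carrier R" "w \<otimes> b = c \<oplus> r \<otimes> ?y" by (rule adjoin_memE)
      have cc: "c \<in> carrier R" by (rule ideal_carrier[OF C c(1)])
      have "r \<otimes> ?y = w \<otimes> b \<ominus> c" unfolding c(3) using cc c(2) yc by Ring.algebra
      moreover have "w \<otimes> b \<ominus> c \<in> ?B s" by (rule ideal_minus[OF B ideal_lmult[OF B w(1) IH(5)]]) (use IH(1) c(1) in blast)
      ultimately have "r \<in> ?B s" using regular_seq_cancel[OF rb s(1) c(2)] s(2) by simp
      then obtain v where v: "v \<in> carrier R" "r \<ominus> v \<otimes> b \<in> ?C s" using IH(2) by blast
      have "(w \<ominus> v \<otimes> ?y) \<otimes> b = w \<otimes> b \<ominus> v \<otimes> ?y \<otimes> b" using w(1) v(1) yc bc by Ring.algebra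
      also have "\<dots> = c \<oplus> (r \<ominus> v \<otimes> b) \<otimes> ?y" unfolding c(3) using cc c(2) v(1) yc bc by Ring.algebra
      also have "\<dots> \<in> ?C s" by (rule ideal_add[OF C c(1) ideal_rmult[OF C yc v(2)]])
      finally have "w \<ominus> v \<otimes> ?y \<in> ?A s" using IH(4)[of "w \<ominus> v \<otimes> ?y"] w(1) v(1) yc by simp
      moreover have "w = (w \<ominus> v \<otimes> ?y) \<oplus> v \<otimes> ?y" using w(1) v(1) yc by Ring.algebra
      ultimately show "w \<in> adjoin R (?A s) ?y" by (rule adjoin_memI[OF A _ v(1)])
    qed
  qed
  show ?thesis
    unfolding regular_seq_def
  proof (intro allI impI conjI)
    fix s assume s: "s < n"
    show xs: "(x(i := a \<otimes> b)) s \<in> carrier R" using xc s ac bc by simp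
    have C: "ideal (?C s) R" by (rule iC) (use s in simp)
    have "z \<in> ?C s" if z: "z \<in> carrier R" "z \<otimes> (x(i := a \<otimes> b)) s \<in> ?C s" for z
    proof -
      consider "s < i" | "s = i" | "Suc i \<le> s" by linarith
      then show ?thesis
      proof cases
        case 1
        then show ?thesis using regular_seq_cancel[OF ra s z(1)] z(2) low(1)[of s] by simp
      next
        case 2
        then have "(z \<otimes> a) \<otimes> b \<in> ?C s" using z ac bc by (simp add: m_assoc)
        then have "z \<otimes> a \<in> ?C s" using regular_seq_cancel[OF rb s, of "z \<otimes> a"] low(2)[of s] 2 z(1) ac by simp
        then show ?thesis using regular_seq_cancel[OF ra s z(1)] low(1)[of s] 2 by simp
      next
        case 3
        let ?y = "x s"
        have y: "z \<otimes> ?y \<in> ?C s" "?y \<in> carrier R" using z(2) 3 xc[OF s] by auto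
        have Ps: "?C s \<subseteq> ?B s" "\<And>z. z \<in> ?B s \<Longrightarrow> \<exists>w\<in>carrier R. z \<ominus> w \<otimes> b \<in> ?C s"
          "\<And>w. w \<in> ?A s \<Longrightarrow> w \<otimes> b \<in> ?C s" "\<And>w. w \<in> carrier R \<Longrightarrow> w \<otimes> b \<in> ?C s \<Longrightarrow> w \<in> ?A s"
          using P[OF 3] s by simp_all
        \<comment> \<open>Regularity on R/B puts z into B, so z = wb modulo C. Regularity on R/A,
          applied to w, then gives w in A and hence wb in C.\<close>
        have "z \<in> ?B s" using regular_seq_cancel[OF rb s z(1)] y(1) Ps(1) 3 by auto
        then obtain w where w: "w \<in> carrier R" "z \<ominus> w \<otimes> b \<in> ?C s" using Ps(2) by blast
        have "(w \<otimes> ?y) \<otimes> b = z \<otimes> ?y \<ominus> (z \<ominus> w \<otimes> b) \<otimes> ?y" using w(1) z(1) y(2) bc by Ring.algebra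
        also have "\<dots> \<in> ?C s" by (rule ideal_minus[OF C y(1) ideal_rmult[OF C y(2) w(2)]])
        finally have "w \<otimes> ?y \<in> ?A s" using Ps(4) w(1) y(2) by simp
        then have "w \<in> ?A s" using regular_seq_cancel[OF ra s w(1)] 3 by simp
        then have "w \<otimes> b \<in> ?C s" by (rule Ps(3))
        then show ?thesis by (rule minus_swap[OF C z(1) _ w(2), rotated]) (use w(1) bc in simp)
      qed
    qed
    then have "colon R (?C s) ((x(i := a \<otimes> b)) s) \<subseteq> ?C s" by (auto simp: colon_def)
    then show "colon R (?C s) ((x(i := a \<otimes> b)) s) = ?C s" using colon_superset[OF C xs] by blast
  qed
qed

text \<open>One term at a time, and within a term one factor at a time:
  \<open>regular_seq_mult\<close> is applied to the power reached so far and to the term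
  itself.\<close>

lemma regular_seq_pow:
  assumes x: "regular_seq R x n" and q: "q > 0"
  shows "regular_seq R (\<lambda>i. x i [^] (q::nat)) n"
proof -
  have one: "regular_seq R (y(i := y i [^] Suc k)) n" if "regular_seq R y n" "i < n" for y i k
  proof (induction k)
    case 0
    have "y(i := y i [^] Suc 0) = y" using regular_seqD(1)[OF that] by simp
    then show ?case using that by simp
  next
    case (Suc k)
    have "regular_seq R (y(i := y i [^] Suc k \<otimes> y i)) n"
      by (rule regular_seq_mult[OF that(2) Suc]) (use that(1) in simp)
    then show ?case by (simp only: nat_pow_Suc)
  qed
  obtain k where k: "q = Suc k" using q by (cases q) auto
  have "regular_seq R (\<lambda>l. if l < j then x l [^] q else x l) n" if "j \<le> n" for j
    using that
  proof (induction j)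
    case 0
    then show ?case using x by simp
  next
    case (Suc j)
    let ?y = "\<lambda>l. if l < j then x l [^] q else x l"
    have "regular_seq R (?y(j := ?y j [^] Suc k)) n" by (rule one) (use Suc in auto)
    moreover have "?y(j := ?y j [^] Suc k) = (\<lambda>l. if l < Suc j then x l [^] q else x l)"
      unfolding k by (auto simp: fun_eq_iff less_Suc_eq)
    ultimately show ?case by simp
  qed
  from this[of n] show ?thesis using regular_seq_cong[of n "\<lambda>l. if l < n then x l [^] q else x l" "\<lambda>i. x i [^] q" R] by simp
qed

text \<open>\<open>Tor\<^sub>1(R\<^sup>k/K, R/I) = 0\<close> for \<open>I\<close> generated by a sequence that is regular on \<open>R\<^sup>k/K\<close>.\<close>

lemma kernel_kill:
  assumes M: "module R M" and g: "\<And>i. i < k \<Longrightarrow> g i \<in> carrier M"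
    and x: "\<And>i. i < t \<Longrightarrow> x i \<in> carrier R"
    and reg: "\<And>s v. s < t \<Longrightarrow> v \<in> carrier (free_module R k) \<Longrightarrow>
      x s \<odot>\<^bsub>M\<^esub> lincomb M g k v \<in> lincomb M g k ` {b \<in> carrier (free_module R k). \<forall>j. b j \<in> seq_ideal R x s} \<Longrightarrow>
      lincomb M g k v \<in> lincomb M g k ` {b \<in> carrier (free_module R k). \<forall>j. b j \<in> seq_ideal R x s}"
    and N: "module R N" and Nx: "\<And>i Y. i < t \<Longrightarrow> Y \<in> carrier N \<Longrightarrow> x i \<odot>\<^bsub>N\<^esub> Y = \<zero>\<^bsub>N\<^esub>"
    and h: "linear_on R (free_module R k) {v \<in> carrier (free_module R k). lincomb M g k v = \<zero>\<^bsub>M\<^esub>} N h"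
  shows "s \<le> t \<Longrightarrow> v \<in> carrier (free_module R k) \<Longrightarrow> lincomb M g k v = \<zero>\<^bsub>M\<^esub> \<Longrightarrow>
    (\<And>j. v j \<in> seq_ideal R x s) \<Longrightarrow> h v = \<zero>\<^bsub>N\<^esub>"
proof (induction s arbitrary: v)
  let ?V = "free_module R k" and ?p = "lincomb M g k"
  let ?K = "{v \<in> carrier ?V. ?p v = \<zero>\<^bsub>M\<^esub>}"
  interpret V: module R ?V by (rule free_module_module)
  interpret M: module R M by fact
  interpret N: module R N by fact
  have p: "linear_on R ?V (carrier ?V) M ?p" by (rule M.lincomb_linear[OF g])
  have K: "submodule ?K R ?V" by (rule linear_on_kernel_submodule[OF V.module_axioms M V.carrier_is_submodule p])
  {
    case 0
    have "v = \<zero>\<^bsub>?V\<^esub>" using 0(4) by (simp add: fun_eq_iff)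
    then show ?case using linear_on_zero[OF V.module_axioms N K h] by simp
  next
    case (Suc s)
    let ?I = "seq_ideal R x s" and ?x = "x s"
    have I: "ideal ?I R" by (rule seq_ideal_ideal) (use x Suc.prems(1) in simp)
    have xc: "?x \<in> carrier R" using x Suc.prems(1) by simp
    have "\<forall>j. \<exists>ar. j < k \<longrightarrow> fst ar \<in> ?I \<and> snd ar \<in> carrier R \<and> v j = fst ar \<oplus> snd ar \<otimes> ?x"
      using Suc.prems(4) by (auto simp: adjoin_def)
    then obtain ar where "\<forall>j. j < k \<longrightarrow> fst (ar j) \<in> ?I \<and> snd (ar j) \<in> carrier R \<and> v j = fst (ar j) \<oplus> snd (ar j) \<otimes> ?x"
      by (rule choice[THEN exE])
    then have ar: "\<And>j. j < k \<Longrightarrow> fst (ar j) \<in> ?I" "\<And>j. j < k \<Longrightarrow> snd (ar j) \<in> carrier R"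
      "\<And>j. j < k \<Longrightarrow> v j = fst (ar j) \<oplus> snd (ar j) \<otimes> ?x" by blast+
    define a where "a j = (if j < k then fst (ar j) else \<zero>)" for j
    define r where "r j = (if j < k then snd (ar j) else \<zero>)" for j
    have aI: "a j \<in> ?I" for j using ar(1) ideal_zero[OF I] by (simp add: a_def)
    have ac: "a j \<in> carrier R" for j by (rule ideal_carrier[OF I aI])
    have "\<forall>i\<ge>k. a i = \<zero>" "\<forall>i\<ge>k. r i = \<zero>" by (simp_all add: a_def r_def)
    then have a: "a \<in> carrier ?V" and rz: "\<forall>i\<ge>k. r i = \<zero>" using ac by simp_all
    have rc: "r j \<in> carrier R" for j using ar(2) by (simp add: r_def)
    have r: "r \<in> carrier ?V" using rc rz by simp
    have vj: "v j = a j \<oplus> r j \<otimes> ?x" for j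
      using ar(3)[of j] Suc.prems(2) xc by (cases "j < k") (auto simp: a_def r_def)
    have v: "v = a \<oplus>\<^bsub>?V\<^esub> ?x \<odot>\<^bsub>?V\<^esub> r" using vj rc xc by (simp add: fun_eq_iff m_comm)
    note pD = linear_onD[OF p]
    have pv: "?p v = ?p a \<oplus>\<^bsub>M\<^esub> ?x \<odot>\<^bsub>M\<^esub> ?p r"
      unfolding v using pD(2)[OF a V.smult_closed[OF xc r]] pD(3)[OF xc r] by simp
    let ?a' = "\<ominus>\<^bsub>?V\<^esub> a"
    have a': "?a' = (\<ominus> \<one>) \<odot>\<^bsub>?V\<^esub> a" using V.smult_l_minus[OF one_closed a] V.smult_one[OF a] by simp
    have "?p ?a' = \<ominus>\<^bsub>M\<^esub> ?p a" unfolding a' using pD(3)[of "\<ominus> \<one>" a] a pD(1)[OF a] by (simp add: M.smult_l_minus)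
    also have "\<dots> = \<ominus>\<^bsub>M\<^esub> ?p a \<oplus>\<^bsub>M\<^esub> ?p v" using Suc.prems(3) pD(1)[OF a] by simp
    also have "\<dots> = ?x \<odot>\<^bsub>M\<^esub> ?p r" unfolding pv using pD(1)[OF a] pD(1)[OF r] xc by (simp add: M.M.group_simps)
    finally have "?x \<odot>\<^bsub>M\<^esub> ?p r = ?p ?a'" by simp
    moreover have "?a' \<in> carrier ?V" using a by (rule V.M.a_inv_closed)
    moreover have "?a' j \<in> ?I" for j
      unfolding a' using ideal_lmult[OF I _ aI, of "\<ominus> \<one>" j] by simp
    ultimately have "?x \<odot>\<^bsub>M\<^esub> ?p r \<in> ?p ` {b \<in> carrier ?V. \<forall>j. b j \<in> ?I}" by blast
    then have "?p r \<in> ?p ` {b \<in> carrier ?V. \<forall>j. b j \<in> ?I}"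
      using reg[of s r] r Suc.prems(1) by simp
    then obtain b where b: "b \<in> carrier ?V" "\<And>j. b j \<in> ?I" "?p r = ?p b" by blast
    let ?d = "r \<ominus>\<^bsub>?V\<^esub> b"
    have dc: "?d \<in> carrier ?V" using r b(1) by (rule V.M.minus_closed)
    have "?p ?d = ?p r \<ominus>\<^bsub>M\<^esub> ?p b" by (rule linear_on_minus[OF V.module_axioms M V.carrier_is_submodule p r b(1)])
    also have "\<dots> = \<zero>\<^bsub>M\<^esub>" unfolding b(3) using pD(1)[OF b(1)] by (simp add: a_minus_def M.M.r_neg)
    finally have d: "?d \<in> ?K" using dc by simp
    \<comment> \<open>Regularity replaced r by b, whose entries lie in the smaller ideal. Thus v = c
      + xd with c and d in K and all entries of c in the smaller ideal; h vanishes at c by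
      induction, and x kills h d.\<close>
    let ?c = "a \<oplus>\<^bsub>?V\<^esub> ?x \<odot>\<^bsub>?V\<^esub> b"
    have xb: "?x \<odot>\<^bsub>?V\<^esub> b \<in> carrier ?V" by (rule V.smult_closed[OF xc b(1)])
    have c: "?c \<in> carrier ?V" by (rule V.M.a_closed[OF a xb])
    have "?p ?c = ?p a \<oplus>\<^bsub>M\<^esub> ?x \<odot>\<^bsub>M\<^esub> ?p b" using pD(2)[OF a xb] pD(3)[OF xc b(1)] by simp
    also have "\<dots> = \<zero>\<^bsub>M\<^esub>" using pv Suc.prems(3) b(3) by simp
    finally have cK: "?c \<in> ?K" using c by simp
    have "?c j \<in> ?I" for j using aI b(2) xc by (simp add: ideal_closed[OF I])
    then have hc: "h ?c = \<zero>\<^bsub>N\<^esub>" using Suc.IH[of ?c] cK Suc.prems(1) by simp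
    have xd: "?x \<odot>\<^bsub>?V\<^esub> ?d \<in> ?K" by (rule submodule_mem(7)[OF V.module_axioms K xc d])
    have "?x \<odot>\<^bsub>?V\<^esub> r = ?x \<odot>\<^bsub>?V\<^esub> b \<oplus>\<^bsub>?V\<^esub> ?x \<odot>\<^bsub>?V\<^esub> ?d"
    proof -
      have "r = b \<oplus>\<^bsub>?V\<^esub> ?d" using r b(1) by (simp only: V.M.group_simps V.M.a_inv_closed)
      then show ?thesis using V.smult_r_distr[OF xc b(1) dc] by simp
    qed
    then have "v = ?c \<oplus>\<^bsub>?V\<^esub> ?x \<odot>\<^bsub>?V\<^esub> ?d"
      unfolding v using V.M.a_assoc[OF a xb V.smult_closed[OF xc dc]] by simp
    then have "h v = h ?c \<oplus>\<^bsub>N\<^esub> ?x \<odot>\<^bsub>N\<^esub> h ?d"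
      using linear_onD(2)[OF h cK xd] linear_onD(3)[OF h xc d] by simp
    also have "\<dots> = \<zero>\<^bsub>N\<^esub>" using hc Nx[OF _ linear_onD(1)[OF h d], of s] Suc.prems(1) by simp
    finally show ?case .
  }
qed

end

section \<open>Frobenius pushforwards\<close>

context cring
begin

lemma binomial_expansion:
  assumes a: "a \<in> carrier R" and b: "b \<in> carrier R"
  shows "(a \<oplus> b) [^] (n::nat) = (\<Oplus>i\<in>{..n}. add_pow R (n choose i) (a [^] i \<otimes> b [^] (n - i)))"
proof (induction n)
  case 0
  then show ?case using a b by simp
next
  case (Suc n)
  define T where "T i = add_pow R (n choose i) (a [^] i \<otimes> b [^] (n - i))" for i
  define U where "U i = add_pow R (n choose i) (a [^] i \<otimes> b [^] (Suc n - i))" for i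
  define V where "V i = add_pow R (n choose i) (a [^] Suc i \<otimes> b [^] (n - i))" for i
  have c: "T \<in> A \<rightarrow> carrier R" "U \<in> A \<rightarrow> carrier R" "V \<in> A \<rightarrow> carrier R" "(\<lambda>i. U (Suc i)) \<in> A \<rightarrow> carrier R" for A
    using a b by (auto simp: T_def U_def V_def)
  have "(a \<oplus> b) [^] Suc n = finsum R T {..n} \<otimes> (a \<oplus> b)" using Suc by (simp add: T_def[abs_def])
  also have "\<dots> = finsum R T {..n} \<otimes> a \<oplus> finsum R T {..n} \<otimes> b"
    using a b finsum_closed[OF c(1)] by (simp add: r_distr)
  also have "finsum R T {..n} \<otimes> a = finsum R V {..n}"
  proof -
    have "T i \<otimes> a = V i" for i
      unfolding T_def V_def using a b add_pow_ldistr[of "a [^] i \<otimes> b [^] (n - i)" a "n choose i"] by (simp add: m_ac)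
    then show ?thesis using finsum_ldistr[of "{..n}" a T] a c by simp
  qed
  also have "finsum R T {..n} \<otimes> b = finsum R U {..Suc n}"
  proof -
    have "T i \<otimes> b = U i" if "i \<le> n" for i
      unfolding T_def U_def using a b that add_pow_ldistr[of "a [^] i \<otimes> b [^] (n - i)" b "n choose i"]
      by (simp add: m_ac Suc_diff_le)
    then have "finsum R T {..n} \<otimes> b = finsum R U {..n}"
      using finsum_ldistr[of "{..n}" b T] b c finsum_cong'[of "{..n}" "{..n}" U "\<lambda>i. T i \<otimes> b"] by simp
    moreover have "U (Suc n) = \<zero>" by (simp add: U_def binomial_eq_0)
    ultimately show ?thesis using finsum_Suc[OF c(2), of n] finsum_closed[OF c(2)] by simp
  qed
  also have "finsum R U {..Suc n} = finsum R (\<lambda>i. U (Suc i)) {..n} \<oplus> U 0" by (rule finsum_Suc2[OF c(2)])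
  also have "finsum R V {..n} \<oplus> (finsum R (\<lambda>i. U (Suc i)) {..n} \<oplus> U 0)
      = finsum R (\<lambda>i. V i \<oplus> U (Suc i)) {..n} \<oplus> U 0"
    using finsum_addf[OF c(3,4)] finsum_closed[OF c(3)] finsum_closed[OF c(4)] c(2)[of UNIV] by (simp add: a_assoc Pi_iff)
  also have "\<dots> = (\<Oplus>i\<in>{..n}. add_pow R (Suc n choose Suc i) (a [^] Suc i \<otimes> b [^] (Suc n - Suc i))) \<oplus> add_pow R (Suc n choose 0) (a [^] (0::nat) \<otimes> b [^] (Suc n - 0))"
    unfolding U_def V_def using a b by (simp add: add.nat_pow_mult del: nat_pow_Suc)
  also have "\<dots> = (\<Oplus>i\<in>{..Suc n}. add_pow R (Suc n choose i) (a [^] i \<otimes> b [^] (Suc n - i)))"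
    by (rule finsum_Suc2[symmetric]) (use a b in auto)
  finally show ?case .
qed

end

section \<open>Additivity and finiteness of the iterated Frobenius\<close>

locale char_p_cring = cring +
  fixes p :: nat
  assumes p: "Factorial_Ring.prime p" and char: "has_characteristic R p"
begin

lemma add_pow_dvd_zero:
  assumes "p dvd n" "a \<in> carrier R" shows "add_pow R n a = \<zero>"
proof -
  have "add_pow R n \<one> = \<zero>" using assms(1) char by (simp add: has_characteristic_def)
  then show ?thesis using add_pow_ldistr[of \<one> a n] assms(2) by simp
qed

lemma frobenius_add:
  assumes a: "a \<in> carrier R" and b: "b \<in> carrier R"
  shows "(a \<oplus> b) [^] p = a [^] p \<oplus> b [^] p"
proof -
  \<comment> \<open>As p is at least 2, the outer terms i = 0 and i = p can be split off; the m + 1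
    terms between them have coefficients divisible by p.\<close>
  obtain m where m: "p = Suc (Suc m)"
    using prime_ge_2_nat[OF p] by (metis Suc_le_D numeral_2_eq_2 Suc_le_mono)
  let ?f = "\<lambda>i. add_pow R (p choose i) (a [^] i \<otimes> b [^] (p - i))"
  have c: "?f \<in> A \<rightarrow> carrier R" for A using a b by auto
  have z: "?f (Suc i) = \<zero>" if "i \<le> m" for i
    by (rule add_pow_dvd_zero[OF dvd_choose_prime]) (use that a b m p in simp_all)
  have "(a \<oplus> b) [^] p = finsum R ?f {..Suc (Suc m)}" using binomial_expansion[OF a b, of p] unfolding m .
  also have "\<dots> = ?f (Suc (Suc m)) \<oplus> finsum R ?f {..Suc m}" by (rule finsum_Suc[OF c])
  also have "finsum R ?f {..Suc m} = finsum R (\<lambda>i. ?f (Suc i)) {..m} \<oplus> ?f 0" by (rule finsum_Suc2[OF c])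
  also have "finsum R (\<lambda>i. ?f (Suc i)) {..m} = finsum R (\<lambda>i. \<zero>) {..m}"
    by (rule finsum_cong') (use z in auto)
  also have "\<dots> = \<zero>" by simp
  also have "?f 0 = b [^] p" using a b by simp
  also have "?f (Suc (Suc m)) = a [^] p" using a b unfolding m[symmetric] by simp
  finally show ?thesis using a b by simp
qed

lemma iterated_frobenius_add:
  assumes a: "a \<in> carrier R" and b: "b \<in> carrier R"
  shows "(a \<oplus> b) [^] (p ^ e) = a [^] (p ^ e) \<oplus> b [^] (p ^ e)"
proof (induction e)
  case (Suc e)
  have eq: "x [^] (p ^ Suc e) = (x [^] (p ^ e)) [^] p" if "x \<in> carrier R" for x
    using that by (simp add: nat_pow_pow mult.commute)
  show ?case using eq a b Suc frobenius_add by simp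
qed (use a b in simp)

lemma frobenius_module_simps [simp]:
  "carrier (frobenius_module p e R) = carrier R" "ring.zero (frobenius_module p e R) = \<zero>"
  "add (frobenius_module p e R) = add R" "smult (frobenius_module p e R) = (\<lambda>r x. (r [^] (p ^ e)) \<otimes> x)"
  by (auto simp: frobenius_module_def)

lemma frobenius_module_module: "module R (frobenius_module p e R)"
proof (rule moduleI)
  show "abelian_group (frobenius_module p e R)"
    by (rule abelian_groupI) (auto simp: a_ac intro: add.l_inv_ex)
qed (auto simp: l_distr r_distr m_assoc is_cring iterated_frobenius_add nat_pow_distrib)

text \<open>F-finiteness concerns e = 1. If the a generate F^e_*R and the b generate F_*R, then the
  products a^p b generate F^(e+1)_*R. Generation is expressed through submodules, which avoids
  expanding nested sums.\<close>

lemma frobenius_module_spanned: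
  assumes F: "F_finite p R"
  shows "\<exists>S\<subseteq>carrier R. finite S \<and> (\<forall>T. submodule T R (frobenius_module p e R) \<longrightarrow> S \<subseteq> T \<longrightarrow> T = carrier R)"
proof (induction e)
  case 0
  have "T = carrier R" if T: "submodule T R (frobenius_module p 0 R)" "{\<one>} \<subseteq> T" for T
  proof -
    note s = submodule_mem[OF frobenius_module_module T(1)]
    have "x \<in> T" if "x \<in> carrier R" for x using s(7)[OF that, of \<one>] T(2) that by simp
    then show ?thesis using s(1) by auto
  qed
  then show ?case by (intro exI[of _ "{\<one>}"]) auto
next
  case (Suc e)
  then obtain S where S: "S \<subseteq> carrier R" "finite S"
    "\<And>T. submodule T R (frobenius_module p e R) \<Longrightarrow> S \<subseteq> T \<Longrightarrow> T = carrier R" by blast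
  let ?M = "frobenius_module p 1 R"
  interpret M: module R ?M by (rule frobenius_module_module)
  obtain B where B: "B \<subseteq> carrier R" "finite B"
    "\<And>x. x \<in> carrier R \<Longrightarrow> \<exists>c\<in>B \<rightarrow> carrier R. x = finsum ?M (\<lambda>s. c s \<odot>\<^bsub>?M\<^esub> s) B"
    using F unfolding F_finite_def finitely_generated_module_def by auto
  let ?S = "(\<lambda>(a, b). a [^] p \<otimes> b) ` (S \<times> B)"
  have "T = carrier R" if T: "submodule T R (frobenius_module p (Suc e) R)" "?S \<subseteq> T" for T
  proof -
    note s = submodule_mem[OF frobenius_module_module T(1)]
    have cb: "c [^] p \<otimes> b \<in> T" if b: "b \<in> B" and c: "c \<in> carrier R" for b c
    proof -
      have bc: "b \<in> carrier R" using b B(1) by blast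
      \<comment> \<open>For fixed b, the c with c^p b in T form a submodule of F^e_*R that contains
        S, hence everything.\<close>
      have "{c \<in> carrier R. c [^] p \<otimes> b \<in> T} = carrier R"
      proof (rule S(3))
        show "S \<subseteq> {c \<in> carrier R. c [^] p \<otimes> b \<in> T}" using S(1) T(2) b by auto
        show "submodule {c \<in> carrier R. c [^] p \<otimes> b \<in> T} R (frobenius_module p e R)"
          unfolding submodule_iff[OF frobenius_module_module]
        proof (intro conjI ballI)
          have "\<zero> [^] p \<otimes> b = \<zero>" using bc prime_gt_0_nat[OF p] by (simp add: nat_pow_zero)
          then show "\<zero>\<^bsub>frobenius_module p e R\<^esub> \<in> {c \<in> carrier R. c [^] p \<otimes> b \<in> T}" using s(3) by simp
        next
          fix x y assume "x \<in> {c \<in> carrier R. c [^] p \<otimes> b \<in> T}" "y \<in> {c \<in> carrier R. c [^] p \<otimes> b \<in> T}"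
          then show "x \<oplus>\<^bsub>frobenius_module p e R\<^esub> y \<in> {c \<in> carrier R. c [^] p \<otimes> b \<in> T}"
            using s(4)[of "x [^] p \<otimes> b" "y [^] p \<otimes> b"] bc by (simp add: frobenius_add l_distr)
        next
          fix r x assume r: "r \<in> carrier R" and "x \<in> {c \<in> carrier R. c [^] p \<otimes> b \<in> T}"
          then have x: "x \<in> carrier R" "x [^] p \<otimes> b \<in> T" by auto
          have "(r [^] (p ^ e) \<otimes> x) [^] p \<otimes> b = r [^] (p ^ Suc e) \<otimes> (x [^] p \<otimes> b)"
            using r x bc by (simp add: nat_pow_distrib nat_pow_pow m_assoc mult.commute)
          then show "r \<odot>\<^bsub>frobenius_module p e R\<^esub> x \<in> {c \<in> carrier R. c [^] p \<otimes> b \<in> T}"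
            using s(7)[OF r x(2)] r x by simp
        qed auto
      qed
      then show ?thesis using c by blast
    qed
    have "x \<in> T" if x: "x \<in> carrier R" for x
    proof -
      obtain c where c: "c \<in> B \<rightarrow> carrier R" "x = finsum ?M (\<lambda>s. c s \<odot>\<^bsub>?M\<^esub> s) B" using B(3)[OF x] by blast
      have "finsum ?M (\<lambda>s. c s \<odot>\<^bsub>?M\<^esub> s) B' \<in> T" if "B' \<subseteq> B" for B'
        using finite_subset[OF that B(2)] that
      proof (induction B' rule: finite_induct)
        case empty
        show ?case unfolding M.M.finsum_empty using s(3) by simp
      next
        case (insert b B')
        have m: "(\<lambda>s. c s \<odot>\<^bsub>?M\<^esub> s) \<in> A \<rightarrow> carrier ?M" if "A \<subseteq> B" for A using that c(1) B(1) by fastforce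
        have "finsum ?M (\<lambda>s. c s \<odot>\<^bsub>?M\<^esub> s) (insert b B') = c b \<odot>\<^bsub>?M\<^esub> b \<oplus>\<^bsub>?M\<^esub> finsum ?M (\<lambda>s. c s \<odot>\<^bsub>?M\<^esub> s) B'"
          by (rule M.M.finsum_insert) (use insert m[of B'] m[of "{b}"] in auto)
        moreover have "c b \<odot>\<^bsub>?M\<^esub> b \<in> T" using cb[of b "c b"] insert.prems c(1) by auto
        ultimately show ?case using s(4) insert by simp
      qed
      then show ?thesis using c(2) by simp
    qed
    then show ?thesis using s(1) by auto
  qed
  moreover have "?S \<subseteq> carrier R" using S(1) B(1) by auto
  moreover have "finite ?S" using S(2) B(2) by simp
  ultimately show ?case by blast
qed

text \<open>This presents F^e_*R as a quotient of R^k; the kernel is the submodule K to which the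
  extension results apply.\<close>

lemma frobenius_module_generators:
  assumes F: "F_finite p R"
  shows "\<exists>k g. (\<forall>i<k. g i \<in> carrier R) \<and> lincomb (frobenius_module p e R) g k ` carrier (free_module R k) = carrier R"
proof -
  let ?M = "frobenius_module p e R"
  interpret M: module R ?M by (rule frobenius_module_module)
  obtain S where S: "S \<subseteq> carrier R" "finite S" "\<And>T. submodule T R ?M \<Longrightarrow> S \<subseteq> T \<Longrightarrow> T = carrier R"
    using frobenius_module_spanned[OF F, of e] by auto
  obtain k :: nat and g where g: "S = g ` {i. i < k}" using finite_imp_nat_seg_image_inj_on[OF S(2)] by blast
  have gc: "g i \<in> carrier ?M" if "i < k" for i using that g S(1) by auto
  have lin: "linear_on R (free_module R k) (carrier (free_module R k)) ?M (lincomb ?M g k)" by (rule M.lincomb_linear[OF gc])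
  have "lincomb ?M g k ` carrier (free_module R k) = carrier R"
  proof (rule S(3))
    show "submodule (lincomb ?M g k ` carrier (free_module R k)) R ?M"
      by (rule linear_on_image_submodule[OF free_module_module M.module_axioms carrier_submodule[OF free_module_module] lin])
    show "S \<subseteq> lincomb ?M g k ` carrier (free_module R k)"
    proof
      fix s assume "s \<in> S"
      then obtain i where i: "i < k" "s = g i" using g by auto
      have "lincomb ?M g k (unit_vector R i) = s" using M.lincomb_unit_vector[of k g i, OF gc] i by simp
      then show "s \<in> lincomb ?M g k ` carrier (free_module R k)" using unit_vector_carrier[OF i(1)] by blast
    qed
  qed
  then show ?thesis using gc by auto
qed

lemma seq_ideal_frobenius:
  assumes x: "\<And>i. i < s \<Longrightarrow> x i \<in> carrier R" and r: "r \<in> seq_ideal R x s"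
  shows "r [^] (p ^ e) \<in> seq_ideal R (\<lambda>i. x i [^] (p ^ e)) s"
  using x r
proof (induction s arbitrary: r)
  case 0
  then show ?case using prime_gt_0_nat[OF p] by (simp add: nat_pow_zero)
next
  case (Suc s)
  have I: "ideal (seq_ideal R x s) R" by (rule seq_ideal_ideal) (use Suc.prems in simp)
  have I': "ideal (seq_ideal R (\<lambda>i. x i [^] (p ^ e)) s) R" by (rule seq_ideal_ideal) (use Suc.prems in simp)
  have xc: "x s \<in> carrier R" using Suc.prems by simp
  from Suc.prems(2) obtain i t where i: "i \<in> seq_ideal R x s" "t \<in> carrier R" "r = i \<oplus> t \<otimes> x s"
    by (auto elim: adjoin_memE)
  have "r [^] (p ^ e) = i [^] (p ^ e) \<oplus> t [^] (p ^ e) \<otimes> x s [^] (p ^ e)"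
    unfolding i(3) using ideal_carrier[OF I i(1)] i(2) xc by (simp add: iterated_frobenius_add nat_pow_distrib)
  moreover have "i [^] (p ^ e) \<in> seq_ideal R (\<lambda>i. x i [^] (p ^ e)) s" by (rule Suc.IH) (use Suc.prems i in auto)
  ultimately show ?case using adjoin_memI[OF I', of _ "t [^] (p ^ e)"] i(2) by simp
qed

text \<open>Both sides are \<open>I F\<^sup>e\<^sub>*(R)\<close>, for \<open>I\<close> generated by \<open>x 0, \<dots>, x (s - 1)\<close>.\<close>

lemma frobenius_module_seq_ideal:
  assumes g: "\<And>i. i < k \<Longrightarrow> g i \<in> carrier R"
    and gen: "lincomb (frobenius_module p e R) g k ` carrier (free_module R k) = carrier R"
    and x: "\<And>i. i < s \<Longrightarrow> x i \<in> carrier R"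
  shows "lincomb (frobenius_module p e R) g k ` {b \<in> carrier (free_module R k). \<forall>j. b j \<in> seq_ideal R x s}
    = seq_ideal R (\<lambda>i. x i [^] (p ^ e)) s" (is "?p ` ?D s = ?I s")
proof
  let ?M = "frobenius_module p e R" and ?V = "free_module R k"
  interpret M: module R ?M by (rule frobenius_module_module)
  interpret V: module R ?V by (rule free_module_module)
  have gc: "\<And>i. i < k \<Longrightarrow> g i \<in> carrier ?M" using g by simp
  have pD: "linear_on R ?V (carrier ?V) ?M ?p" by (rule M.lincomb_linear[OF gc])
  have I: "ideal (?I s) R" by (rule seq_ideal_ideal) (use x in simp)
  show "?p ` ?D s \<subseteq> ?I s"
  proof (rule image_subsetI)
    fix b assume b: "b \<in> ?D s"
    have "lincomb ?M g l b \<in> ?I s" if "l \<le> k" for l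
      using that
    proof (induction l)
      case 0
      then show ?case using ideal_zero[OF I] by simp
    next
      case (Suc l)
      have "b l [^] (p ^ e) \<in> ?I s" by (rule seq_ideal_frobenius) (use x b in auto)
      then show ?case using Suc g by (simp add: ideal_closed[OF I])
    qed
    then show "?p b \<in> ?I s" by simp
  qed
  show "?I s \<subseteq> ?p ` ?D s"
    using x
  proof (induction s)
    case 0
    have "\<zero>\<^bsub>?V\<^esub> \<in> ?D 0" by simp
    moreover have "?p \<zero>\<^bsub>?V\<^esub> = \<zero>" using linear_on_zero[OF V.module_axioms M.module_axioms V.carrier_is_submodule pD] by simp
    ultimately show ?case by (auto intro: image_eqI[of _ _ "\<zero>\<^bsub>?V\<^esub>"])
  next
    case (Suc s)
    have I': "ideal (seq_ideal R x s) R" by (rule seq_ideal_ideal) (use Suc.prems in simp)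
    have xc: "x s \<in> carrier R" using Suc.prems by simp
    show ?case
    proof
      fix y assume "y \<in> ?I (Suc s)"
      then obtain i r where i: "i \<in> ?I s" "r \<in> carrier R" "y = i \<oplus> r \<otimes> x s [^] (p ^ e)" by (auto elim: adjoin_memE)
      have "?I s \<subseteq> ?p ` ?D s" by (rule Suc.IH) (use Suc.prems in simp)
      then obtain b where b: "b \<in> carrier ?V" "\<And>j. b j \<in> seq_ideal R x s" "i = ?p b" using i(1) by blast
      obtain c where c: "c \<in> carrier ?V" "r = ?p c" using i(2) gen by blast
      let ?b = "b \<oplus>\<^bsub>?V\<^esub> x s \<odot>\<^bsub>?V\<^esub> c"
      have xsc: "x s \<odot>\<^bsub>?V\<^esub> c \<in> carrier ?V" by (rule V.smult_closed[OF xc c(1)])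
      have "?p ?b = i \<oplus> x s [^] (p ^ e) \<otimes> r"
        using linear_onD(2)[OF pD b(1) xsc] linear_onD(3)[OF pD xc c(1)] b(3) c(2) by simp
      then have "y = ?p ?b" using i(2,3) xc by (simp add: m_comm)
      moreover have "?b \<in> carrier ?V" by (rule V.M.a_closed[OF b(1) xsc])
      moreover have "?b j \<in> seq_ideal R x (Suc s)" for j
        unfolding seq_ideal.simps
        by (rule adjoin_memI[OF I' b(2)[of j], of "c j"]) (use free_module_coeff[OF c(1)] xc in \<open>simp_all add: m_comm\<close>)
      ultimately show "y \<in> ?p ` ?D (Suc s)" by blast
    qed
  qed
qed

end

section \<open>Lifting of maps and splittings from the quotient by f\<close>

locale char_p_local_cring = local_noetherian_cring + char_p_cring

context char_p_local_cring
begin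

text \<open>Multiplication by x i on F^e_*R is multiplication by its p^e-th power on R. So
  \<open>regular_seq_pow\<close> supplies the regularity on F^e_*R that \<open>kernel_kill\<close>
  asks for, and the extension to R^k follows from self-injectivity modulo the sequence.\<close>

lemma frobenius_kernel_extendable:
  assumes inj: "finite_self_injective_dimension R"
    and g: "\<forall>i<k. g i \<in> carrier R"
    and gen: "lincomb (frobenius_module p e R) g k ` carrier (free_module R k) = carrier R"
    and h: "linear_on R (free_module R k)
      {v \<in> carrier (free_module R k). lincomb (frobenius_module p e R) g k v = \<zero>} (quot_module R {\<zero>}) h"
  shows "extendable R k {v \<in> carrier (free_module R k). lincomb (frobenius_module p e R) g k v = \<zero>}
    (quot_module R {\<zero>}) (carrier (quot_module R {\<zero>})) h"
proof -
  let ?M = "frobenius_module p e R" and ?V = "free_module R k"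
  let ?p = "lincomb ?M g k"
  let ?K = "{v \<in> carrier ?V. ?p v = \<zero>}"
  interpret M: module R ?M by (rule frobenius_module_module)
  interpret V: module R ?V by (rule free_module_module)
  have gc: "\<And>i. i < k \<Longrightarrow> g i \<in> carrier ?M" using g by simp
  have pD: "linear_on R ?V (carrier ?V) ?M ?p" by (rule M.lincomb_linear[OF gc])
  have K: "submodule ?K R ?V"
    using linear_on_kernel_submodule[OF V.module_axioms M.module_axioms V.carrier_is_submodule pD] by simp
  obtain J :: "nat \<Rightarrow> ('a, 'a \<times> nat) module" and aug d n where J: "injective_resolution R (self_module R) J aug d"
    "\<forall>i>n. carrier (J i) = {\<zero>\<^bsub>J i\<^esub>}"
    using inj unfolding finite_self_injective_dimension_def by blast
  interpret J: resolved_local_ring R J aug d by unfold_locales (rule J(1))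
  obtain t x where x: "regular_seq R x t" "\<forall>i<t. x i \<in> max_ideal R" "\<forall>B. ideal B R \<longrightarrow> J.ext_vanishes t B"
    using J.maximal_regular_seq[OF J(2)] by blast
  have baer: "baer R (seq_ideal R x t) (quot_module R (seq_ideal R x t))"
    by (rule J.quot_regular_seq_baer[OF x(1)]) (use x(3) in blast)
  let ?I = "seq_ideal R x t"
  note I = regular_seq_ideal[OF x(1)]
  have xc: "x i \<in> carrier R" if "i < t" for i by (rule regular_seqD(1)[OF x(1) that])
  have xI: "x i \<in> seq_ideal R x s" if "i < s" "s \<le> t" for i s
    using that
  proof (induction s)
    case (Suc s)
    have I': "ideal (seq_ideal R x s) R" by (rule seq_ideal_ideal) (use Suc.prems xc in simp)
    show ?case
      using Suc adjoin_self[OF I', of "x s"] adjoin_superset[OF I', of "x s"] xc[of s] by (cases "i = s") auto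
  qed simp
  have xq: "regular_seq R (\<lambda>i. x i [^] (p ^ e)) t" by (rule regular_seq_pow[OF x(1)]) (use prime_gt_0_nat[OF p] in simp)
  show ?thesis
  proof (rule extendable_regular_seq[OF x(1,2) baer K _ h])
    fix h v assume h: "linear_on R ?V ?K (quot_module R ?I) h" and v: "v \<in> ?K" "\<And>j. v j \<in> ?I"
    show "h v = \<zero>\<^bsub>quot_module R ?I\<^esub>"
    proof (rule kernel_kill[OF M.module_axioms gc xc _ quot_module_module[OF I], where s = t])
      fix s w assume s: "s < t" and w: "w \<in> carrier ?V"
        and m: "x s \<odot>\<^bsub>?M\<^esub> ?p w \<in> ?p ` {b \<in> carrier ?V. \<forall>j. b j \<in> seq_ideal R x s}"
      have D: "?p ` {b \<in> carrier ?V. \<forall>j. b j \<in> seq_ideal R x s} = seq_ideal R (\<lambda>i. x i [^] (p ^ e)) s"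
        by (rule frobenius_module_seq_ideal[OF _ gen]) (use g xc s in auto)
      have pw: "?p w \<in> carrier R" using linear_onD(1)[OF pD w] by simp
      have "?p w \<otimes> x s [^] (p ^ e) \<in> seq_ideal R (\<lambda>i. x i [^] (p ^ e)) s"
        using m pw xc[OF s] unfolding D by (simp add: m_comm)
      then show "?p w \<in> ?p ` {b \<in> carrier ?V. \<forall>j. b j \<in> seq_ideal R x s}"
        unfolding D by (rule regular_seq_cancel[OF xq s pw])
    next
      fix i Y assume i: "i < t" and Y: "Y \<in> carrier (quot_module R ?I)"
      obtain a where a: "a \<in> carrier R" "Y = ?I +> a" using Y unfolding quot_module_simps(1)[OF I] by blast
      have "x i \<otimes> a \<in> ?I" by (rule ideal_rmult[OF I a(1) xI[OF i order_refl]])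
      then show "x i \<odot>\<^bsub>quot_module R ?I\<^esub> Y = \<zero>\<^bsub>quot_module R ?I\<^esub>"
        using a xc[OF i] coset_eq_zero_iff[OF I, of "x i \<otimes> a"] quot_module_simps(4)[OF I a(1) xc[OF i]] by simp
    next
      show "linear_on R ?V {v \<in> carrier ?V. ?p v = \<zero>\<^bsub>?M\<^esub>} (quot_module R ?I) h" using h by simp
      show "v \<in> carrier ?V" "?p v = \<zero>\<^bsub>?M\<^esub>" using v(1) by auto
      show "v j \<in> ?I" for j by (rule v(2))
    qed simp_all
  qed
qed

text \<open>Surjectivity of Hom(F^e_*R, R) -> Hom(F^e_*R, R/f). On the free module \<phi> lifts to a
  map W, which on the kernel K takes values in fR, say W = f h. An extension u of h corrects W to W
  - f u, which vanishes on K and descends to F^e_*R.\<close>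

lemma lift_frobenius_hom:
  assumes inj: "finite_self_injective_dimension R" and F: "F_finite p R"
    and f: "nonzerodivisor R f"
    and \<phi>: "linear_on R (frobenius_module p e R) (carrier R) (quot_module R (PIdl f)) \<phi>"
  shows "\<exists>\<psi>. linear_on R (frobenius_module p e R) (carrier R) (self_module R) \<psi> \<and>
    (\<forall>y\<in>carrier R. PIdl f +> \<psi> y = \<phi> y)"
proof -
  have fc: "f \<in> carrier R" and fz: "\<And>r. r \<in> carrier R \<Longrightarrow> f \<otimes> r = \<zero> \<Longrightarrow> r = \<zero>"
    using f by (auto simp: nonzerodivisor_def)
  let ?I = "PIdl f"
  have I: "ideal ?I R" by (rule cgenideal_ideal[OF fc])
  let ?Q = "quot_module R ?I" and ?Z = "quot_module R {\<zero>}"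
  note Q = quot_module_module[OF I] and Q0 = quot_module_module[OF zeroideal]
  note q = quot_module_simps[OF I] and q0 = quot_module_simps[OF zeroideal]
  obtain k g where g: "\<forall>i<k. g i \<in> carrier R"
    and gen: "lincomb (frobenius_module p e R) g k ` carrier (free_module R k) = carrier R"
    using frobenius_module_generators[OF F] by blast
  let ?M = "frobenius_module p e R" and ?V = "free_module R k" and ?S = "self_module R"
  let ?p = "lincomb ?M g k"
  let ?K = "{v \<in> carrier ?V. ?p v = \<zero>}"
  interpret M: module R ?M by (rule frobenius_module_module)
  interpret V: module R ?V by (rule free_module_module)
  interpret S: module R ?S by (rule self_module_module)
  have gc: "\<And>i. i < k \<Longrightarrow> g i \<in> carrier ?M" using g by simp
  have pD: "linear_on R ?V (carrier ?V) ?M ?p" by (rule M.lincomb_linear[OF gc])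
  have pc: "?p v \<in> carrier R" if "v \<in> carrier ?V" for v using linear_onD(1)[OF pD that] by simp
  have K: "submodule ?K R ?V"
    using linear_on_kernel_submodule[OF V.module_axioms M.module_axioms V.carrier_is_submodule pD] by simp
  have \<phi>p: "linear_on R ?V (carrier ?V) ?Q (\<lambda>v. \<phi> (?p v))" by (rule linear_on_comp[OF pD \<phi> pc])
  have "\<exists>W. linear_on R ?V (carrier ?V) ?S W \<and> (\<forall>v\<in>carrier ?V. ?I +> W v = \<phi> (?p v))"
  proof (rule free_module_lift[OF S.module_axioms Q _ \<phi>p])
    show "linear_on R ?S (carrier ?S) ?Q (\<lambda>a. ?I +> a)" using coset_linear[OF I] by simp
    show "\<phi> (?p (unit_vector R i)) \<in> (\<lambda>a. ?I +> a) ` carrier ?S" if "i < k" for i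
      using linear_onD(1)[OF \<phi>p unit_vector_carrier[OF that]] unfolding q(1) by simp
  qed
  then obtain W where W: "linear_on R ?V (carrier ?V) ?S W" "\<forall>v\<in>carrier ?V. ?I +> W v = \<phi> (?p v)" by blast
  have Wc: "W v \<in> carrier R" if "v \<in> carrier ?V" for v using linear_onD(1)[OF W(1) that] by simp
  have \<phi>0: "\<phi> \<zero> = \<zero>\<^bsub>?Q\<^esub>"
    using linear_on_zero[OF M.module_axioms Q M.carrier_is_submodule] \<phi> by simp
  have WK: "linear_on R ?V ?K ?S W" by (rule linear_on_subset[OF W(1)]) blast
  have "\<exists>h. linear_on R ?V ?K ?S h \<and> (\<forall>v\<in>?K. f \<odot>\<^bsub>?S\<^esub> h v = W v)"
  proof (rule linear_on_divide[OF V.module_axioms S.module_axioms K WK fc])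
    show "Y = \<zero>\<^bsub>?S\<^esub>" if "Y \<in> carrier ?S" "f \<odot>\<^bsub>?S\<^esub> Y = \<zero>\<^bsub>?S\<^esub>" for Y using fz that by simp
    fix v assume v: "v \<in> ?K"
    then have "?I +> W v = \<zero>\<^bsub>?Q\<^esub>" using W(2) \<phi>0 by simp
    then have "W v \<in> ?I" using coset_eq_zero_iff[OF I Wc] v by simp
    then show "\<exists>Y\<in>carrier ?S. f \<odot>\<^bsub>?S\<^esub> Y = W v" unfolding cgenideal_def using fc by (auto simp: m_comm)
  qed
  then obtain h where h: "linear_on R ?V ?K ?S h" "\<forall>v\<in>?K. f \<otimes> h v = W v" by auto
  have hc: "h v \<in> carrier R" if "v \<in> ?K" for v using linear_onD(1)[OF h(1) that] by simp
  have h0: "linear_on R ?V ?K ?Z (\<lambda>v. {\<zero>} +> h v)"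
    by (rule linear_on_comp[OF h(1) coset_linear[OF zeroideal] hc])
  obtain e' where e': "linear_on R ?V (carrier ?V) ?Z e'" "\<forall>v\<in>?K. {\<zero>} +> h v = e' v"
    using frobenius_kernel_extendable[OF inj g gen h0] unfolding extendable_def by blast
  have "\<exists>u. linear_on R ?V (carrier ?V) ?S u \<and> (\<forall>v\<in>carrier ?V. {\<zero>} +> u v = e' v)"
  proof (rule free_module_lift[OF S.module_axioms Q0 _ e'(1)])
    show "linear_on R ?S (carrier ?S) ?Z (\<lambda>a. {\<zero>} +> a)" using coset_linear[OF zeroideal] by simp
    show "e' (unit_vector R i) \<in> (\<lambda>a. {\<zero>} +> a) ` carrier ?S" if "i < k" for i
      using linear_onD(1)[OF e'(1) unit_vector_carrier[OF that]] unfolding q0(1) by simp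
  qed
  then obtain u where u: "linear_on R ?V (carrier ?V) ?S u" "\<forall>v\<in>carrier ?V. {\<zero>} +> u v = e' v" by blast
  have uc: "u v \<in> carrier R" if "v \<in> carrier ?V" for v using linear_onD(1)[OF u(1) that] by simp
  have uh: "u v = h v" if v: "v \<in> ?K" for v
  proof -
    have "{\<zero>} +> u v = {\<zero>} +> h v" using u(2) e'(2) v by simp
    then have "u v \<ominus> h v = \<zero>" using coset_eq_iff[OF zeroideal uc hc] v by simp
    then show ?thesis using minus_eq_zeroD[OF uc hc] v by simp
  qed
  let ?w = "\<lambda>v. W v \<oplus>\<^bsub>?S\<^esub> (\<ominus> f) \<odot>\<^bsub>?S\<^esub> u v"
  have w: "linear_on R ?V (carrier ?V) ?S ?w" by (rule linear_on_lin[OF S.module_axioms W(1) u(1)]) (use fc in simp)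
  have "\<exists>\<psi>. linear_on R ?M (?p ` carrier ?V) ?S \<psi> \<and> (\<forall>v\<in>carrier ?V. \<psi> (?p v) = ?w v)"
  proof (rule linear_on_factor[OF V.module_axioms M.module_axioms S.module_axioms pD w])
    fix v assume v: "v \<in> carrier ?V" "?p v = \<zero>\<^bsub>?M\<^esub>"
    then have vK: "v \<in> ?K" by simp
    have "f \<otimes> u v = W v" using uh[OF vK] h(2) vK by simp
    then show "?w v = \<zero>\<^bsub>?S\<^esub>" using fc uc[OF v(1)] Wc[OF v(1)] by (simp add: l_minus r_neg)
  qed
  then obtain \<psi> where \<psi>: "linear_on R ?M (carrier R) ?S \<psi>" "\<forall>v\<in>carrier ?V. \<psi> (?p v) = ?w v"
    unfolding gen by blast
  have "?I +> \<psi> y = \<phi> y" if y: "y \<in> carrier R" for y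
  proof -
    obtain v where v: "v \<in> carrier ?V" "y = ?p v" using y gen by blast
    have "\<psi> y \<ominus> W v = (\<ominus> u v) \<otimes> f"
      using \<psi>(2) v fc uc[OF v(1)] Wc[OF v(1)] by simp Ring.algebra
    also have "\<dots> \<in> ?I" unfolding cgenideal_def using uc[OF v(1)] by blast
    finally have "\<psi> y \<ominus> W v \<in> ?I" .
    then have "?I +> \<psi> y = ?I +> W v"
      using coset_eq_iff[OF I _ Wc[OF v(1)], of "\<psi> y"] linear_onD(1)[OF \<psi>(1) y] by simp
    then show ?thesis using W(2) v by simp
  qed
  then show ?thesis using \<psi>(1) by blast
qed

theorem frobenius_splits_lift:
  assumes inj: "finite_self_injective_dimension R" and F: "F_finite p R"
    and f: "nonzerodivisor R f" "f \<in> max_ideal R" and g: "g \<in> carrier R"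
    and split: "frobenius_splits p e (R Quot (PIdl f)) (PIdl f +> g)"
  shows "frobenius_splits p e R (f [^] (p ^ e - 1) \<otimes> g)"
proof -
  have fc: "f \<in> carrier R" and fz: "\<And>r. r \<in> carrier R \<Longrightarrow> f \<otimes> r = \<zero> \<Longrightarrow> r = \<zero>"
    using f by (auto simp: nonzerodivisor_def)
  let ?I = "PIdl f" and ?q = "p ^ e"
  have I: "ideal ?I R" by (rule cgenideal_ideal[OF fc])
  interpret I: ideal ?I R by (rule I)
  let ?R = "R Quot ?I" and ?M = "frobenius_module p e R" and ?S = "self_module R"
  interpret \<pi>: ring_hom_ring R ?R "(+>) ?I" by (rule I.rcos_ring_hom_ring)
  interpret M: module R ?M by (rule frobenius_module_module)
  interpret S: module R ?S by (rule self_module_module)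
  from split obtain \<theta> where \<theta>: "\<theta> \<in> module_hom ?R (frobenius_module p e ?R) (self_module ?R)"
    "\<And>r. r \<in> carrier ?R \<Longrightarrow> \<theta> ((r [^]\<^bsub>?R\<^esub> ?q) \<otimes>\<^bsub>?R\<^esub> (?I +> g)) = r"
    unfolding frobenius_splits_def by (auto simp: frobenius_module_def)
  have \<theta>D: "\<And>x. x \<in> carrier ?R \<Longrightarrow> \<theta> x \<in> carrier ?R"
    "\<And>x y. x \<in> carrier ?R \<Longrightarrow> y \<in> carrier ?R \<Longrightarrow> \<theta> (x \<oplus>\<^bsub>?R\<^esub> y) = \<theta> x \<oplus>\<^bsub>?R\<^esub> \<theta> y"
    "\<And>r x. r \<in> carrier ?R \<Longrightarrow> x \<in> carrier ?R \<Longrightarrow> \<theta> ((r [^]\<^bsub>?R\<^esub> ?q) \<otimes>\<^bsub>?R\<^esub> x) = r \<otimes>\<^bsub>?R\<^esub> \<theta> x"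
    using \<theta>(1) unfolding module_hom_def by (auto simp: frobenius_module_def)
  have "linear_on R ?M (carrier R) (quot_module R ?I) (\<lambda>x. \<theta> (?I +> x))"
    unfolding linear_on_def
  proof (intro conjI ballI)
    fix x assume x: "x \<in> carrier R"
    show "\<theta> (?I +> x) \<in> carrier (quot_module R ?I)" using \<theta>D(1)[of "?I +> x"] x by (simp add: quot_module_def)
    show "\<theta> (?I +> (x \<oplus>\<^bsub>?M\<^esub> y)) = \<theta> (?I +> x) \<oplus>\<^bsub>quot_module R ?I\<^esub> \<theta> (?I +> y)" if y: "y \<in> carrier R" for y
      using \<theta>D(2)[of "?I +> x" "?I +> y"] x y by (simp add: quot_module_def)
    show "\<theta> (?I +> (r \<odot>\<^bsub>?M\<^esub> x)) = r \<odot>\<^bsub>quot_module R ?I\<^esub> \<theta> (?I +> x)" if r: "r \<in> carrier R" for r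
      using \<theta>D(3)[of "?I +> r" "?I +> x"] x r by (simp add: quot_module_def \<pi>.hom_nat_pow)
  qed
  then obtain \<psi> where \<psi>: "linear_on R ?M (carrier R) ?S \<psi>" "\<forall>y\<in>carrier R. ?I +> \<psi> y = \<theta> (?I +> y)"
    using lift_frobenius_hom[OF inj F f(1)] by blast
  have \<psi>c: "\<psi> y \<in> carrier R" if "y \<in> carrier R" for y using linear_onD(1)[OF \<psi>(1) that] by simp
  have cM: "submodule (carrier R) R ?M" using M.carrier_is_submodule by simp
  have \<psi>f: "linear_on R ?M (carrier R) ?S (\<lambda>x. \<psi> (f \<otimes> x))"
    unfolding linear_on_def
  proof (intro conjI ballI)
    fix x assume x: "x \<in> carrier R"
    show "\<psi> (f \<otimes> x) \<in> carrier ?S" using \<psi>c x fc by simp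
    show "\<psi> (f \<otimes> (x \<oplus>\<^bsub>?M\<^esub> y)) = \<psi> (f \<otimes> x) \<oplus>\<^bsub>?S\<^esub> \<psi> (f \<otimes> y)" if y: "y \<in> carrier R" for y
      using linear_onD(2)[OF \<psi>(1), of "f \<otimes> x" "f \<otimes> y"] x y fc by (simp add: r_distr)
    show "\<psi> (f \<otimes> (r \<odot>\<^bsub>?M\<^esub> x)) = r \<odot>\<^bsub>?S\<^esub> \<psi> (f \<otimes> x)" if r: "r \<in> carrier R" for r
      using linear_onD(3)[OF \<psi>(1) r, of "f \<otimes> x"] x r fc by (simp add: m_lcomm)
  qed
  \<comment> \<open>Modulo f the value \<psi>(fx) depends only on the class of fx, which is zero. So
    it is divisible by f, uniquely since f is a nonzerodivisor.\<close>
  have "\<exists>\<chi>. linear_on R ?M (carrier R) ?S \<chi> \<and> (\<forall>x\<in>carrier R. f \<odot>\<^bsub>?S\<^esub> \<chi> x = \<psi> (f \<otimes> x))"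
  proof (rule linear_on_divide[OF M.module_axioms S.module_axioms cM \<psi>f fc])
    show "Y = \<zero>\<^bsub>?S\<^esub>" if "Y \<in> carrier ?S" "f \<odot>\<^bsub>?S\<^esub> Y = \<zero>\<^bsub>?S\<^esub>" for Y using fz that by simp
    fix x assume x: "x \<in> carrier R"
    have "x \<otimes> f \<in> ?I" unfolding cgenideal_def using x by blast
    then have "f \<otimes> x \<in> ?I" using x fc by (simp add: m_comm)
    then have z: "?I +> (f \<otimes> x) = ?I +> \<zero>" using coset_eq_iff[OF I, of "f \<otimes> x" \<zero>] x fc by (simp add: a_minus_def)
    have "?I +> \<psi> (f \<otimes> x) = \<theta> (?I +> \<zero>)" using \<psi>(2) x fc z by simp
    also have "\<dots> = ?I +> \<psi> \<zero>" using \<psi>(2) by simp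
    also have "\<psi> \<zero> = \<zero>" using linear_on_zero[OF M.module_axioms S.module_axioms cM \<psi>(1)] by simp
    finally have "\<psi> (f \<otimes> x) \<in> ?I" using coset_eq_iff[OF I, of "\<psi> (f \<otimes> x)" \<zero>] \<psi>c x fc by (simp add: a_minus_def)
    then show "\<exists>Y\<in>carrier ?S. f \<odot>\<^bsub>?S\<^esub> Y = \<psi> (f \<otimes> x)" unfolding cgenideal_def using fc by (auto simp: m_comm)
  qed
  then obtain \<chi> where \<chi>: "linear_on R ?M (carrier R) ?S \<chi>" "\<And>x. x \<in> carrier R \<Longrightarrow> f \<otimes> \<chi> x = \<psi> (f \<otimes> x)" by auto
  have \<chi>c: "\<chi> y \<in> carrier R" if "y \<in> carrier R" for y using linear_onD(1)[OF \<chi>(1) that] by simp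
  let ?g = "f [^] (?q - 1) \<otimes> g"
  have gc: "?g \<in> carrier R" using fc g by simp
  have q1: "?q = Suc (?q - 1)" using prime_gt_0_nat[OF p] by simp
  have "\<psi> g = \<chi> ?g"
  proof -
    have "f [^] ?q = f [^] (?q - 1) \<otimes> f" by (subst q1) simp
    then have "f \<otimes> ?g = f [^] ?q \<otimes> g" using fc g by (simp add: m_ac)
    then have "f \<otimes> \<chi> ?g = f \<otimes> \<psi> g" using \<chi>(2)[OF gc] linear_onD(3)[OF \<psi>(1) fc g] by simp
    then have "f \<otimes> (\<chi> ?g \<ominus> \<psi> g) = \<zero>"
      using fc \<chi>c[OF gc] \<psi>c[OF g] by (simp add: a_minus_def r_distr r_minus r_neg)
    then have "\<chi> ?g \<ominus> \<psi> g = \<zero>" using fz \<chi>c[OF gc] \<psi>c[OF g] by simp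
    then show ?thesis using minus_eq_zeroD[OF \<chi>c[OF gc] \<psi>c[OF g]] by simp
  qed
  have "?I +> \<psi> g = ?I +> \<one>"
  proof -
    have "?I +> \<psi> g = \<theta> ((\<one>\<^bsub>?R\<^esub> [^]\<^bsub>?R\<^esub> ?q) \<otimes>\<^bsub>?R\<^esub> (?I +> g))" using \<psi>(2) g by simp
    also have "\<dots> = \<one>\<^bsub>?R\<^esub>" by (rule \<theta>(2)) simp
    finally show ?thesis by simp
  qed
  then have "\<one> \<ominus> \<psi> g \<in> ?I" using coset_eq_iff[OF I one_closed \<psi>c[OF g]] by simp
  then have m: "\<one> \<ominus> \<psi> g \<in> max_ideal R" using cgenideal_minimal[OF max_ideal_ideal f(2)] by blast
  \<comment> \<open>The value \<psi>(g) is 1 modulo f, hence a unit because f lies in the maximal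
    ideal. Its inverse b turns \<chi> into a splitting.\<close>
  obtain b where b: "b \<in> carrier R" "b \<otimes> (\<one> \<ominus> (\<one> \<ominus> \<psi> g)) = \<one>" by (rule one_minus_max_ideal_unit[OF m])
  have "\<one> \<ominus> (\<one> \<ominus> \<psi> g) = \<psi> g" using \<psi>c[OF g] by Ring.algebra
  then have b1: "b \<otimes> \<chi> ?g = \<one>" using b(2) \<open>\<psi> g = \<chi> ?g\<close> by simp
  let ?\<Theta> = "\<lambda>x. b \<otimes> \<chi> x"
  have "linear_on R ?M (carrier R) ?S ?\<Theta>"
    unfolding linear_on_def
  proof (intro conjI ballI)
    fix x assume x: "x \<in> carrier R"
    show "?\<Theta> x \<in> carrier ?S" using \<chi>c x b by simp
    show "?\<Theta> (x \<oplus>\<^bsub>?M\<^esub> y) = ?\<Theta> x \<oplus>\<^bsub>?S\<^esub> ?\<Theta> y" if y: "y \<in> carrier R" for y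
      using linear_onD(2)[OF \<chi>(1) x y] x y b \<chi>c by (simp add: r_distr)
    show "?\<Theta> (r \<odot>\<^bsub>?M\<^esub> x) = r \<odot>\<^bsub>?S\<^esub> ?\<Theta> x" if r: "r \<in> carrier R" for r
      using linear_onD(3)[OF \<chi>(1) r x] x r b \<chi>c by (simp add: m_lcomm)
  qed
  then have "?\<Theta> \<in> module_hom R ?M ?S" using linear_on_module_hom[of R ?M ?S ?\<Theta>] by simp
  moreover have "\<forall>r\<in>carrier R. ?\<Theta> (r \<odot>\<^bsub>?M\<^esub> ?g) = r"
  proof
    fix r assume r: "r \<in> carrier R"
    have "?\<Theta> (r \<odot>\<^bsub>?M\<^esub> ?g) = b \<otimes> (r \<otimes> \<chi> ?g)" using linear_onD(3)[OF \<chi>(1) r gc] by simp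
    also have "\<dots> = r \<otimes> (b \<otimes> \<chi> ?g)" by (rule m_lcomm[OF b(1) r \<chi>c[OF gc]])
    also have "\<dots> = r" using b1 r by simp
    finally show "?\<Theta> (r \<odot>\<^bsub>?M\<^esub> ?g) = r" .
  qed
  ultimately show ?thesis unfolding frobenius_splits_def by (intro bexI[of _ ?\<Theta>])
qed

end

section \<open>Quotients by an ideal and Krull dimension\<close>

context cring
begin

lemma quot_ring_simps:
  assumes I: "ideal I R"
  shows "carrier (R Quot I) = (\<lambda>a. I +> a) ` carrier R"
    "\<zero>\<^bsub>R Quot I\<^esub> = I +> \<zero>" "\<one>\<^bsub>R Quot I\<^esub> = I +> \<one>"
    "a \<in> carrier R \<Longrightarrow> b \<in> carrier R \<Longrightarrow> (I +> a) \<oplus>\<^bsub>R Quot I\<^esub> (I +> b) = I +> (a \<oplus> b)"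
    "a \<in> carrier R \<Longrightarrow> b \<in> carrier R \<Longrightarrow> (I +> a) \<otimes>\<^bsub>R Quot I\<^esub> (I +> b) = I +> (a \<otimes> b)"
proof -
  interpret I: ideal I R by (rule I)
  note hom = I.rcos_ring_hom
  show "carrier (R Quot I) = (\<lambda>a. I +> a) ` carrier R" "\<zero>\<^bsub>R Quot I\<^esub> = I +> \<zero>"
    using quot_module_simps(1,2)[OF I] by (simp_all add: quot_module_def)
  show "\<one>\<^bsub>R Quot I\<^esub> = I +> \<one>" using ring_hom_one[OF hom] by simp
  show "a \<in> carrier R \<Longrightarrow> b \<in> carrier R \<Longrightarrow> (I +> a) \<oplus>\<^bsub>R Quot I\<^esub> (I +> b) = I +> (a \<oplus> b)"
    using ring_hom_add[OF hom] by simp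
  show "a \<in> carrier R \<Longrightarrow> b \<in> carrier R \<Longrightarrow> (I +> a) \<otimes>\<^bsub>R Quot I\<^esub> (I +> b) = I +> (a \<otimes> b)"
    using ring_hom_mult[OF hom] by simp
qed

lemma quot_cring: "ideal I R \<Longrightarrow> cring (R Quot I)"
  by (rule ideal.quotient_is_cring[OF _ is_cring])

lemma coset_image_iff:
  assumes I: "ideal I R" and P: "ideal P R" and IP: "I \<subseteq> P" and a: "a \<in> carrier R"
  shows "I +> a \<in> (\<lambda>a. I +> a) ` P \<longleftrightarrow> a \<in> P"
proof
  assume "I +> a \<in> (\<lambda>a. I +> a) ` P"
  then obtain b where b: "b \<in> P" "I +> a = I +> b" by blast
  then have "a \<ominus> b \<in> P" using coset_eq_iff[OF I a ideal_carrier[OF P b(1)]] IP by blast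
  then show "a \<in> P" using minus_swap[OF P a ideal_carrier[OF P b(1)]] b(1) by blast
qed blast

lemma coset_image_ideal:
  assumes I: "ideal I R" and P: "ideal P R"
  shows "ideal ((\<lambda>a. I +> a) ` P) (R Quot I)"
proof -
  note q = quot_ring_simps[OF I]
  note Pc = ideal_carrier[OF P]
  interpret Q: cring "R Quot I" by (rule quot_cring[OF I])
  show ?thesis
  proof (rule Q.cring_idealI)
    show "(\<lambda>a. I +> a) ` P \<subseteq> carrier (R Quot I)" using q(1) ideal_subset[OF P] by blast
    show "\<zero>\<^bsub>R Quot I\<^esub> \<in> (\<lambda>a. I +> a) ` P" using q(2) ideal_zero[OF P] by blast
    show "x \<oplus>\<^bsub>R Quot I\<^esub> y \<in> (\<lambda>a. I +> a) ` P" if "x \<in> (\<lambda>a. I +> a) ` P" "y \<in> (\<lambda>a. I +> a) ` P" for x y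
      using that q(4) Pc ideal_add[OF P] by auto
    show "r \<otimes>\<^bsub>R Quot I\<^esub> x \<in> (\<lambda>a. I +> a) ` P" if "r \<in> carrier (R Quot I)" "x \<in> (\<lambda>a. I +> a) ` P" for r x
      using that q(5) Pc ideal_lmult[OF P] unfolding q(1) by auto
  qed
qed

lemma coset_image_prime:
  assumes I: "ideal I R" and P: "primeideal P R" and IP: "I \<subseteq> P"
  shows "primeideal ((\<lambda>a. I +> a) ` P) (R Quot I)"
proof -
  note q = quot_ring_simps[OF I]
  note iP = primeideal.axioms(1)[OF P]
  note iff = coset_image_iff[OF I iP IP]
  show ?thesis
  proof (rule primeidealI[OF coset_image_ideal[OF I iP] quot_cring[OF I]])
    show "carrier (R Quot I) \<noteq> (\<lambda>a. I +> a) ` P"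
      using iff[OF one_closed] prime_one_notin[OF P] unfolding q(1) by blast
    fix x y assume xy: "x \<in> carrier (R Quot I)" "y \<in> carrier (R Quot I)" "x \<otimes>\<^bsub>R Quot I\<^esub> y \<in> (\<lambda>a. I +> a) ` P"
    then obtain a b where ab: "a \<in> carrier R" "b \<in> carrier R" "x = I +> a" "y = I +> b" unfolding q(1) by blast
    then have "a \<otimes> b \<in> P" using xy(3) q(5) iff[of "a \<otimes> b"] by simp
    then show "x \<in> (\<lambda>a. I +> a) ` P \<or> y \<in> (\<lambda>a. I +> a) ` P"
      using primeideal.I_prime[OF P ab(1,2)] ab(3,4) by blast
  qed
qed

lemma krull_dim_quot_ge:
  assumes I: "ideal I R" and Q: "\<forall>i\<le>n. primeideal (Q i) R \<and> I \<subseteq> Q i" "\<forall>i<n. Q i \<subset> Q (Suc i)"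
  shows "enat n \<le> krull_dim (R Quot I)"
proof -
  let ?P = "\<lambda>i. (\<lambda>a. I +> a) ` Q i"
  have "\<forall>i\<le>n. primeideal (?P i) (R Quot I)" using coset_image_prime[OF I] Q(1) by simp
  moreover have "?P i \<subset> ?P (Suc i)" if i: "i < n" for i
  proof -
    have Qi: "primeideal (Q i) R" "I \<subseteq> Q i" "primeideal (Q (Suc i)) R" using Q(1) i by auto
    obtain a where a: "a \<in> Q (Suc i)" "a \<notin> Q i" using Q(2) i by blast
    have "a \<in> carrier R" by (rule ideal_carrier[OF primeideal.axioms(1)[OF Qi(3)] a(1)])
    then have "I +> a \<notin> ?P i" using coset_image_iff[OF I primeideal.axioms(1)[OF Qi(1)] Qi(2)] a(2) by blast
    moreover have "I +> a \<in> ?P (Suc i)" using a(1) by blast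
    moreover have "?P i \<subseteq> ?P (Suc i)" using Q(2) i by blast
    ultimately show ?thesis by blast
  qed
  then have "\<forall>i<n. ?P i \<subset> ?P (Suc i)" by simp
  ultimately show ?thesis unfolding krull_dim_def by (intro SUP_upper CollectI exI[of _ ?P] conjI)
qed

lemma ideal_power_ideal: "ideal I R \<Longrightarrow> ideal (ideal_power R I n) R"
  by (induction n) (auto simp: oneideal ideal_prod_is_ideal)

lemma ideal_power_mult:
  assumes I: "ideal I R"
  shows "a \<in> ideal_power R I m \<Longrightarrow> b \<in> ideal_power R I n \<Longrightarrow> a \<otimes> b \<in> ideal_power R I (m + n)"
proof (induction m arbitrary: a)
  case 0
  then show ?case using ideal_lmult[OF ideal_power_ideal[OF I]] by simp
next
  case (Suc m)
  have bc: "b \<in> carrier R" by (rule ideal_carrier[OF ideal_power_ideal[OF I] Suc.prems(2)])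
  note P = ideal_power_ideal[OF I]
  from Suc.prems(1) have "a \<in> ideal_prod R I (ideal_power R I m)" by simp
  then show ?case
  proof (induction a rule: ideal_prod.induct)
    case (prod i j)
    have "j \<otimes> b \<in> ideal_power R I (m + n)" by (rule Suc.IH[OF prod(2) Suc.prems(2)])
    then have "i \<otimes> (j \<otimes> b) \<in> ideal_power R I (Suc m + n)" using prod(1) by (auto intro: ideal_prod.prod)
    then show ?case using ideal_carrier[OF I prod(1)] ideal_carrier[OF P prod(2)] bc by (simp add: m_assoc)
  next
    case (sum s1 s2)
    have "s1 \<in> carrier R" "s2 \<in> carrier R"
      using sum(1,2) ideal_carrier[OF ideal_prod_is_ideal[OF I P]] by blast+
    then show ?case using ideal_add[OF P sum(3,4)] bc by (simp add: l_distr)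
  qed
qed

lemma ideal_power_nat_pow:
  assumes I: "ideal I R" and a: "a \<in> ideal_power R I m"
  shows "a [^] (n::nat) \<in> ideal_power R I (m * n)"
proof (induction n)
  case (Suc n)
  have "a [^] n \<otimes> a \<in> ideal_power R I (m * n + m)" by (rule ideal_power_mult[OF I Suc a])
  then show ?case by (simp add: add.commute)
qed simp

lemma ideal_power_quot:
  assumes I: "ideal I R" and M: "ideal M R"
  shows "h \<in> ideal_power (R Quot I) ((\<lambda>a. I +> a) ` M) n \<Longrightarrow> \<exists>g\<in>ideal_power R M n. h = I +> g"
proof (induction n arbitrary: h)
  case 0
  then show ?case using quot_ring_simps(1)[OF I] by auto
next
  case (Suc n)
  note q = quot_ring_simps[OF I]
  note P = ideal_power_ideal[OF M]
  from Suc.prems have "h \<in> ideal_prod (R Quot I) ((\<lambda>a. I +> a) ` M) (ideal_power (R Quot I) ((\<lambda>a. I +> a) ` M) n)" by simp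
  then show ?case
  proof (induction h rule: ideal_prod.induct)
    case (prod i j)
    obtain a where a: "a \<in> M" "i = I +> a" using prod(1) by blast
    obtain b where b: "b \<in> ideal_power R M n" "j = I +> b" using Suc.IH[OF prod(2)] by blast
    have "i \<otimes>\<^bsub>R Quot I\<^esub> j = I +> (a \<otimes> b)"
      using q(5) a b ideal_carrier[OF M a(1)] ideal_carrier[OF P b(1)] by simp
    moreover have "a \<otimes> b \<in> ideal_power R M (Suc n)" using a(1) b(1) by (auto intro: ideal_prod.prod)
    ultimately show ?case by blast
  next
    case (sum s1 s2)
    then obtain a b where ab: "a \<in> ideal_power R M (Suc n)" "s1 = I +> a" "b \<in> ideal_power R M (Suc n)" "s2 = I +> b" by blast
    have "s1 \<oplus>\<^bsub>R Quot I\<^esub> s2 = I +> (a \<oplus> b)"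
      using q(4) ab(2,4) ideal_carrier[OF P ab(1)] ideal_carrier[OF P ab(3)] by simp
    then show ?case using ideal_add[OF P ab(1,3)] by blast
  qed
qed

end

context local_noetherian_cring
begin

text \<open>\<open>max_ideal\<close> is a definite description, so uniqueness is part of the proof:
  the preimage in R of a proper ideal of R/I is proper and lies in the maximal ideal.\<close>

lemma quot_max_ideal:
  assumes I: "ideal I R" "I \<subseteq> max_ideal R"
  shows "max_ideal (R Quot I) = (\<lambda>a. I +> a) ` max_ideal R"
proof -
  let ?M = "(\<lambda>a. I +> a) ` max_ideal R"
  note q = quot_ring_simps[OF I(1)]
  interpret Q: cring "R Quot I" by (rule quot_cring[OF I(1)])
  have M: "ideal ?M (R Quot I)" by (rule coset_image_ideal[OF I(1) max_ideal_ideal])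
  have Mne: "carrier (R Quot I) \<noteq> ?M"
    using primeideal.I_notcarr[OF coset_image_prime[OF I(1) max_ideal_prime I(2)]] .
  have sub: "L \<subseteq> ?M" if L: "ideal L (R Quot I)" "L \<noteq> carrier (R Quot I)" for L
  proof -
    let ?P = "{a \<in> carrier R. I +> a \<in> L}"
    have "ideal ?P R"
    proof (rule cring_idealI)
      show "\<zero> \<in> ?P" using ideal_zero[OF L(1)] q(2) by simp
      show "x \<oplus> y \<in> ?P" if "x \<in> ?P" "y \<in> ?P" for x y
        using that ideal_add[OF L(1), of "I +> x" "I +> y"] q(4) by simp
      show "r \<otimes> x \<in> ?P" if "r \<in> carrier R" "x \<in> ?P" for r x
        using that ideal_lmult[OF L(1), of "I +> r" "I +> x"] q(1,5) by simp
    qed auto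
    moreover have "?P \<noteq> carrier R"
    proof
      assume "?P = carrier R"
      then have "carrier (R Quot I) \<subseteq> L" unfolding q(1) by blast
      then show False using L ideal_subset[OF L(1)] by blast
    qed
    ultimately have "?P \<subseteq> max_ideal R" by (rule proper_ideal_subset)
    then show ?thesis using ideal_subset[OF L(1)] unfolding q(1) by blast
  qed
  have "maximalideal ?M (R Quot I)"
  proof (rule maximalidealI[OF M Mne])
    show "L = ?M \<or> L = carrier (R Quot I)" if "ideal L (R Quot I)" "?M \<subseteq> L" for L using sub[OF that(1)] that(2) by blast
  qed
  moreover have "L = ?M" if "maximalideal L (R Quot I)" for L
  proof -
    have "L \<subseteq> ?M" using sub[OF maximalideal.axioms(1)[OF that]] maximalideal.I_notcarr[OF that] by blast
    then show ?thesis using maximalideal.I_maximal[OF that M] ideal_subset[OF M] Mne by blast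
  qed
  ultimately show ?thesis unfolding max_ideal_def by (rule the_equality)
qed

text \<open>If the top of a chain contains f, pushing f down the chain costs one prime. If it does
  not, the maximal ideal can first be put on top, and nothing is lost.\<close>

lemma krull_dim_le_quot:
  assumes f: "f \<in> max_ideal R"
  shows "krull_dim R \<le> eSuc (krull_dim (R Quot (PIdl f)))"
  unfolding krull_dim_def[of R]
proof (rule SUP_least)
  have fc: "f \<in> carrier R" by (rule ideal_carrier[OF max_ideal_ideal f])
  have I: "ideal (PIdl f) R" by (rule cgenideal_ideal[OF fc])
  have bound: "enat n \<le> krull_dim (R Quot (PIdl f))"
    if P: "\<forall>i\<le>Suc n. primeideal (P i) R" "\<forall>i\<le>n. P i \<subset> P (Suc i)" "f \<in> P (Suc n)" for P n
  proof -
    obtain Q where Q: "\<forall>i\<le>n. primeideal (Q i) R \<and> f \<in> Q i" "\<forall>i<n. Q i \<subset> Q (Suc i)"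
      using prime_chain_containing[OF P] by blast
    have "\<forall>i\<le>n. primeideal (Q i) R \<and> PIdl f \<subseteq> Q i"
    proof (intro allI impI conjI)
      fix i assume "i \<le> n"
      then have q: "primeideal (Q i) R" "f \<in> Q i" using Q(1) by (simp_all only:)
      show "primeideal (Q i) R" by (rule q(1))
      show "PIdl f \<subseteq> Q i" by (rule cgenideal_minimal[OF primeideal.axioms(1)[OF q(1)] q(2)])
    qed
    then show ?thesis by (rule krull_dim_quot_ge[OF I _ Q(2)])
  qed
  fix n assume "n \<in> {n. \<exists>P. (\<forall>i\<le>n. primeideal (P i) R) \<and> (\<forall>i<n. P i \<subset> P (Suc i))}"
  then obtain P where P: "\<forall>i\<le>n. primeideal (P i) R" "\<forall>i<n. P i \<subset> P (Suc i)" by blast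
  show "enat n \<le> eSuc (krull_dim (R Quot (PIdl f)))"
  proof (cases "f \<in> P n")
    case True
    show ?thesis
    proof (cases n)
      case (Suc m)
      have "enat m \<le> krull_dim (R Quot (PIdl f))"
        by (rule bound[of m P]) (use P True Suc in auto)
      then show ?thesis unfolding Suc eSuc_enat[symmetric] by simp
    qed (simp add: zero_enat_def[symmetric])
  next
    case False
    have Pn: "primeideal (P n) R" using P(1) by blast
    have "P n \<subseteq> max_ideal R"
      using proper_ideal_subset[OF primeideal.axioms(1)[OF Pn]] primeideal.I_notcarr[OF Pn] by blast
    then have lt: "P n \<subset> max_ideal R" using f False by blast
    have "enat n \<le> krull_dim (R Quot (PIdl f))"
    proof (rule bound[of n "P(Suc n := max_ideal R)"])
      show "\<forall>i\<le>Suc n. primeideal ((P(Suc n := max_ideal R)) i) R"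
        using P(1) max_ideal_prime by (simp add: le_Suc_eq)
      show "\<forall>i\<le>n. (P(Suc n := max_ideal R)) i \<subset> (P(Suc n := max_ideal R)) (Suc i)"
      proof (intro allI impI)
        fix i assume "i \<le> n"
        then show "(P(Suc n := max_ideal R)) i \<subset> (P(Suc n := max_ideal R)) (Suc i)"
          using P(2) lt by (cases "i = n") simp_all
      qed
    qed (use f in simp)
    then show ?thesis using ile_eSuc order_trans by blast
  qed
qed

end

section \<open>F-pure thresholds\<close>

context char_p_local_cring
begin

text \<open>A splitting \<theta> for ag gives the splitting x -> \<theta>(ax) for g. With a =
  f^(p-1) and g = 1 this turns the lifted splitting into F-purity of R.\<close>

lemma frobenius_splits_factor:
  assumes a: "a \<in> carrier R" and g: "g \<in> carrier R" and split: "frobenius_splits p e R (a \<otimes> g)"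
  shows "frobenius_splits p e R g"
proof -
  let ?M = "frobenius_module p e R"
  from split obtain \<theta> where \<theta>: "\<theta> \<in> module_hom R ?M (self_module R)"
    "\<forall>r\<in>carrier R. \<theta> (r \<odot>\<^bsub>?M\<^esub> (a \<otimes> g)) = r" unfolding frobenius_splits_def by blast
  have l: "linear_on R ?M (carrier R) (self_module R) \<theta>" using \<theta>(1) linear_on_module_hom[of R ?M "self_module R" \<theta>] by simp
  have "linear_on R ?M (carrier R) (self_module R) (\<lambda>x. \<theta> (a \<otimes> x))"
    unfolding linear_on_def
  proof (intro conjI ballI)
    fix x assume x: "x \<in> carrier R"
    show "\<theta> (a \<otimes> x) \<in> carrier (self_module R)" using linear_onD(1)[OF l, of "a \<otimes> x"] x a by simp
    show "\<theta> (a \<otimes> (x \<oplus>\<^bsub>?M\<^esub> y)) = \<theta> (a \<otimes> x) \<oplus>\<^bsub>self_module R\<^esub> \<theta> (a \<otimes> y)" if y: "y \<in> carrier R" for y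
      using linear_onD(2)[OF l, of "a \<otimes> x" "a \<otimes> y"] x y a by (simp add: r_distr)
    show "\<theta> (a \<otimes> (r \<odot>\<^bsub>?M\<^esub> x)) = r \<odot>\<^bsub>self_module R\<^esub> \<theta> (a \<otimes> x)" if r: "r \<in> carrier R" for r
      using linear_onD(3)[OF l r, of "a \<otimes> x"] x r a by (simp add: m_lcomm)
  qed
  then have h: "(\<lambda>x. \<theta> (a \<otimes> x)) \<in> module_hom R ?M (self_module R)"
    using linear_on_module_hom[of R ?M "self_module R" "\<lambda>x. \<theta> (a \<otimes> x)"] by simp
  have "\<forall>r\<in>carrier R. \<theta> (a \<otimes> (r \<odot>\<^bsub>?M\<^esub> g)) = r"
  proof
    fix r assume r: "r \<in> carrier R"
    have "a \<otimes> (r \<odot>\<^bsub>?M\<^esub> g) = r \<odot>\<^bsub>?M\<^esub> (a \<otimes> g)" using r a g by (simp add: m_lcomm)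
    then show "\<theta> (a \<otimes> (r \<odot>\<^bsub>?M\<^esub> g)) = r" using \<theta>(2) r by simp
  qed
  then show ?thesis unfolding frobenius_splits_def using h by (intro bexI[of _ "\<lambda>x. \<theta> (a \<otimes> x)"])
qed

lemma F_pure_lift:
  assumes "finite_self_injective_dimension R" "F_finite p R" "nonzerodivisor R f" "f \<in> max_ideal R"
    and "F_pure p (R Quot (PIdl f))"
  shows "F_pure p R"
proof -
  have fc: "f \<in> carrier R" by (rule ideal_carrier[OF max_ideal_ideal assms(4)])
  have "\<one>\<^bsub>R Quot (PIdl f)\<^esub> = PIdl f +> \<one>" by (rule quot_ring_simps(3)[OF cgenideal_ideal[OF fc]])
  then have "frobenius_splits p 1 (R Quot (PIdl f)) (PIdl f +> \<one>)" using assms(5) by (simp add: F_pure_def)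
  then have "frobenius_splits p 1 R (f [^] (p ^ 1 - 1) \<otimes> \<one>)"
    by (rule frobenius_splits_lift[OF assms(1-4) one_closed])
  then show ?thesis unfolding F_pure_def by (rule frobenius_splits_factor[rotated 2]) (use fc in auto)
qed

text \<open>With q = p^e, the splitting element f^(q-1) g lies in the power with exponent i(q-1) +
  floor(l(q-1)). As i(q-1) is an integer this is floor((l+i)(q-1)) exactly, so each e that works for
  R/f works for R.\<close>

lemma F_pure_pair_lift:
  assumes inj: "finite_self_injective_dimension R" and F: "F_finite p R"
    and f: "nonzerodivisor R f" "f \<in> max_ideal R" "f \<in> ideal_power R (max_ideal R) i"
    and l: "0 \<le> l" "F_pure_pair p (R Quot (PIdl f)) l"
  shows "F_pure_pair p R (l + real i)"
proof -
  let ?I = "PIdl f" and ?m = "max_ideal R"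
  have fc: "f \<in> carrier R" by (rule ideal_carrier[OF max_ideal_ideal f(2)])
  have I: "ideal ?I R" by (rule cgenideal_ideal[OF fc])
  have M: "max_ideal (R Quot ?I) = (\<lambda>a. ?I +> a) ` ?m"
    by (rule quot_max_ideal[OF I cgenideal_minimal[OF max_ideal_ideal f(2)]])
  have "\<exists>g\<in>ideal_power R ?m (nat \<lfloor>(l + real i) * (real p ^ e - 1)\<rfloor>). frobenius_splits p e R g"
    if e: "\<exists>h\<in>ideal_power (R Quot ?I) (max_ideal (R Quot ?I)) (nat \<lfloor>l * (real p ^ e - 1)\<rfloor>). frobenius_splits p e (R Quot ?I) h" for e
  proof -
    let ?n = "nat \<lfloor>l * (real p ^ e - 1)\<rfloor>" and ?q = "p ^ e"
    obtain h where h: "h \<in> ideal_power (R Quot ?I) (max_ideal (R Quot ?I)) ?n" "frobenius_splits p e (R Quot ?I) h"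
      using e by blast
    obtain g where g: "g \<in> ideal_power R ?m ?n" "h = ?I +> g"
      using ideal_power_quot[OF I max_ideal_ideal h(1)[unfolded M]] by blast
    have gc: "g \<in> carrier R" by (rule ideal_carrier[OF ideal_power_ideal[OF max_ideal_ideal] g(1)])
    have "f [^] (?q - 1) \<otimes> g \<in> ideal_power R ?m (i * (?q - 1) + ?n)"
      by (rule ideal_power_mult[OF max_ideal_ideal ideal_power_nat_pow[OF max_ideal_ideal f(3)] g(1)])
    moreover have "frobenius_splits p e R (f [^] (?q - 1) \<otimes> g)"
      by (rule frobenius_splits_lift[OF inj F f(1,2) gc]) (use h(2) g(2) in simp)
    moreover have "nat \<lfloor>(l + real i) * (real p ^ e - 1)\<rfloor> = i * (?q - 1) + ?n"
    proof -
      have "?q \<ge> 1" using prime_gt_0_nat[OF p] by simp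
      then have q: "real p ^ e - 1 = real (?q - 1)" by (simp add: of_nat_diff)
      have "(l + real i) * real (?q - 1) = l * real (?q - 1) + of_int (int (i * (?q - 1)))"
        by (simp only: distrib_right of_int_of_nat_eq of_nat_mult of_int_mult)
      then have "\<lfloor>(l + real i) * real (?q - 1)\<rfloor> = \<lfloor>l * real (?q - 1)\<rfloor> + int (i * (?q - 1))"
        by (simp only: floor_add_int)
      moreover have "\<lfloor>l * real (?q - 1)\<rfloor> \<ge> 0" using l(1) by simp
      ultimately show ?thesis unfolding q by (simp add: nat_add_distrib nat_mult_distrib)
    qed
    ultimately show ?thesis by auto
  qed
  then show ?thesis using l(2) unfolding F_pure_pair_def by (rule eventually_mono[rotated])
qed

lemma fpt_lift:
  assumes "finite_self_injective_dimension R" "F_finite p R"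
    "nonzerodivisor R f" "f \<in> max_ideal R" "f \<in> ideal_power R (max_ideal R) i"
    "0 \<le> l" "F_pure_pair p (R Quot (PIdl f)) l"
  shows "ereal l + ereal (real i) \<le> fpt p R"
proof -
  have "l + real i \<in> {l. 0 \<le> l \<and> F_pure_pair p R l}" using F_pure_pair_lift[OF assms] assms(6) by simp
  then have "ereal (l + real i) \<le> fpt p R" unfolding fpt_def by (rule SUP_upper)
  then show ?thesis by simp
qed

text \<open>The order is a supremum, so each exponent i with f in the i-th power is bounded
  separately. If the threshold of R is a real number r, every such i is at most r - l, which also
  shows that the order is finite.\<close>

lemma fpt_quot_le:
  assumes h: "finite_self_injective_dimension R" "F_finite p R" "nonzerodivisor R f" "f \<in> max_ideal R"
  shows "fpt p (R Quot (PIdl f)) \<le> fpt p R - ereal_of_enat (ord_at_max R f)"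
  unfolding fpt_def[of p "R Quot (PIdl f)"]
proof (rule SUP_least)
  fix l assume "l \<in> {l. 0 \<le> l \<and> F_pure_pair p (R Quot (PIdl f)) l}"
  then have l: "0 \<le> l" "F_pure_pair p (R Quot (PIdl f)) l" by auto
  have b: "ereal l + ereal (real i) \<le> fpt p R" if "f \<in> ideal_power R (max_ideal R) i" for i
    by (rule fpt_lift[OF h that l])
  have fc: "f \<in> carrier R" by (rule ideal_carrier[OF max_ideal_ideal h(4)])
  have b0: "ereal l \<le> fpt p R" using b[of 0] fc by simp
  show "ereal l \<le> fpt p R - ereal_of_enat (ord_at_max R f)"
  proof (cases "fpt p R")
    case (real r)
    have "ord_at_max R f \<le> enat (nat \<lfloor>r - l\<rfloor>)"
      unfolding ord_at_max_def
    proof (rule SUP_least)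
      fix i assume "i \<in> {i. f \<in> ideal_power R (max_ideal R) i}"
      then have "l + real i \<le> r" using b[of i] real by simp
      then have "real i \<le> r - l" by simp
      then have "int i \<le> \<lfloor>r - l\<rfloor>" by (simp add: le_floor_iff)
      then show "enat i \<le> enat (nat \<lfloor>r - l\<rfloor>)" by simp
    qed
    then obtain N where N: "ord_at_max R f = enat N" "N \<le> nat \<lfloor>r - l\<rfloor>" by (cases "ord_at_max R f") auto
    have "0 \<le> r - l" using b0 real by simp
    then have "real (nat \<lfloor>r - l\<rfloor>) \<le> r - l" by simp
    then have "real N \<le> r - l" using N(2) of_nat_mono[OF N(2), where 'a = real] by linarith
    then show ?thesis using N(1) real by simp
  next
    \<comment> \<open>In \<open>ereal\<close> the difference \<infinity> - \<infinity> is
      \<infinity>, so the bound holds for every value of the order.\<close>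
    case PInf
    then show ?thesis by (cases "ereal_of_enat (ord_at_max R f)") simp_all
  next
    case MInf
    then show ?thesis using b0 by simp
  qed
qed

text \<open>The exponent i = 1 gives fpt(R/f) + 1 \<le> fpt(R) for every f in the maximal ideal.
  This gain of one compensates the drop of at most one in the dimension; infinite values are covered
  by the final case split.\<close>

lemma dfpt_le_quot:
  assumes h: "finite_self_injective_dimension R" "F_finite p R" "nonzerodivisor R f" "f \<in> max_ideal R"
  shows "dfpt p R \<le> dfpt p (R Quot (PIdl f))"
proof -
  have fc: "f \<in> carrier R" by (rule ideal_carrier[OF max_ideal_ideal h(4)])
  let ?t = "fpt p R" and ?s = "fpt p (R Quot (PIdl f))"
  let ?a = "ereal_of_enat (krull_dim R)" and ?b = "ereal_of_enat (krull_dim (R Quot (PIdl f)))"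
  have "f \<otimes> \<one> \<in> ideal_power R (max_ideal R) 1" using h(4) by (auto intro: ideal_prod.prod)
  then have f1: "f \<in> ideal_power R (max_ideal R) 1" using fc by simp
  have st: "?s + 1 \<le> ?t"
  proof -
    have "?s \<le> ?t - 1"
      unfolding fpt_def[of p "R Quot (PIdl f)"]
    proof (rule SUP_least)
      fix l assume "l \<in> {l. 0 \<le> l \<and> F_pure_pair p (R Quot (PIdl f)) l}"
      then have "ereal l + 1 \<le> ?t" using fpt_lift[OF h f1] by (simp add: one_ereal_def)
      then show "ereal l \<le> ?t - 1" by (cases ?t) (auto simp: one_ereal_def)
    qed
    then show ?thesis by (cases ?s; cases ?t) (auto simp: one_ereal_def)
  qed
  have "?a \<le> ereal_of_enat (eSuc (krull_dim (R Quot (PIdl f))))"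
    using krull_dim_le_quot[OF h(4)] by simp
  also have "\<dots> = ?b + 1" by (cases "krull_dim (R Quot (PIdl f))") (auto simp: eSuc_enat one_ereal_def)
  finally have ab: "?a \<le> ?b + 1" .
  show ?thesis
    unfolding dfpt_def
    using st ab by (cases "krull_dim R"; cases "krull_dim (R Quot (PIdl f))"; cases ?s; cases ?t)
      (auto simp: one_ereal_def)
qed

end

theorem proposition5p3:
  fixes R :: "('a, 'm) ring_scheme" and p :: nat and f :: 'a
  assumes "Factorial_Ring.prime p" and "has_characteristic R p"
    and "gorenstein_local_ring R" and "F_finite p R"
    and "f \<in> max_ideal R" and "nonzerodivisor R f"
    and "F_pure p (R Quot (PIdl\<^bsub>R\<^esub> f))"
  shows "F_pure p R
    \<and> fpt p (R Quot (PIdl\<^bsub>R\<^esub> f)) \<le> fpt p R - ereal_of_enat (ord_at_max R f)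
    \<and> dfpt p R \<le> dfpt p (R Quot (PIdl\<^bsub>R\<^esub> f))"
proof -
  have loc: "cring R" "noetherian_ring R" "\<exists>!I. maximalideal I R" and inj: "finite_self_injective_dimension R"
    using assms(3) by (auto simp: gorenstein_local_ring_def local_noetherian_ring_def)
  interpret R0: cring R by (rule loc(1))
  interpret R1: noetherian_ring R by (rule loc(2))
  interpret char_p_local_cring R p by unfold_locales (use loc(3) assms(1,2) in auto)
  show ?thesis
    using F_pure_lift[OF inj assms(4,6,5,7)] fpt_quot_le[OF inj assms(4,6,5)] dfpt_le_quot[OF inj assms(4,6,5)]
    by (intro conjI)
qed

end
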